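(* For all pointwise finite dimensional zigzag modules $V$ and $W$, $$d_I(V,W)\ \le\ d_b^{\mathbb{ZZ}}(\mathcal B(V),\mathcal B(W))\ \le\ \tfrac52\,d_I(V,W).$$
   Context: Fix a field $k$. For a poset $P$, a $P$-indexed module is a functor $M:P\to\mathrm{Vec}_k$, with internal maps $\varphi_M(a,b)$; it is pointwise finite dimensional (p.f.d.) if every $M_a$ is finite dimensional. An interval of $P$ is a nonempty subset that is convex and connected (any two elements are joined by a finite sequence in it of consecutively comparable elements). $I^{\mathcal J}$ is the module equal to $k$ on the interval $\mathcal J$ and $0$ elsewhere, with identity maps within $\mathcal J$ and zero maps otherwise. If $M\cong\bigoplus_{\mathcal J\in\mathcal B(M)}I^{\mathcal J}$ for a multiset $\mathcal B(M)$ of intervals, then $\mathcal B(M)$ is unique and is called the barcode of $M$, and $M$ is interval decomposable. In $\mathbb R^{op}\times\mathbb R$, $(a,b)\le(c,d)$ iff $c\le a$ and $b\le d$. $\mathbb{ZZ}=\{(i,j): i\in\mathbb Z,\ j\in\{i,i-1\}\}$ and $\mathbb U=\{(a,b)\in\mathbb R^2: a\le b\}$, both with the order induced from $\mathbb R^{op}\times\mathbb R$. A zigzag module is a $\mathbb{ZZ}$-indexed module; every p.f.d. zigzag module is interval decomposable (known structure theorem). The block extension $E(V)$ of a zigzag module $V$ is the $\mathbb U$-indexed module $E(V)_{(x,y)}=\varinjlim V|_{\{(i,j)\in\mathbb{ZZ}:\ i\ge x,\ j\le y\}}$ with internal maps induced by universality of colimits (the left Kan extension along $\mathbb{ZZ}\hookrightarrow\mathbb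 R^{op}\times\mathbb R$, restricted to $\mathbb U$). For p.f.d. $V$, $E(V)$ is interval decomposable. $\mathbb U$-indexed modules are regarded as $\mathbb R^{op}\times\mathbb R$-indexed modules by extending by $0$ outside $\mathbb U$. For an $\mathbb R^{op}\times\mathbb R$-indexed module $M$ and $\epsilon\ge0$, $M(\epsilon)_{(s,t)}=M_{(s-\epsilon,t+\epsilon)}$ and $\varphi_M^\epsilon:M\to M(\epsilon)$ is given by internal maps. $M,N$ are $\epsilon$-interleaved if there are $f:M\to N(\epsilon)$, $g:N\to M(\epsilon)$ with $g(\epsilon)\circ f=\varphi_M^{2\epsilon}$, $f(\epsilon)\circ g=\varphi_N^{2\epsilon}$; $d_I(M,N)$ is the infimum of such $\epsilon$. Intervals $\mathcal J,\mathcal K$ are $\epsilon$-interleaved if $I^{\mathcal J},I^{\mathcal K}$ are; $\mathcal J$ is $\epsilon$-trivial if $\varphi^\epsilon_{I^{\mathcal J}}=0$. For a barcode $\mathcal C$, $\mathcal C_\epsilon$ consists of its non-$\epsilon$-trivial intervals. An $\epsilon$-matching between barcodes $\mathcal C,\mathcal D$ is a bijection $\sigma$ from a sub-multiset $\mathcal C'\subseteq\mathcal C$ to a sub-multiset $\mathcal D'\subseteq\mathcal D$ with $\mathcal C_{2\epsilon}\subseteq\mathcal C'$, $\mathcal D_{2\epsilon}\subseteq\mathcal D'$, and $\mathcal J,\sigma(\mathcal J)$ $\epsilon$-interleaved for all $\mathcal J\in\mathcal C'$; $d_b(\mathcal C,\mathcal D)$ is the infimum of $\epsilon\ge 0$ for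 which an $\epsilon$-matching exists. For p.f.d. zigzag modules, by definition $d_I(V,W):=d_I(E(V),E(W))$ and $d_b^{\mathbb{ZZ}}(\mathcal B(V),\mathcal B(W)):=d_b(\mathcal B(E(V)),\mathcal B(E(W)))$. *)

theory Defs
  imports
    Complex_Main
    "HOL-Library.Function_Algebras"
    "HOL-Library.Extended_Nonnegative_Real"
begin

section \<open>The poset $\mathbb{R}^{op}\times\mathbb{R}$\<close>

type_synonym pt = "real \<times> real"

definition opp_le :: "pt \<Rightarrow> pt \<Rightarrow> bool" (infix \<open>\<preceq>\<close> 50) where
  "p \<preceq> q \<longleftrightarrow> fst q \<le> fst p \<and> snd p \<le> snd q"

definition ZZ :: "pt set" where
  "ZZ = {(real_of_int i, real_of_int j) | i j. j = i \<or> j = i - 1}"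

definition UU :: "pt set" where
  "UU = {(a, b). a \<le> b}"

definition interval :: "pt set \<Rightarrow> pt set \<Rightarrow> bool" where
  "interval P J \<longleftrightarrow> J \<noteq> {} \<and> J \<subseteq> P
     \<and> (\<forall>a\<in>J. \<forall>b\<in>P. \<forall>c\<in>J. a \<preceq> b \<and> b \<preceq> c \<longrightarrow> b \<in> J)
     \<and> (\<forall>a\<in>J. \<forall>b\<in>J. (a, b) \<in> {(x, y). x \<in> J \<and> y \<in> J \<and> (x \<preceq> y \<or> y \<preceq> x)}\<^sup>*)"


section \<open>Modules indexed by a subposet\<close>

text \<open>
  The vector spaces of a module are subspaces of one ambient vector space, given by the
  type \<open>'v\<close> with scalar multiplication \<open>scl\<close>. This is no restriction, since any family of vector
  spaces embeds into its direct sum. Only the values of \<open>fib\<close> and \<open>imap\<close> on the index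
  poset \<open>P\<close> (and of \<open>imap a b\<close> on \<open>fib a\<close>) are relevant.
\<close>

record ('k, 'v) pmod =
  scl :: "'k \<Rightarrow> 'v \<Rightarrow> 'v"
  fib :: "pt \<Rightarrow> 'v set"
  imap :: "pt \<Rightarrow> pt \<Rightarrow> 'v \<Rightarrow> 'v"

definition lin_map ::
  "('k \<Rightarrow> 'v \<Rightarrow> 'v) \<Rightarrow> ('k \<Rightarrow> 'w \<Rightarrow> 'w) \<Rightarrow> 'v set \<Rightarrow> 'w set \<Rightarrow> ('v::plus \<Rightarrow> 'w::plus) \<Rightarrow> bool" where
  "lin_map s t A B f \<longleftrightarrow> f ` A \<subseteq> B
     \<and> (\<forall>x\<in>A. \<forall>y\<in>A. f (x + y) = f x + f y)
     \<and> (\<forall>c. \<forall>x\<in>A. f (s c x) = t c (f x))"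

definition is_pmod :: "pt set \<Rightarrow> ('k::field, 'v::ab_group_add) pmod \<Rightarrow> bool" where
  "is_pmod P M \<longleftrightarrow> vector_space (scl M)
     \<and> (\<forall>a\<in>P. module.subspace (scl M) (fib M a))
     \<and> (\<forall>a\<in>P. \<forall>b\<in>P. a \<preceq> b \<longrightarrow> lin_map (scl M) (scl M) (fib M a) (fib M b) (imap M a b))
     \<and> (\<forall>a\<in>P. \<forall>v\<in>fib M a. imap M a a v = v)
     \<and> (\<forall>a\<in>P. \<forall>b\<in>P. \<forall>c\<in>P. a \<preceq> b \<and> b \<preceq> c \<longrightarrow>
          (\<forall>v\<in>fib M a. imap M b c (imap M a b v) = imap M a c v))"

definition pfd :: "pt set \<Rightarrow> ('k::field, 'v::ab_group_add) pmod \<Rightarrow> bool" where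
  "pfd P M \<longleftrightarrow> (\<forall>a\<in>P. \<exists>B. finite B \<and> fib M a = module.span (scl M) B)"

definition pmod_hom ::
  "pt set \<Rightarrow> ('k::field, 'v::ab_group_add) pmod \<Rightarrow> ('k, 'w::ab_group_add) pmod
     \<Rightarrow> (pt \<Rightarrow> 'v \<Rightarrow> 'w) \<Rightarrow> bool" where
  "pmod_hom P M N f \<longleftrightarrow>
     (\<forall>a\<in>P. lin_map (scl M) (scl N) (fib M a) (fib N a) (f a))
     \<and> (\<forall>a\<in>P. \<forall>b\<in>P. a \<preceq> b \<longrightarrow>
          (\<forall>v\<in>fib M a. f b (imap M a b v) = imap N a b (f a v)))"

definition pmod_iso ::
  "pt set \<Rightarrow> ('k::field, 'v::ab_group_add) pmod \<Rightarrow> ('k, 'w::ab_group_add) pmod \<Rightarrow> bool" where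
  "pmod_iso P M N \<longleftrightarrow> (\<exists>f. pmod_hom P M N f \<and> (\<forall>a\<in>P. bij_betw (f a) (fib M a) (fib N a)))"


section \<open>Direct sums, interval modules and barcodes\<close>

definition dsum :: "'i set \<Rightarrow> ('i \<Rightarrow> ('k, 'v::ab_group_add) pmod) \<Rightarrow> ('k, 'i \<Rightarrow> 'v) pmod" where
  "dsum I N =
    \<lparr> scl = (\<lambda>c f i. scl (N i) c (f i)),
      fib = (\<lambda>a. {f. (\<forall>i\<in>I. f i \<in> fib (N i) a) \<and> (\<forall>i. i \<notin> I \<longrightarrow> f i = 0) \<and> finite {i. f i \<noteq> 0}}),
      imap = (\<lambda>a b f i. if i \<in> I then imap (N i) a b (f i) else 0) \<rparr>"

definition interval_module :: "pt set \<Rightarrow> ('k::field, 'k) pmod" where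
  "interval_module J =
    \<lparr> scl = (*),
      fib = (\<lambda>a. if a \<in> J then UNIV else {0}),
      imap = (\<lambda>a b v. if a \<in> J \<and> b \<in> J then v else 0) \<rparr>"

text \<open>
  A multiset of intervals is given by its multiplicities. These are finite for every p.f.d. module,
  because the multiplicity of \<open>J\<close> is at most the dimension at any point of \<open>J\<close>. The underlying set
  may be infinite, so the library's type of finite multisets does not apply. The elements of a
  barcode, counted with multiplicity, are the pairs in \<open>bars\<close>.
\<close>

type_synonym barcode = "pt set \<Rightarrow> nat"

definition bars :: "barcode \<Rightarrow> (pt set \<times> nat) set" where
  "bars C = {(J, n). n < C J}"

definition is_barcode :: "pt set \<Rightarrow> ('k::field, 'v::ab_group_add) pmod \<Rightarrow> barcode \<Rightarrow> bool" where
  "is_barcode P M C \<longleftrightarrow> (\<forall>J. 0 < C J \<longrightarrow> interval P J)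
     \<and> pmod_iso P M (dsum (bars C) (\<lambda>(J, n). interval_module J))"

text \<open>The barcode is unique if it exists, so the choice is immaterial.\<close>

definition barcode_of :: "pt set \<Rightarrow> ('k::field, 'v::ab_group_add) pmod \<Rightarrow> barcode" where
  "barcode_of P M = (SOME C. is_barcode P M C)"


section \<open>Block extension\<close>

text \<open>
  The quotient of a vector space by a subspace \<open>K\<close> is realised, inside the same type, as the range
  of a linear idempotent with kernel \<open>K\<close>, with that idempotent as the quotient map.
\<close>

definition quot_map :: "('k::field \<Rightarrow> 'v \<Rightarrow> 'v) \<Rightarrow> 'v::ab_group_add set \<Rightarrow> 'v \<Rightarrow> 'v" where
  "quot_map s K = (SOME p. Vector_Spaces.linear s s p \<and> (\<forall>x. p (p x) = p x) \<and> {x. p x = 0} = K)"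

definition coprod_scl :: "('k, 'v) pmod \<Rightarrow> 'k \<Rightarrow> (pt \<Rightarrow> 'v) \<Rightarrow> (pt \<Rightarrow> 'v)" where
  "coprod_scl M c f = (\<lambda>q. scl M c (f q))"

definition coprod :: "('k, 'v::zero) pmod \<Rightarrow> pt set \<Rightarrow> (pt \<Rightarrow> 'v) set" where
  "coprod M D = {f. (\<forall>q\<in>D. f q \<in> fib M q) \<and> (\<forall>q. q \<notin> D \<longrightarrow> f q = 0) \<and> finite {q. f q \<noteq> 0}}"

definition inj_at :: "pt \<Rightarrow> 'v \<Rightarrow> pt \<Rightarrow> 'v::zero" where
  "inj_at q v = (\<lambda>r. if r = q then v else 0)"

definition colim_rel :: "('k::field, 'v::ab_group_add) pmod \<Rightarrow> pt set \<Rightarrow> (pt \<Rightarrow> 'v) set" where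
  "colim_rel M D = module.span (coprod_scl M)
     {inj_at b (imap M a b v) - inj_at a v | a b v. a \<in> D \<and> b \<in> D \<and> a \<preceq> b \<and> v \<in> fib M a}"

definition colim_map :: "('k::field, 'v::ab_group_add) pmod \<Rightarrow> pt set \<Rightarrow> (pt \<Rightarrow> 'v) \<Rightarrow> (pt \<Rightarrow> 'v)" where
  "colim_map M D = quot_map (coprod_scl M) (colim_rel M D)"

definition colim :: "('k::field, 'v::ab_group_add) pmod \<Rightarrow> pt set \<Rightarrow> (pt \<Rightarrow> 'v) set" where
  "colim M D = colim_map M D ` coprod M D"

definition below :: "pt \<Rightarrow> pt set" where
  "below p = {q \<in> ZZ. q \<preceq> p}"

text \<open>
  Since \<open>below p \<subseteq> below q\<close> for \<open>p \<preceq> q\<close>, the map between the colimits induced by universality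
  sends the class of a representative to the class of the same representative; on the chosen
  representatives it is the quotient map at \<open>q\<close> (see \<open>block_ext_imap\<close> below).
\<close>

definition block_ext :: "('k::field, 'v::ab_group_add) pmod \<Rightarrow> ('k, pt \<Rightarrow> 'v) pmod" where
  "block_ext V =
    \<lparr> scl = coprod_scl V,
      fib = (\<lambda>p. colim V (below p)),
      imap = (\<lambda>p q. colim_map V (below q)) \<rparr>"

definition extend_zero :: "pt set \<Rightarrow> ('k, 'v::zero) pmod \<Rightarrow> ('k, 'v) pmod" where
  "extend_zero P M =
    M \<lparr> fib := (\<lambda>a. if a \<in> P then fib M a else {0}),
        imap := (\<lambda>a b v. if a \<in> P \<and> b \<in> P then imap M a b v else 0) \<rparr>"


section \<open>Interleavings and matchings\<close>

definition shift_pt :: "real \<Rightarrow> pt \<Rightarrow> pt" where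
  "shift_pt e p = (fst p - e, snd p + e)"

definition shift :: "real \<Rightarrow> ('k, 'v) pmod \<Rightarrow> ('k, 'v) pmod" where
  "shift e M =
    M \<lparr> fib := (\<lambda>a. fib M (shift_pt e a)),
        imap := (\<lambda>a b. imap M (shift_pt e a) (shift_pt e b)) \<rparr>"

definition shift_map :: "real \<Rightarrow> ('k, 'v) pmod \<Rightarrow> pt \<Rightarrow> 'v \<Rightarrow> 'v" where
  "shift_map e M a = imap M a (shift_pt e a)"

definition interleaved ::
  "real \<Rightarrow> ('k::field, 'v::ab_group_add) pmod \<Rightarrow> ('k, 'w::ab_group_add) pmod \<Rightarrow> bool" where
  "interleaved e M N \<longleftrightarrow> (\<exists>f g. pmod_hom UNIV M (shift e N) f \<and> pmod_hom UNIV N (shift e M) g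
     \<and> (\<forall>a. \<forall>v\<in>fib M a. g (shift_pt e a) (f a v) = shift_map (2 * e) M a v)
     \<and> (\<forall>a. \<forall>w\<in>fib N a. f (shift_pt e a) (g a w) = shift_map (2 * e) N a w))"

definition interleaving_dist ::
  "('k::field, 'v::ab_group_add) pmod \<Rightarrow> ('k, 'w::ab_group_add) pmod \<Rightarrow> ennreal" where
  "interleaving_dist M N = Inf {ennreal e | e. 0 \<le> e \<and> interleaved e M N}"

definition intervals_interleaved :: "'k::field itself \<Rightarrow> real \<Rightarrow> pt set \<Rightarrow> pt set \<Rightarrow> bool" where
  "intervals_interleaved _ e J K \<longleftrightarrow>
     interleaved e (interval_module J :: ('k, 'k) pmod) (interval_module K :: ('k, 'k) pmod)"

definition trivial_interval :: "'k::field itself \<Rightarrow> real \<Rightarrow> pt set \<Rightarrow> bool" where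
  "trivial_interval _ e J \<longleftrightarrow>
     (\<forall>a. \<forall>v\<in>fib (interval_module J :: ('k, 'k) pmod) a.
        shift_map e (interval_module J :: ('k, 'k) pmod) a v = 0)"

definition is_matching ::
  "'k::field itself \<Rightarrow> real \<Rightarrow> barcode \<Rightarrow> barcode \<Rightarrow> (pt set \<times> nat) set \<Rightarrow> (pt set \<times> nat) set
     \<Rightarrow> (pt set \<times> nat \<Rightarrow> pt set \<times> nat) \<Rightarrow> bool" where
  "is_matching k e C D C' D' \<sigma> \<longleftrightarrow>
     C' \<subseteq> bars C \<and> D' \<subseteq> bars D \<and> bij_betw \<sigma> C' D'
     \<and> {x \<in> bars C. \<not> trivial_interval k (2 * e) (fst x)} \<subseteq> C'
     \<and> {y \<in> bars D. \<not> trivial_interval k (2 * e) (fst y)} \<subseteq> D'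
     \<and> (\<forall>x\<in>C'. intervals_interleaved k e (fst x) (fst (\<sigma> x)))"

definition bottleneck_dist :: "'k::field itself \<Rightarrow> barcode \<Rightarrow> barcode \<Rightarrow> ennreal" where
  "bottleneck_dist k C D = Inf {ennreal e | e. 0 \<le> e \<and> (\<exists>C' D' \<sigma>. is_matching k e C D C' D' \<sigma>)}"


section \<open>Distances between zigzag modules\<close>

definition zz_interleaving_dist ::
  "('k::field, 'v::ab_group_add) pmod \<Rightarrow> ('k, 'w::ab_group_add) pmod \<Rightarrow> ennreal" where
  "zz_interleaving_dist V W =
     interleaving_dist (extend_zero UU (block_ext V)) (extend_zero UU (block_ext W))"

definition zz_bottleneck_dist ::
  "('k::field, 'v::ab_group_add) pmod \<Rightarrow> ('k, 'w::ab_group_add) pmod \<Rightarrow> ennreal" where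
  "zz_bottleneck_dist V W =
     bottleneck_dist TYPE('k) (barcode_of UU (block_ext V)) (barcode_of UU (block_ext W))"


section \<open>The construction of the block extension is a colimit\<close>

lemma vector_space_coprod_scl:
  assumes "vector_space (scl M)"
  shows "vector_space (coprod_scl (M :: ('k::field, 'v::ab_group_add) pmod))"
proof -
  interpret vector_space "scl M" by fact
  show ?thesis
    by unfold_locales
      (auto simp: coprod_scl_def fun_eq_iff scale_right_distrib scale_left_distrib)
qed

lemma quot_map:
  assumes "vector_space s" "module.subspace s K"
  shows "Vector_Spaces.linear s s (quot_map s K)"
    and "quot_map s K (quot_map s K x) = quot_map s K x"
    and "quot_map s K x = 0 \<longleftrightarrow> x \<in> K"
proof -
  interpret vector_space s by fact
  interpret vector_space_pair s s by unfold_locales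
  have "Vector_Spaces.linear s s (\<lambda>x. x)"
    by (simp add: linear_ident)
  then obtain g where g: "g ` UNIV \<subseteq> K" "Vector_Spaces.linear s s g" "\<forall>v\<in>K. g v = v"
    using linear_exists_left_inverse_on[of "\<lambda>x. x" K] assms(2) by (auto simp: inj_on_def)
  let ?p = "\<lambda>x. x - g x"
  have "Vector_Spaces.linear s s ?p"
    by (intro linear_compose_sub linear_ident g(2))
  moreover have "?p (?p x) = ?p x" for x
  proof -
    have "x - ?p x \<in> K" using g(1) by auto
    moreover have "g (?p x) = g x - g (g x)" using linear_diff[OF g(2)] by simp
    moreover have "g (g x) = g x" using g by blast
    ultimately show ?thesis by simp
  qed
  moreover have "{x. ?p x = 0} = K"
  proof -
    have "g x \<in> K" for x using g(1) by auto
    then show ?thesis using g(3) by (auto, metis)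
  qed
  ultimately have "\<exists>p. Vector_Spaces.linear s s p \<and> (\<forall>x. p (p x) = p x) \<and> {x. p x = 0} = K"
    by blast
  then have "Vector_Spaces.linear s s (quot_map s K) \<and> (\<forall>x. quot_map s K (quot_map s K x) = quot_map s K x)
      \<and> {x. quot_map s K x = 0} = K"
    unfolding quot_map_def by (rule someI_ex)
  then show "Vector_Spaces.linear s s (quot_map s K)"
    and "quot_map s K (quot_map s K x) = quot_map s K x"
    and "quot_map s K x = 0 \<longleftrightarrow> x \<in> K"
    by blast+
qed

lemma coprod_outside: "f \<in> coprod M D \<Longrightarrow> q \<notin> D \<Longrightarrow> f q = 0"
  unfolding coprod_def by blast

locale diagram =
  fixes M :: "('k::field, 'v::ab_group_add) pmod" and D :: "pt set"
  assumes is_pmod: "is_pmod D M"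
begin

lemma vs: "vector_space (scl M)"
  using is_pmod by (simp add: is_pmod_def)

sublocale M: vector_space "scl M" by (rule vs)
sublocale C: vector_space "coprod_scl M" by (rule vector_space_coprod_scl[OF vs])

lemma sub: "a \<in> D \<Longrightarrow> M.subspace (fib M a)"
  using is_pmod by (simp add: is_pmod_def)

lemma imap_in: "a \<in> D \<Longrightarrow> b \<in> D \<Longrightarrow> a \<preceq> b \<Longrightarrow> v \<in> fib M a \<Longrightarrow> imap M a b v \<in> fib M b"
  using is_pmod unfolding is_pmod_def lin_map_def by blast

lemma subspace_coprod: "C.subspace (coprod M D)"
proof (rule C.subspaceI)
  show "0 \<in> coprod M D"
    using sub by (auto simp: coprod_def M.subspace_0)
next
  fix f g assume "f \<in> coprod M D" "g \<in> coprod M D"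
  moreover have "finite {q. (f + g) q \<noteq> 0}" if "finite {q. f q \<noteq> 0}" "finite {q. g q \<noteq> 0}"
    by (rule finite_subset[OF _ finite_UnI[OF that]]) auto
  ultimately show "f + g \<in> coprod M D"
    using sub by (auto simp: coprod_def M.subspace_add)
next
  fix c f assume "f \<in> coprod M D"
  moreover have "finite {q. coprod_scl M c f q \<noteq> 0}" if "finite {q. f q \<noteq> 0}"
    by (rule finite_subset[OF _ that]) (auto simp: coprod_scl_def)
  ultimately show "coprod_scl M c f \<in> coprod M D"
    using sub by (auto simp: coprod_def coprod_scl_def M.subspace_scale)
qed

lemma inj_at_coprod: "a \<in> D \<Longrightarrow> v \<in> fib M a \<Longrightarrow> inj_at a v \<in> coprod M D"
  using sub M.subspace_0
  by (auto simp: coprod_def inj_at_def intro: finite_subset[of _ "{a}"])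

lemma subspace_rel: "C.subspace (colim_rel M D)"
  by (simp add: colim_rel_def)

lemma rel_coprod: "colim_rel M D \<subseteq> coprod M D"
  unfolding colim_rel_def
  by (rule C.span_minimal)
    (auto intro!: C.subspace_diff subspace_coprod inj_at_coprod imap_in)

lemmas colim_map =
  quot_map[OF C.vector_space_axioms subspace_rel, folded colim_map_def]

lemma map_eq_iff: "colim_map M D x = colim_map M D y \<longleftrightarrow> x - y \<in> colim_rel M D"
proof -
  interpret Vector_Spaces.linear "coprod_scl M" "coprod_scl M" "colim_map M D" by (rule colim_map)
  show ?thesis using colim_map(3)[of "x - y"] by (simp add: diff)
qed

lemma map_diff_rel: "colim_map M D x - x \<in> colim_rel M D"
  using colim_map(2) by (simp flip: map_eq_iff)

lemma map_coprod: "x \<in> coprod M D \<Longrightarrow> colim_map M D x \<in> coprod M D"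
  using map_diff_rel[of x] rel_coprod C.subspace_add[OF subspace_coprod, of x "colim_map M D x - x"]
  by auto

lemma colim_subspace: "C.subspace (colim M D)"
proof -
  interpret Vector_Spaces.linear "coprod_scl M" "coprod_scl M" "colim_map M D" by (rule colim_map)
  show ?thesis unfolding colim_def by (rule subspace_image) (rule subspace_coprod)
qed

lemma cocone:
  assumes "a \<in> D" "b \<in> D" "a \<preceq> b" "v \<in> fib M a"
  shows "colim_map M D (inj_at b (imap M a b v)) = colim_map M D (inj_at a v)"
  unfolding map_eq_iff colim_rel_def using assms by (intro C.span_base) blast

lemma coprod_induct:
  assumes "f \<in> coprod M D"
  shows "f = (\<Sum>a | a \<in> D \<and> f a \<noteq> 0. inj_at a (f a))"
proof
  fix q
  have *: "(sum g A) q = (\<Sum>a\<in>A. g a q)" if "finite A" for g :: "pt \<Rightarrow> pt \<Rightarrow> 'v" and A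
    using that by induction auto
  have fin: "finite {a \<in> D. f a \<noteq> 0}"
    using assms by (auto simp: coprod_def intro: finite_subset[of _ "{q. f q \<noteq> 0}"])
  show "f q = (\<Sum>a | a \<in> D \<and> f a \<noteq> 0. inj_at a (f a)) q"
    using assms by (cases "q \<in> D") (simp_all add: * fin inj_at_def coprod_outside)
qed

lemma universal:
  fixes T :: "'w::ab_group_add set"
  assumes t: "vector_space t" "module.subspace t T"
    and lin: "\<And>a. a \<in> D \<Longrightarrow> lin_map (scl M) t (fib M a) T (g a)"
    and compat: "\<And>a b v. \<lbrakk>a \<in> D; b \<in> D; a \<preceq> b; v \<in> fib M a\<rbrakk> \<Longrightarrow> g b (imap M a b v) = g a v"
  shows "\<exists>u. lin_map (coprod_scl M) t (colim M D) T u
           \<and> (\<forall>a\<in>D. \<forall>v\<in>fib M a. u (colim_map M D (inj_at a v)) = g a v)"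
    and "\<lbrakk>lin_map (coprod_scl M) t (colim M D) T u; lin_map (coprod_scl M) t (colim M D) T u';
          \<And>a v. a \<in> D \<Longrightarrow> v \<in> fib M a \<Longrightarrow> u (colim_map M D (inj_at a v)) = g a v;
          \<And>a v. a \<in> D \<Longrightarrow> v \<in> fib M a \<Longrightarrow> u' (colim_map M D (inj_at a v)) = g a v;
          x \<in> colim M D\<rbrakk> \<Longrightarrow> u x = u' x"
proof -
  interpret T: vector_space t by (rule t)
  define S where "S f = {a \<in> D. f a \<noteq> 0}" for f :: "pt \<Rightarrow> 'v"
  define G where "G f = (\<Sum>a\<in>S f. g a (f a))" for f
  have finS: "finite (S f)" if "f \<in> coprod M D" for f
    using that by (auto simp: coprod_def S_def intro: finite_subset[of _ "{q. f q \<noteq> 0}"])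
  have g0: "g a 0 = 0" if "a \<in> D" for a
  proof -
    have "0 \<in> fib M a" using sub[OF that] by (rule M.subspace_0)
    then have "g a (0 + 0) = g a 0 + g a 0"
      using lin[OF that] unfolding lin_map_def by blast
    then show ?thesis by simp
  qed
  have gadd: "g a (x + y) = g a x + g a y" if "a \<in> D" "x \<in> fib M a" "y \<in> fib M a" for a x y
    using lin[OF that(1)] that unfolding lin_map_def by blast
  have gscl: "g a (scl M c x) = t c (g a x)" if "a \<in> D" "x \<in> fib M a" for a x c
    using lin[OF that(1)] that unfolding lin_map_def by blast
  have gT: "g a x \<in> T" if "a \<in> D" "x \<in> fib M a" for a x
    using lin[OF that(1)] that unfolding lin_map_def by blast
  have Gsup: "G f = (\<Sum>a\<in>A. g a (f a))" if "finite A" "S f \<subseteq> A" "A \<subseteq> D" for f A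
    unfolding G_def by (rule sum.mono_neutral_left) (use that g0 in \<open>auto simp: S_def\<close>)
  have fibD: "f a \<in> fib M a" if "f \<in> coprod M D" "a \<in> D" for f a
    using that by (auto simp: coprod_def)
  have Gadd: "G (x + y) = G x + G y" if xy: "x \<in> coprod M D" "y \<in> coprod M D" for x y
  proof -
    let ?A = "S x \<union> S y"
    have A: "finite ?A" "?A \<subseteq> D" "S (x + y) \<subseteq> ?A" using finS xy by (auto simp: S_def)
    have "G (x + y) = (\<Sum>a\<in>?A. g a (x a + y a))" using Gsup[OF A(1,3,2)] by simp
    also have "\<dots> = (\<Sum>a\<in>?A. g a (x a) + g a (y a))"
      by (rule sum.cong[OF refl], rule gadd) (use A(2) xy fibD in blast)+
    also have "\<dots> = G x + G y"
      using Gsup[of ?A x] Gsup[of ?A y] A by (simp add: sum.distrib)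
    finally show ?thesis .
  qed
  have Gscl: "G (coprod_scl M c x) = t c (G x)" if x: "x \<in> coprod M D" for c x
  proof -
    have "S (coprod_scl M c x) \<subseteq> S x" by (auto simp: S_def coprod_scl_def)
    then have "G (coprod_scl M c x) = (\<Sum>a\<in>S x. g a (scl M c (x a)))"
      using Gsup[of "S x" "coprod_scl M c x"] finS[OF x] by (auto simp: S_def coprod_scl_def)
    also have "\<dots> = (\<Sum>a\<in>S x. t c (g a (x a)))"
      by (rule sum.cong[OF refl], rule gscl) (use x fibD in \<open>auto simp: S_def\<close>)
    finally show ?thesis by (simp add: G_def T.scale_sum_right)
  qed
  have GT: "G x \<in> T" if "x \<in> coprod M D" for x
    unfolding G_def by (rule T.subspace_sum[OF t(2)]) (use that fibD gT in \<open>auto simp: S_def\<close>)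
  have Ginj: "G (inj_at a v) = g a v" if "a \<in> D" "v \<in> fib M a" for a v
  proof -
    have "S (inj_at a v) \<subseteq> {a}" by (auto simp: S_def inj_at_def)
    then have "G (inj_at a v) = g a (inj_at a v a)" using Gsup[of "{a}" "inj_at a v"] that by simp
    then show ?thesis by (simp add: inj_at_def)
  qed
  have ker: "colim_rel M D \<subseteq> {x \<in> coprod M D. G x = 0}"
    unfolding colim_rel_def
  proof (rule C.span_minimal)
    show "C.subspace {x \<in> coprod M D. G x = 0}"
      using subspace_coprod Gadd Gscl Gsup[of "{}" 0]
      by (auto intro!: C.subspaceI simp: C.subspace_0 C.subspace_add C.subspace_scale S_def)
  next
    have "G (inj_at b (imap M a b v) - inj_at a v) = 0"
      "inj_at b (imap M a b v) - inj_at a v \<in> coprod M D"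
      if *: "a \<in> D" "b \<in> D" "a \<preceq> b" "v \<in> fib M a" for a b v
    proof -
      let ?x = "inj_at b (imap M a b v)" and ?y = "inj_at a v"
      have in': "?x \<in> coprod M D" "?y \<in> coprod M D"
        using * by (auto intro: inj_at_coprod imap_in)
      then show d: "?x - ?y \<in> coprod M D" by (rule C.subspace_diff[OF subspace_coprod])
      have "G (?x - ?y + ?y) = G (?x - ?y) + G ?y" by (rule Gadd[OF d in'(2)])
      moreover have "G ?x = G ?y" using * by (simp add: Ginj imap_in compat)
      ultimately show "G (?x - ?y) = 0" by simp
    qed
    then show "{inj_at b (imap M a b v) - inj_at a v |a b v.
        a \<in> D \<and> b \<in> D \<and> a \<preceq> b \<and> v \<in> fib M a} \<subseteq> {x \<in> coprod M D. G x = 0}"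
      by blast
  qed
  have Gmap: "G (colim_map M D x) = G x" if x: "x \<in> coprod M D" for x
  proof -
    have "colim_map M D x - x \<in> coprod M D" "G (colim_map M D x - x) = 0"
      using map_diff_rel ker by auto
    with Gadd[OF this(1) x] show ?thesis by simp
  qed
  have sub_co: "colim M D \<subseteq> coprod M D"
    using map_coprod by (auto simp: colim_def)
  show "\<exists>u. lin_map (coprod_scl M) t (colim M D) T u
           \<and> (\<forall>a\<in>D. \<forall>v\<in>fib M a. u (colim_map M D (inj_at a v)) = g a v)"
  proof (intro exI conjI)
    show "lin_map (coprod_scl M) t (colim M D) T G"
      unfolding lin_map_def using sub_co GT Gadd Gscl by blast
    show "\<forall>a\<in>D. \<forall>v\<in>fib M a. G (colim_map M D (inj_at a v)) = g a v"
      by (simp add: Gmap inj_at_coprod Ginj)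
  qed
  assume u: "lin_map (coprod_scl M) t (colim M D) T u" "lin_map (coprod_scl M) t (colim M D) T u'"
    and ug: "\<And>a v. a \<in> D \<Longrightarrow> v \<in> fib M a \<Longrightarrow> u (colim_map M D (inj_at a v)) = g a v"
      "\<And>a v. a \<in> D \<Longrightarrow> v \<in> fib M a \<Longrightarrow> u' (colim_map M D (inj_at a v)) = g a v"
    and x: "x \<in> colim M D"
  from x obtain f where f: "f \<in> coprod M D" "x = colim_map M D f" by (auto simp: colim_def)
  interpret L: Vector_Spaces.linear "coprod_scl M" "coprod_scl M" "colim_map M D" by (rule colim_map)
  have sum_u: "w (\<Sum>a\<in>A. h a) = (\<Sum>a\<in>A. w (h a))"
    if "finite A" "\<And>a. a \<in> A \<Longrightarrow> h a \<in> colim M D" "lin_map (coprod_scl M) t (colim M D) T w" for w h A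
    using that
  proof (induction A)
    case empty
    have "w (0 + 0) = w 0 + w 0"
      using empty.prems(2) C.subspace_0[OF colim_subspace] unfolding lin_map_def by blast
    then have "w 0 = 0" by simp
    then show ?case by (simp only: sum.empty)
  next
    case (insert b A)
    have "(\<Sum>a\<in>A. h a) \<in> colim M D"
      using insert by (intro C.subspace_sum[OF colim_subspace]) auto
    then have "w (h b + (\<Sum>a\<in>A. h a)) = w (h b) + w (\<Sum>a\<in>A. h a)"
      using insert.prems unfolding lin_map_def by blast
    moreover have "w (\<Sum>a\<in>A. h a) = (\<Sum>a\<in>A. w (h a))" using insert by blast
    ultimately show ?case by (simp only: sum.insert[OF insert.hyps])
  qed
  have xs: "x = (\<Sum>a\<in>S f. colim_map M D (inj_at a (f a)))"
    using arg_cong[OF coprod_induct[OF f(1)], of "colim_map M D"] f(2)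
    by (simp add: L.sum S_def)
  have "colim_map M D (inj_at a (f a)) \<in> colim M D" if "a \<in> S f" for a
    using that inj_at_coprod fibD[OF f(1)] by (auto simp: S_def colim_def)
  then have ws: "w x = (\<Sum>a\<in>S f. w (colim_map M D (inj_at a (f a))))"
    if "lin_map (coprod_scl M) t (colim M D) T w" for w
    unfolding xs using sum_u[OF finS[OF f(1)] _ that] by simp
  have eq: "u (colim_map M D (inj_at a (f a))) = u' (colim_map M D (inj_at a (f a)))" if "a \<in> S f" for a
  proof -
    have "a \<in> D" using that by (simp add: S_def)
    then show ?thesis using ug fibD[OF f(1)] by metis
  qed
  show "u x = u' x"
    unfolding ws[OF u(1)] ws[OF u(2)] by (rule sum.cong[OF refl eq])
qed

end

lemma below_mono: "p \<preceq> q \<Longrightarrow> below p \<subseteq> below q"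
  by (auto simp: below_def opp_le_def)

lemma is_pmod_subset: "is_pmod P M \<Longrightarrow> D \<subseteq> P \<Longrightarrow> is_pmod D M"
  unfolding is_pmod_def by (intro conjI) blast+

lemma diagram_below: "is_pmod ZZ V \<Longrightarrow> diagram V (below p)"
  by (rule diagram.intro, erule is_pmod_subset) (auto simp: below_def)

lemma colim_rel_mono:
  assumes "is_pmod ZZ V" "p \<preceq> q"
  shows "colim_rel V (below p) \<subseteq> colim_rel V (below q)"
proof -
  interpret diagram V "below p" using assms(1) by (rule diagram_below)
  show ?thesis unfolding colim_rel_def
    using below_mono[OF assms(2)] by (intro C.span_mono) blast
qed

lemma coprod_mono:
  assumes "is_pmod ZZ V" "p \<preceq> q"
  shows "coprod V (below p) \<subseteq> coprod V (below q)"
proof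
  interpret diagram V "below q" using assms(1) by (rule diagram_below)
  fix f assume f: "f \<in> coprod V (below p)"
  have "f a \<in> fib V a" if "a \<in> below q" for a
    using f M.subspace_0[OF sub[OF that]] coprod_outside[OF f]
    by (cases "a \<in> below p") (simp_all add: coprod_def)
  then show "f \<in> coprod V (below q)"
    using f below_mono[OF assms(2)] unfolding coprod_def by blast
qed

lemma block_ext_imap:
  assumes "is_pmod ZZ V" "p \<preceq> q"
  shows "imap (block_ext V) p q (colim_map V (below p) x) = colim_map V (below q) x"
proof -
  interpret p: diagram V "below p" using assms(1) by (rule diagram_below)
  interpret q: diagram V "below q" using assms(1) by (rule diagram_below)
  show ?thesis
    using p.map_diff_rel[of x] colim_rel_mono[OF assms]
    by (simp add: block_ext_def q.map_eq_iff subset_iff)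
qed

lemma is_pmod_block_ext:
  assumes "is_pmod ZZ V"
  shows "is_pmod P (block_ext V)"
proof -
  have d: "diagram V (below p)" for p using assms by (rule diagram_below)
  have "vector_space (coprod_scl V)"
    using assms by (simp add: is_pmod_def vector_space_coprod_scl)
  moreover have "module.subspace (coprod_scl V) (colim V (below p))" for p
    using d by (rule diagram.colim_subspace)
  moreover have "lin_map (coprod_scl V) (coprod_scl V) (colim V (below p)) (colim V (below q))
      (colim_map V (below q))" if "p \<preceq> q" for p q
  proof -
    interpret L: Vector_Spaces.linear "coprod_scl V" "coprod_scl V" "colim_map V (below q)"
      by (rule diagram.colim_map[OF d])
    have "colim_map V (below p) x \<in> coprod V (below q)" if "x \<in> coprod V (below p)" for x
      using diagram.map_coprod[OF d that] coprod_mono[OF assms \<open>p \<preceq> q\<close>] by blast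
    then show ?thesis
      by (auto simp: lin_map_def colim_def L.add L.scale)
  qed
  moreover have "imap (block_ext V) p q (imap (block_ext V) r p v) = imap (block_ext V) r q v"
    if "r \<preceq> p" "p \<preceq> q" for p q r v
    using block_ext_imap[OF assms that(2)] by (simp add: block_ext_def del: split_paired_All)
  moreover have "colim_map V (below p) v = v" if "v \<in> colim V (below p)" for p v
    using that diagram.colim_map(2)[OF d, of p] by (auto simp: colim_def)
  ultimately show ?thesis
    unfolding is_pmod_def block_ext_def pmod.simps by blast
qed

end

theory Submission
  imports Defs
begin

text \<open>
  Pointwise, a zigzag module has a basis that every structure map sends to basis vectors or to zero:
  each space carries the chain of images and kernels coming from one direction, a basis at the origin
  adapted to the chains of both directions can be continued step by step both ways. Following basis
  vectors gives threads, and the colimits of the block extension are computed thread by thread, so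
  that the block extension is a sum of interval modules of blocks. Any other interval decomposition
  also consists of blocks, because middle exactness passes to direct summands.

  The first inequality glues interleavings of matched intervals. For the second one, the matrix of an
  interleaving of barcodes is inspected as in Bjerkevik's work: between blocks of one type, each
  described by two extended real coordinates, a nonzero morphism to an \<open>\<epsilon>\<close>-shift raises no coordinate
  by more than \<open>\<epsilon>\<close>. Hence composites through intervals that are far from both ends lower the sum of the
  coordinates, so the relevant matrix is unitriangular, and its rank gives Hall's condition. This even
  yields matchings for every parameter above that of the interleaving, so the two distances agree.
\<close>

section \<open>Bases adapted to chains of subspaces\<close>

text \<open>One starting position suffices because two chains of subspaces always have a common
  adapted basis, while three need not; every later step carries only the chain that comes from
  ahead. \<open>barcode_of\<close> is a choice, so the chosen intervals are tied to the threads only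
  by an isomorphism. This is why the shape of an interval is recovered from a property of small
  squares. Three obstacles shape the matrix argument. An end of a block may be open or closed, which
  its coordinate does not record; passing from the parameter \<open>e\<close> of the interleaving to
  an arbitrary \<open>d > e\<close> absorbs this. Coordinates may be infinite, so they are clipped
  at a large real number before being added. And an entry of the composite can be read off only at a
  point where the first bar and the shifted second bar are both present; if there is none, both
  coordinates drop, provided that the bars survive a shift by \<open>2 * d\<close>. Along nonzero
  entries a side may change from closed to open but never back, so a path that returns to its
  initial type has never left it. This separates the four types of blocks.\<close>

definition adapted :: "('k::field \<Rightarrow> 'v \<Rightarrow> 'v) \<Rightarrow> 'v::ab_group_add set \<Rightarrow> 'v set \<Rightarrow> bool" where
  "adapted s C U \<longleftrightarrow> U \<inter> module.span s C \<subseteq> module.span s (C \<inter> U)"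

context vector_space
begin


text \<open>The ambient space may be infinite-dimensional, so finiteness comes from
  \<open>F\<close>; a basis of \<open>S\<close> with one vector outside \<open>S\<close> is still
  independent in \<open>T\<close>.\<close>

lemma dim_psubset_finite_span:
  assumes S: "subspace S" "S \<subset> T" and T: "T \<subseteq> span F" "finite F"
  shows "dim S < dim T"
proof -
  obtain B where B: "B \<subseteq> S" "independent B" "S \<subseteq> span B" "card B = dim S"
    using basis_exists by blast
  obtain v where v: "v \<in> T" "v \<notin> S" using S by blast
  have "v \<notin> span B" using v(2) span_minimal[OF B(1) S(1)] by blast
  then have ind: "independent (insert v B)" using B(2) by (rule independent_insertI)
  obtain B' where B': "insert v B \<subseteq> B'" "B' \<subseteq> T" "independent B'" "T \<subseteq> span B'"
    using maximal_independent_subset_extend[of "insert v B" T] ind v(1) B(1) S(2) by blast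
  have fin: "finite B'" using independent_span_bound[OF T(2) B'(3)] B'(2) T(1) by blast
  have "dim T = card B'" by (rule dim_unique) (use B' in auto)
  moreover have "v \<notin> B" using \<open>v \<notin> span B\<close> span_base by blast
  then have "card B < card (insert v B)" using finite_subset[OF B'(1) fin] by simp
  moreover have "card (insert v B) \<le> card B'" using card_mono[OF fin B'(1)] .
  ultimately show ?thesis using B(4) by simp
qed

text \<open>Subtracting a multiple of \<open>v\<close>, which lies in \<open>U\<close>, brings a
  vector of \<open>U\<close> from the new span back into the old one.\<close>

lemma adapted_insert:
  assumes "subspace U" "adapted scale C U" "v \<in> U"
  shows "adapted scale (insert v C) U"
  unfolding adapted_def
proof
  fix x assume x: "x \<in> U \<inter> span (insert v C)"
  then obtain k where k: "x - k *s v \<in> span C" using span_breakdown_eq by blast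
  have "x - k *s v \<in> U" using x assms by (auto intro: subspace_diff subspace_scale)
  then have "x - k *s v \<in> span (C \<inter> U)" using k assms(2) by (auto simp: adapted_def)
  then have "x \<in> span (insert v (C \<inter> U))" using span_breakdown_eq by blast
  then show "x \<in> span (insert v C \<inter> U)" using assms(3) by (simp add: Int_insert_left)
qed

text \<open>Meant for \<open>v\<close> outside \<open>U\<close>: when the larger span meets
  \<open>U\<close> only in the old span, the old adapted part still suffices.\<close>

lemma adapted_insert_small:
  assumes "adapted scale C U" "U \<inter> span (insert v C) \<subseteq> span C"
  shows "adapted scale (insert v C) U"
  using assms span_mono[of "C \<inter> U" "insert v C \<inter> U"] unfolding adapted_def by blast

text \<open>
  Extending \<open>B\<close> by one vector at a time, the vector being chosen first in the smallest
  unspanned member \<open>L\<close> of the chain \<open>\<L>\<close>, and inside \<open>L\<close> in the smallest unspanned \<open>U \<inter> L\<close>.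
\<close>

lemma adapted_basis_extension:
  assumes W: "subspace W" "W \<subseteq> span F" "finite F"
    and R: "\<And>U. U \<in> \<R> \<Longrightarrow> subspace U \<and> U \<subseteq> W" "\<And>U U'. U \<in> \<R> \<Longrightarrow> U' \<in> \<R> \<Longrightarrow> U \<subseteq> U' \<or> U' \<subseteq> U"
    and L: "\<And>U. U \<in> \<L> \<Longrightarrow> subspace U \<and> U \<subseteq> W" "\<And>U U'. U \<in> \<L> \<Longrightarrow> U' \<in> \<L> \<Longrightarrow> U \<subseteq> U' \<or> U' \<subseteq> U"
    and B: "independent B" "B \<subseteq> W" "\<And>U. U \<in> \<R> \<Longrightarrow> adapted scale B U" "\<And>U. U \<in> \<L> \<Longrightarrow> adapted scale B U"
      "\<And>U. U \<in> \<L> \<Longrightarrow> U \<subseteq> span B \<or> B \<subseteq> U"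
  shows "\<exists>C. B \<subseteq> C \<and> independent C \<and> C \<subseteq> W \<and> span C = W \<and>
             (\<forall>U\<in>\<R>. adapted scale C U) \<and> (\<forall>U\<in>\<L>. adapted scale C U)"
proof -
  \<comment> \<open>The last clause keeps \<open>C\<close> inside every member of
    \<open>\<L>\<close> that it does not yet span; this is what confines \<open>span ?C\<close> to
    \<open>L0\<close> below.\<close>
  define Q where "Q C \<longleftrightarrow> B \<subseteq> C \<and> independent C \<and> C \<subseteq> W \<and>
             (\<forall>U\<in>\<R>. adapted scale C U) \<and> (\<forall>U\<in>\<L>. adapted scale C U) \<and> (\<forall>U\<in>\<L>. U \<subseteq> span C \<or> C \<subseteq> U)" for C
  have "Q B" using B by (auto simp: Q_def)
  have bnd: "finite C \<and> card C \<le> card F" if "Q C" for C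
    using that independent_span_bound[OF W(3), of C] W(2) by (auto simp: Q_def)
  obtain C where C: "Q C" and Cmax: "\<And>C'. Q C' \<Longrightarrow> card C' \<le> card C"
    using ex_has_greatest_nat[of Q B card "Suc (card F)"] \<open>Q B\<close> bnd by (auto simp: less_Suc_eq_le)
  have indC: "independent C" and CW: "C \<subseteq> W" using C by (auto simp: Q_def)
  have "span C = W"
  proof (rule ccontr)
    assume "span C \<noteq> W"
    then have ns: "\<not> W \<subseteq> span C" using span_minimal[OF CW W(1)] by blast
    \<comment> \<open>Adding \<open>W\<close> guarantees that an unspanned member exists; the same
      device is used for \<open>\<R>'\<close>.\<close>
    define \<L>' where "\<L>' = insert W \<L>"
    have "\<exists>L. L \<in> \<L>' \<and> \<not> L \<subseteq> span C" using ns by (auto simp: \<L>'_def)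
    then obtain L0 where L0: "L0 \<in> \<L>'" "\<not> L0 \<subseteq> span C"
      and L0min: "\<And>L'. L' \<in> \<L>' \<and> \<not> L' \<subseteq> span C \<Longrightarrow> dim L0 \<le> dim L'"
      using ex_has_least_nat[of "\<lambda>L. L \<in> \<L>' \<and> \<not> L \<subseteq> span C" _ dim] by blast
    have subL: "subspace L'" "L' \<subseteq> W" if "L' \<in> \<L>'" for L'
      using that L W by (auto simp: \<L>'_def)
    have CL: "C \<subseteq> L0" using L0 C CW by (auto simp: Q_def \<L>'_def)
    define \<R>' where "\<R>' = insert W \<R>"
    have "W \<in> \<R>' \<and> \<not> W \<inter> L0 \<subseteq> span C" using L0 subL by (auto simp: \<R>'_def)
    then obtain U where U: "U \<in> \<R>'" "\<not> U \<inter> L0 \<subseteq> span C"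
      and Umin: "\<And>U'. U' \<in> \<R>' \<and> \<not> U' \<inter> L0 \<subseteq> span C \<Longrightarrow> dim (U \<inter> L0) \<le> dim (U' \<inter> L0)"
      using ex_has_least_nat[of "\<lambda>U. U \<in> \<R>' \<and> \<not> U \<inter> L0 \<subseteq> span C" W "\<lambda>U. dim (U \<inter> L0)"] by blast
    obtain v where v: "v \<in> U" "v \<in> L0" "v \<notin> span C" using U by blast
    let ?C = "insert v C"
    have spL: "span ?C \<subseteq> L0" using CL v subL[OF L0(1)] by (intro span_minimal) auto
    \<comment> \<open>A member missing \<open>v\<close> lies strictly below \<open>U\<close> in the
      chain, so minimality of \<open>U\<close> says that its part in \<open>L0\<close> is already
      spanned.\<close>
    have small: "U' \<inter> L0 \<subseteq> span C" if U': "U' \<in> \<R>" "v \<notin> U'" for U'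
    proof (rule ccontr)
      assume n: "\<not> U' \<inter> L0 \<subseteq> span C"
      have "U' \<subseteq> U"
        using U' R(1)[OF U'(1)] R(2)[OF U'(1)] U(1) v(1) unfolding \<R>'_def by blast
      then have "U' \<inter> L0 \<subset> U \<inter> L0" using v U' by blast
      moreover have "subspace (U' \<inter> L0)" using U' R subL[OF L0(1)] by (intro subspace_inter) auto
      ultimately have "dim (U' \<inter> L0) < dim (U \<inter> L0)"
        using subL[OF L0(1)] W by (intro dim_psubset_finite_span[where F = F]) auto
      then show False using Umin[of U'] n U' by (auto simp: \<R>'_def)
    qed
    have smallL: "L' \<subseteq> span C" if L': "L' \<in> \<L>" "v \<notin> L'" for L'
    proof (rule ccontr)
      assume n: "\<not> L' \<subseteq> span C"
      have "L' \<subseteq> L0"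
        using L' L(1)[OF L'(1)] L(2)[OF L'(1)] L0(1) v(2) unfolding \<L>'_def by blast
      then have "L' \<subset> L0" using v L' by blast
      moreover have "subspace L'" using L' L by auto
      ultimately have "dim L' < dim L0"
        using subL[OF L0(1)] W by (intro dim_psubset_finite_span[where F = F]) auto
      then show False using L0min[of L'] n L' by (auto simp: \<L>'_def)
    qed
    have "adapted scale ?C U'" if "U' \<in> \<R>" for U'
    proof (cases "v \<in> U'")
      case True then show ?thesis using that R C by (intro adapted_insert) (auto simp: Q_def)
    next
      case False
      then show ?thesis using that C small[OF that False] spL
        by (intro adapted_insert_small) (auto simp: Q_def)
    qed
    moreover have "adapted scale ?C L'" if "L' \<in> \<L>" for L'
    proof (cases "v \<in> L'")
      case True then show ?thesis using that L C by (intro adapted_insert) (auto simp: Q_def)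
    next
      case False
      then show ?thesis using that C smallL[OF that False]
        by (intro adapted_insert_small) (auto simp: Q_def)
    qed
    moreover have "L' \<subseteq> span ?C \<or> ?C \<subseteq> L'" if "L' \<in> \<L>" for L'
    proof (cases "L' \<subseteq> span C")
      case True then show ?thesis using span_mono[of C ?C] by blast
    next
      case False then show ?thesis using that smallL[OF that] C by (auto simp: Q_def)
    qed
    moreover have "v \<in> W" using v subL[OF L0(1)] by blast
    ultimately have "Q ?C"
      using C independent_insertI[OF v(3) indC] by (auto simp: Q_def)
    moreover have "card ?C = Suc (card C)" using bnd[OF C] v(3) span_base[of v C] by (subst card_insert_disjoint) auto
    ultimately show False using Cmax[of ?C] by simp
  qed
  then show ?thesis using C by (auto simp: Q_def)
qed

text \<open>Representations over \<open>B\<close> are unique, so the coefficients of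
  \<open>x\<close> are supported both in \<open>S\<close> and in \<open>T\<close>.\<close>

lemma independent_span_disjoint:
  assumes "independent B" "S \<subseteq> B" "T \<subseteq> B" "S \<inter> T = {}" "x \<in> span S" "x \<in> span T"
  shows "x = 0"
proof -
  have iS: "independent S" using assms independent_mono by blast
  have "representation S x = representation B x" "representation T x = representation B x"
    using assms representation_extend by metis+
  then have "representation S x b = 0" for b
    using representation_ne_zero[of S x b] representation_ne_zero[of T x b] assms(4) by force
  then show ?thesis
    using sum_nonzero_representation_eq[OF iS assms(5)] by simp
qed

text \<open>Adaptedness to the kernel, which is the preimage of \<open>{0}\<close>, makes
  \<open>f\<close> injective on the span of the basis vectors that it does not kill. Their images
  are adapted because the preimages of the chain were, and they are completed to a basis of
  \<open>Y\<close>.\<close>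

lemma forward_basis:
  assumes f: "Vector_Spaces.linear scale scale f"
    and B: "independent B" "span B = X" and fX: "f ` X \<subseteq> Y"
    and Y: "subspace Y" "Y \<subseteq> span F" "finite F"
    and R: "\<And>U. U \<in> \<R> \<Longrightarrow> subspace U \<and> U \<subseteq> Y" "\<And>U U'. U \<in> \<R> \<Longrightarrow> U' \<in> \<R> \<Longrightarrow> U \<subseteq> U' \<or> U' \<subseteq> U"
      "{0} \<in> \<R>"
    and ad: "\<And>U. U \<in> \<R> \<Longrightarrow> adapted scale B {x\<in>X. f x \<in> U}"
  shows "\<exists>C. independent C \<and> span C = Y \<and> (\<forall>U\<in>\<R>. adapted scale C U) \<and>
           (\<forall>b\<in>B. f b = 0 \<or> f b \<in> C) \<and> inj_on f {b\<in>B. f b \<noteq> 0}"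
proof -
  interpret f: Vector_Spaces.linear scale scale f by (rule f)
  let ?K = "{x\<in>X. f x = 0}" and ?B = "{b\<in>B. f b \<noteq> 0}"
  have BX: "B \<subseteq> X" using B span_base by blast
  have K: "?K \<subseteq> span (B \<inter> ?K)" using ad[OF R(3)] B(2) by (auto simp: adapted_def)
  have inj: "inj_on f (span ?B)"
    unfolding f.inj_on_iff_eq_0[OF subspace_span]
  proof (intro ballI impI)
    fix x assume x: "x \<in> span ?B" "f x = 0"
    have "x \<in> span (B \<inter> ?K)" using x K span_mono[of ?B B] B(2) by blast
    then show "x = 0" by (intro independent_span_disjoint[OF B(1) _ _ _ x(1)]) auto
  qed
  have ind0: "independent (f ` ?B)"
    by (rule f.independent_injective_image[OF _ inj]) (rule independent_mono[OF B(1)], auto)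
  have img: "span (f ` ?B) = f ` X"
  proof -
    have "f ` X = span (f ` B)" using B(2) f.span_image by metis
    also have "f ` B \<subseteq> insert 0 (f ` ?B)" by auto
    then have "span (f ` B) \<subseteq> span (f ` ?B)" using span_mono span_insert_0 by metis
    moreover have "span (f ` ?B) \<subseteq> span (f ` B)" by (rule span_mono) auto
    ultimately show ?thesis by blast
  qed
  have adB: "adapted scale (f ` ?B) U" if "U \<in> \<R>" for U
    unfolding adapted_def
  proof
    fix y assume y: "y \<in> U \<inter> span (f ` ?B)"
    then obtain x where x: "x \<in> X" "y = f x" using img by auto
    have "x \<in> span (B \<inter> {x\<in>X. f x \<in> U})" using ad[OF that] x y B(2) by (auto simp: adapted_def)
    then have "y \<in> span (f ` (B \<inter> {x\<in>X. f x \<in> U}))" using x(2) f.span_image by auto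
    also have "\<dots> \<subseteq> span (insert 0 (f ` ?B \<inter> U))" by (rule span_mono) auto
    finally show "y \<in> span (f ` ?B \<inter> U)" by simp
  qed
  have "f ` ?B \<subseteq> Y" using fX BX by auto
  then have "\<exists>C. f ` ?B \<subseteq> C \<and> independent C \<and> C \<subseteq> Y \<and> span C = Y \<and> (\<forall>U\<in>\<R>. adapted scale C U) \<and> (\<forall>U\<in>{}. adapted scale C U)"
    by (intro adapted_basis_extension[OF Y R(1,2)] ind0 adB) auto
  then obtain C where "f ` ?B \<subseteq> C" "independent C" "span C = Y" "\<forall>U\<in>\<R>. adapted scale C U"
    by blast
  moreover have "inj_on f ?B" by (rule inj_on_subset[OF inj]) (auto intro: span_base)
  ultimately show ?thesis by blast
qed

text \<open>Basis vectors in the image of \<open>Y\<close> are lifted, and an adapted basis of the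
  kernel completes the lifts. A lift has to be taken in the smallest possible chain member, since
  otherwise adaptedness to the smaller members is lost.\<close>

lemma backward_basis:
  assumes g: "Vector_Spaces.linear scale scale g"
    and B: "independent B" "span B = X" and gY: "g ` Y \<subseteq> X"
    and Y: "subspace Y" "Y \<subseteq> span F" "finite F"
    and R: "\<And>U. U \<in> \<R> \<Longrightarrow> subspace U \<and> U \<subseteq> Y" "\<And>U U'. U \<in> \<R> \<Longrightarrow> U' \<in> \<R> \<Longrightarrow> U \<subseteq> U' \<or> U' \<subseteq> U"
      "Y \<in> \<R>"
    and ad: "\<And>U. U \<in> \<R> \<Longrightarrow> adapted scale B (g ` U)"
  shows "\<exists>C. independent C \<and> span C = Y \<and> (\<forall>U\<in>\<R>. adapted scale C U) \<and>
           (\<forall>c\<in>C. g c = 0 \<or> g c \<in> B) \<and> inj_on g {c\<in>C. g c \<noteq> 0}"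
proof -
  interpret g: Vector_Spaces.linear scale scale g by (rule g)
  let ?K = "{y\<in>Y. g y = 0}"
  have subK: "subspace ?K"
    using Y(1) by (auto intro!: subspaceI simp: subspace_0 subspace_add subspace_scale g.add g.scale)
  have "\<exists>K. {} \<subseteq> K \<and> independent K \<and> K \<subseteq> ?K \<and> span K = ?K \<and>
      (\<forall>U\<in>(\<lambda>U. U \<inter> ?K) ` \<R>. adapted scale K U) \<and> (\<forall>U\<in>{}. adapted scale K U)"
  proof (rule adapted_basis_extension[OF subK _ Y(3)])
    show "?K \<subseteq> span F" using Y(2) by blast
    show "U \<subseteq> U' \<or> U' \<subseteq> U" if "U \<in> (\<lambda>U. U \<inter> ?K) ` \<R>" "U' \<in> (\<lambda>U. U \<inter> ?K) ` \<R>" for U U'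
      using that R(2) by fast
    show "subspace U \<and> U \<subseteq> ?K" if "U \<in> (\<lambda>U. U \<inter> ?K) ` \<R>" for U
      using that R(1) subspace_inter[OF _ subK] by blast
    show "adapted scale {} U" if "U \<in> (\<lambda>U. U \<inter> ?K) ` \<R>" for U
      using that R(1) subspace_0[OF subK] by (auto simp: adapted_def)
  qed (simp_all add: independent_empty)
  then obtain K where K: "independent K" "K \<subseteq> ?K" "span K = ?K"
    and adK': "\<forall>U\<in>(\<lambda>U. U \<inter> ?K) ` \<R>. adapted scale K U"
    by (elim exE conjE) (rule that)
  have adK: "adapted scale K (U \<inter> ?K)" if "U \<in> \<R>" for U
    using that adK' by simp
  \<comment> \<open>\<open>m b\<close> is the smallest chain member whose image still contains
    \<open>b\<close>, with dimension as the measure of size.\<close>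
  define m where "m b = (SOME U. U \<in> \<R> \<and> b \<in> g ` U \<and> (\<forall>U'. U' \<in> \<R> \<and> b \<in> g ` U' \<longrightarrow> dim U \<le> dim U'))" for b
  have m: "m b \<in> \<R>" "b \<in> g ` m b" "\<And>U'. U' \<in> \<R> \<Longrightarrow> b \<in> g ` U' \<Longrightarrow> m b \<subseteq> U'" if b: "b \<in> g ` Y" for b
  proof -
    have *: "m b \<in> \<R> \<and> b \<in> g ` m b \<and> (\<forall>U'. U' \<in> \<R> \<and> b \<in> g ` U' \<longrightarrow> dim (m b) \<le> dim U')"
      unfolding m_def by (rule someI_ex)
        (use ex_has_least_nat[of "\<lambda>U. U \<in> \<R> \<and> b \<in> g ` U" Y dim] R(3) b in auto)
    then show "m b \<in> \<R>" "b \<in> g ` m b" by auto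
    fix U' assume U': "U' \<in> \<R>" "b \<in> g ` U'"
    show "m b \<subseteq> U'"
    proof (rule ccontr)
      assume "\<not> m b \<subseteq> U'"
      then have "U' \<subset> m b" using R(2)[OF U'(1)] * by blast
      then have "dim U' < dim (m b)"
        using R(1)[OF U'(1)] R(1)[of "m b"] * Y by (intro dim_psubset_finite_span[where F = F]) auto
      moreover have "dim (m b) \<le> dim U'" using * U' by blast
      ultimately show False by simp
    qed
  qed
  let ?B = "B \<inter> g ` Y"
  define l where "l b = (SOME y. y \<in> m b \<and> g y = b)" for b
  have l: "l b \<in> m b" "g (l b) = b" if "b \<in> g ` Y" for b
  proof -
    have "l b \<in> m b \<and> g (l b) = b" unfolding l_def by (rule someI_ex) (use m(2)[OF that] in auto)
    then show "l b \<in> m b" "g (l b) = b" by auto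
  qed
  have lY: "l b \<in> Y" if "b \<in> g ` Y" for b using l(1)[OF that] m(1)[OF that] R(1) by blast
  let ?L = "l ` ?B" and ?C = "K \<union> l ` ?B"
  have indB: "independent ?B" using independent_mono[OF B(1)] by blast

  \<comment> \<open>Applying \<open>g\<close> removes the kernel part of a relation and leaves one
    among distinct members of \<open>B\<close>.\<close>
  have indC: "independent (K \<union> l ` T)" if "finite T" "T \<subseteq> ?B" for T
    using that
  proof induction
    case empty then show ?case using K by simp
  next
    case (insert b T)
    have "l b \<notin> span (K \<union> l ` T)"
    proof
      assume "l b \<in> span (K \<union> l ` T)"
      then have "g (l b) \<in> span (g ` (K \<union> l ` T))" using g.span_image by blast
      also have "g ` (K \<union> l ` T) \<subseteq> insert 0 T" using K(2) l(2) insert.prems by auto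
      then have "span (g ` (K \<union> l ` T)) \<subseteq> span T" using span_mono span_insert_0 by metis
      finally have "b \<in> span T" using l(2) insert.prems by auto
      moreover have "b \<notin> span (B - {b})" using B(1) insert.prems by (auto simp: dependent_def)
      moreover have "span T \<subseteq> span (B - {b})" using insert by (intro span_mono) auto
      ultimately show False by blast
    qed
    then have "independent (insert (l b) (K \<union> l ` T))"
      using insert by (intro independent_insertI) auto
    then show ?case by simp
  qed
  \<comment> \<open>\<open>g u\<close> is a combination of basis vectors in the image of
    \<open>U\<close>. Their lifts lie in \<open>U\<close> by the choice of \<open>m\<close>, and the
    remaining error is a kernel vector in \<open>U\<close>.\<close>
  have spanC: "u \<in> span (?C \<inter> U)" if U: "U \<in> \<R>" and u: "u \<in> U" for U u
  proof -
    have "g u \<in> span B" using u R(1)[OF U] gY B(2) by blast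
    then have "g u \<in> span (B \<inter> g ` U)" using ad[OF U] u by (auto simp: adapted_def)
    also have "B \<inter> g ` U = g ` (l ` (B \<inter> g ` U))"
    proof -
      have "b \<in> g ` Y" if "b \<in> g ` U" for b using that R(1)[OF U] by blast
      then show ?thesis using l(2) by (force simp: image_image)
    qed
    finally obtain y where y: "y \<in> span (l ` (B \<inter> g ` U))" "g u = g y"
      using g.span_image by auto
    have lU: "l b \<in> U" if "b \<in> g ` U" for b
    proof -
      have "b \<in> g ` Y" using that R(1)[OF U] by blast
      then show ?thesis using l(1)[of b] m(3)[of b U] U that by blast
    qed
    have "l ` (B \<inter> g ` U) \<subseteq> ?C \<inter> U" using lU R(1)[OF U] by auto
    then have y': "y \<in> span (?C \<inter> U)" using y(1) span_mono by blast
    have "y \<in> U" using y(1) lU R(1)[OF U] span_minimal[of "l ` (B \<inter> g ` U)" U] by auto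
    then have "u - y \<in> U \<inter> ?K" using u y(2) R(1)[OF U] by (auto simp: subspace_diff g.diff)
    then have "u - y \<in> span (K \<inter> (U \<inter> ?K))" using adK[OF U] K(3) unfolding adapted_def by blast
    then have "u - y \<in> span (?C \<inter> U)" using span_mono[of "K \<inter> (U \<inter> ?K)" "?C \<inter> U"] by blast
    then show ?thesis using y' span_add[of "u - y" _ y] by simp
  qed
  have CY: "?C \<subseteq> Y" using K(2) lY by auto
  have "finite ?B"
  proof -
    have "?B \<subseteq> span (g ` F)" using Y(2) g.span_image by blast
    then show ?thesis using independent_span_bound[OF _ indB] Y(3) by blast
  qed
  then have "independent ?C" using indC by blast
  moreover have "span ?C = Y"
    using span_minimal[OF CY Y(1)] spanC[OF R(3)] CY by (auto simp: Int_absorb2)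
  moreover have "\<forall>U\<in>\<R>. adapted scale ?C U" using spanC by (auto simp: adapted_def)
  moreover have "\<forall>c\<in>?C. g c = 0 \<or> g c \<in> B" using K(2) l(2) by auto
  moreover have "inj_on g {c\<in>?C. g c \<noteq> 0}" using K(2) l(2) by (auto simp: inj_on_def)
  ultimately show ?thesis by blast
qed


text \<open>Internal maps are linear on the fibres only. Replacing them by linear maps of the whole
  ambient space makes the theory of linear maps applicable; the new map is prescribed on a basis of
  the fibre.\<close>

lemma lin_map_extend:
  assumes "lin_map scale scale A A' f" "subspace A"
  shows "\<exists>g. Vector_Spaces.linear scale scale g \<and> (\<forall>x\<in>A. g x = f x)"
proof -
  interpret vector_space_pair scale scale by unfold_locales
  obtain B where B: "B \<subseteq> A" "independent B" "A \<subseteq> span B"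
    using basis_exists by metis
  have AB: "A = span B" using B span_minimal assms(2) by blast
  obtain g where g: "Vector_Spaces.linear scale scale g" "\<forall>x\<in>B. g x = f x"
    using linear_independent_extend[OF B(2)] by blast
  interpret g: Vector_Spaces.linear scale scale g by (rule g)
  have f: "f (x + y) = f x + f y" "f (scale c x) = scale c (f x)" if "x \<in> A" "y \<in> A" for x y c
    using that assms(1) by (auto simp: lin_map_def)
  have 0: "0 \<in> A" using assms(2) by (rule subspace_0)
  have "x \<in> A \<and> g x = f x" if "x \<in> span B" for x
    using that
  proof (induction rule: span_induct_alt)
    case base
    have "f (0 + 0) = f 0 + f 0" using f(1)[OF 0 0] .
    then show ?case using 0 by (simp add: g.zero)
  next
    case (step c x y)
    then have "x \<in> A" "scale c x \<in> A" "y \<in> A" using B(1) assms(2) by (auto simp: subspace_scale)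
    then show ?case using step g f assms(2) by (simp add: g.add g.scale subspace_add)
  qed
  then show ?thesis using g(1) AB by blast
qed

end

text \<open>On a half line whose arrow runs from \<open>X k\<close> to \<open>X (Suc k)\<close> if
  \<open>d k\<close> holds and backwards otherwise, these are the subspaces of \<open>X k\<close>
  visible from the right: zero and full spaces of later positions, carried back by preimages and
  images. A basis at \<open>k\<close> must respect all of them for the later steps to
  succeed.\<close>

inductive right_chain ::
  "(nat \<Rightarrow> 'v::zero set) \<Rightarrow> (nat \<Rightarrow> bool) \<Rightarrow> (nat \<Rightarrow> 'v \<Rightarrow> 'v) \<Rightarrow> nat \<Rightarrow> 'v set \<Rightarrow> bool"
  for X d h where
  zero: "right_chain X d h k {0}"
| full: "right_chain X d h k (X k)"
| pull: "d k \<Longrightarrow> right_chain X d h (Suc k) U \<Longrightarrow> right_chain X d h k {x \<in> X k. h k x \<in> U}"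
| push: "\<not> d k \<Longrightarrow> right_chain X d h (Suc k) U \<Longrightarrow> right_chain X d h k (h k ` U)"

text \<open>In these bases the matrix of \<open>f\<close> is a partial permutation matrix.\<close>

definition basis_arrow :: "('v \<Rightarrow> 'v::zero) \<Rightarrow> 'v set \<Rightarrow> 'v set \<Rightarrow> bool" where
  "basis_arrow f B C \<longleftrightarrow> (\<forall>b\<in>B. f b = 0 \<or> f b \<in> C) \<and> inj_on f {b\<in>B. f b \<noteq> 0}"

section \<open>Bases chosen step by step along a half line\<close>

locale halfline = vector_space scale for scale :: "'k::field \<Rightarrow> 'v::ab_group_add \<Rightarrow> 'v" +
  fixes X :: "nat \<Rightarrow> 'v set" and d :: "nat \<Rightarrow> bool" and h :: "nat \<Rightarrow> 'v \<Rightarrow> 'v" and F :: "nat \<Rightarrow> 'v set"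
  assumes lin: "\<And>k. Vector_Spaces.linear scale scale (h k)"
    and sub: "\<And>k. module.subspace scale (X k)"
    and fin: "\<And>k. finite (F k)" "\<And>k. X k \<subseteq> module.span scale (F k)"
    and fwd: "\<And>k. d k \<Longrightarrow> h k ` X k \<subseteq> X (Suc k)"
    and bwd: "\<And>k. \<not> d k \<Longrightarrow> h k ` X (Suc k) \<subseteq> X k"
begin

lemma right_chain_subspace: "right_chain X d h k U \<Longrightarrow> subspace U \<and> U \<subseteq> X k"
proof (induction rule: right_chain.induct)
  case (zero k) then show ?case using subspace_0[OF sub] subspace_single_0 by simp
next
  case (full k) then show ?case using sub by simp
next
  case (pull k U)
  interpret h: Vector_Spaces.linear scale scale "h k" by (rule lin)
  have "{x \<in> X k. h k x \<in> U} = X k \<inter> {x. h k x \<in> U}" by blast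
  moreover have "subspace (X k \<inter> {x. h k x \<in> U})"
    using pull sub by (intro subspace_inter h.subspace_linear_preimage) auto
  ultimately show ?case by simp
next
  case (push k U)
  interpret h: Vector_Spaces.linear scale scale "h k" by (rule lin)
  have "subspace (h k ` U)" using push by (intro h.subspace_image) auto
  then show ?case using push bwd[of k] by blast
qed

text \<open>Zero and the full space are the extremes. Otherwise \<open>d k\<close> decides between
  preimage and image, so two members at \<open>k\<close> come from two members at
  \<open>Suc k\<close> by the same monotone operation.\<close>

lemma right_chain_total:
  "right_chain X d h k U \<Longrightarrow> right_chain X d h k U' \<Longrightarrow> U \<subseteq> U' \<or> U' \<subseteq> U"
proof (induction arbitrary: U' rule: right_chain.induct)
  case (zero k)
  then have "0 \<in> U'" using right_chain_subspace[OF zero] subspace_0 by auto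
  then show ?case by simp
next
  case (full k)
  then show ?case using right_chain_subspace[OF full] by simp
next
  case (pull k U)
  have s: "right_chain X d h k {x \<in> X k. h k x \<in> U}" using pull by (auto intro: right_chain.pull)
  from pull.prems pull.hyps show ?case
  proof cases
    case zero then show ?thesis using right_chain_subspace[OF s] subspace_0[of "_ :: 'v set"] by auto
  next
    case (pull U2) then show ?thesis using pull.IH[of U2] by blast
  qed (use right_chain_subspace[OF s] in auto)
next
  case (push k U)
  have s: "right_chain X d h k (h k ` U)" using push by (auto intro: right_chain.push)
  from push.prems push.hyps show ?case
  proof cases
    case zero then show ?thesis using right_chain_subspace[OF s] subspace_0[of "_ :: 'v set"] by auto
  next
    case full then show ?thesis using right_chain_subspace[OF s] by blast
  next
    case (push U2) then show ?thesis using push.IH[of U2] by blast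
  qed (use right_chain_subspace[OF s] in auto)
qed

text \<open>The invariant is adaptedness to the whole right chain at \<open>k\<close>. Its members
  coming from \<open>Suc k\<close> are what \<open>forward_basis\<close> and
  \<open>backward_basis\<close> ask for, and these return adaptedness one position further.\<close>

lemma halfline_basis:
  assumes B0: "independent B0" "span B0 = X 0" "\<And>U. right_chain X d h 0 U \<Longrightarrow> adapted scale B0 U"
  shows "\<exists>B. B 0 = B0 \<and> (\<forall>k. independent (B k) \<and> span (B k) = X k \<and>
    (if d k then basis_arrow (h k) (B k) (B (Suc k)) else basis_arrow (h k) (B (Suc k)) (B k)))"
proof -
  define P where "P k B \<longleftrightarrow> (k = 0 \<longrightarrow> B = B0) \<and> independent B \<and> span B = X k \<and>
    (\<forall>U. right_chain X d h k U \<longrightarrow> adapted scale B U)" for k B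
  have "\<exists>B. \<forall>k. P k (B k) \<and>
    (if d k then basis_arrow (h k) (B k) (B (Suc k)) else basis_arrow (h k) (B (Suc k)) (B k))"
  proof (rule dependent_nat_choice)
    show "\<exists>B. P 0 B" using B0 by (intro exI[of _ B0]) (simp add: P_def)
    fix B k assume B: "P k B"
    let ?\<R> = "{U. right_chain X d h (Suc k) U}"
    have R: "subspace U \<and> U \<subseteq> X (Suc k)" if "U \<in> ?\<R>" for U
      using that right_chain_subspace by auto
    have T: "U \<subseteq> U' \<or> U' \<subseteq> U" if "U \<in> ?\<R>" "U' \<in> ?\<R>" for U U'
      using that right_chain_total by auto
    show "\<exists>C. P (Suc k) C \<and> (if d k then basis_arrow (h k) B C else basis_arrow (h k) C B)"
    proof (cases "d k")
      case True
      have "adapted scale B {x\<in>X k. h k x \<in> U}" if "U \<in> ?\<R>" for U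
        using B that True by (auto simp: P_def intro: right_chain.pull)
      then have "\<exists>C. independent C \<and> span C = X (Suc k) \<and> (\<forall>U\<in>?\<R>. adapted scale C U) \<and>
          (\<forall>b\<in>B. h k b = 0 \<or> h k b \<in> C) \<and> inj_on (h k) {b\<in>B. h k b \<noteq> 0}"
        by (intro forward_basis[OF lin _ _ fwd[OF True] sub fin(2,1) R T])
          (use B in \<open>simp_all add: P_def right_chain.zero\<close>)
      then obtain C where C: "independent C" "span C = X (Suc k)" "\<forall>U\<in>?\<R>. adapted scale C U"
          "basis_arrow (h k) B C"
        by (elim exE conjE) (rule that; simp add: basis_arrow_def)
      show ?thesis using True C by (intro exI[of _ C]) (simp add: P_def)
    next
      case False
      have "adapted scale B (h k ` U)" if "U \<in> ?\<R>" for U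
        using B that False by (auto simp: P_def intro: right_chain.push)
      then have "\<exists>C. independent C \<and> span C = X (Suc k) \<and> (\<forall>U\<in>?\<R>. adapted scale C U) \<and>
          (\<forall>b\<in>C. h k b = 0 \<or> h k b \<in> B) \<and> inj_on (h k) {b\<in>C. h k b \<noteq> 0}"
        by (intro backward_basis[OF lin _ _ bwd[OF False] sub fin(2,1) R T])
          (use B in \<open>simp_all add: P_def right_chain.full\<close>)
      then obtain C where C: "independent C" "span C = X (Suc k)" "\<forall>U\<in>?\<R>. adapted scale C U"
          "basis_arrow (h k) C B"
        by (elim exE conjE) (rule that; simp add: basis_arrow_def)
      show ?thesis using False C by (intro exI[of _ C]) (simp add: P_def)
    qed
  qed
  then obtain B where *: "\<forall>k. P k (B k) \<and>
    (if d k then basis_arrow (h k) (B k) (B (Suc k)) else basis_arrow (h k) (B (Suc k)) (B k))" ..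
  from * show ?thesis unfolding P_def by (intro exI[of _ B]) simp
qed

end

section \<open>Zigzags indexed by the integers\<close>

text \<open>Even integers are the sinks \<open>(i, i)\<close> of the zigzag, odd ones its sources \<open>(i, i - 1)\<close>.\<close>

definition pos :: "int \<Rightarrow> pt" where
  "pos m = (if even m then (of_int (m div 2), of_int (m div 2))
            else (of_int (m div 2) + 1, of_int (m div 2)))"

lemma pos_ZZ: "pos m \<in> ZZ"
proof (cases "even m")
  case True then show ?thesis by (auto simp: pos_def ZZ_def)
next
  case False
  then have "pos m = (real_of_int (m div 2 + 1), real_of_int (m div 2 + 1 - 1))" by (simp add: pos_def)
  then show ?thesis unfolding ZZ_def by blast
qed

lemma ZZ_eq: "ZZ = range pos"
proof (intro equalityI subsetI)
  fix q assume "q \<in> ZZ"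
  then obtain i j :: int where q: "q = (of_int i, of_int j)" and ij: "j = i \<or> j = i - 1"
    by (auto simp: ZZ_def)
  show "q \<in> range pos"
  proof (cases "j = i")
    case True then have "q = pos (2 * i)" by (simp add: q pos_def)
    then show ?thesis by blast
  next
    case False
    have "(2 * i - 1) div 2 = i - 1" by presburger
    then have "q = pos (2 * i - 1)" using False ij by (simp add: q pos_def)
    then show ?thesis by blast
  qed
qed (auto simp: pos_ZZ)

lemma pos_le_iff: "pos m \<preceq> pos n \<longleftrightarrow> m = n \<or> odd m \<and> (n = m + 1 \<or> n = m - 1)"
proof -
  have r: "real_of_int a + 1 \<le> real_of_int b \<longleftrightarrow> a + 1 \<le> b" for a b by linarith
  have r2: "real_of_int a \<le> real_of_int b + 1 \<longleftrightarrow> a \<le> b + 1" for a b by linarith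
  show ?thesis unfolding pos_def opp_le_def
    by (cases "even m"; cases "even n") (auto simp: r r2, presburger+)
qed

lemma inj_pos: "inj pos"
  unfolding inj_def
proof (intro allI impI)
  fix m n assume "pos m = pos n"
  then have "pos m \<preceq> pos n" "pos n \<preceq> pos m" by (simp_all add: opp_le_def)
  then show "m = n" unfolding pos_le_iff by presburger
qed

text \<open>At position 0 one chain arrives from each side. Once a basis adapted to both is fixed
  there, the two half lines are independent of each other.\<close>

lemma zigzag_basis:
  fixes V :: "('k::field, 'v::ab_group_add) pmod"
  assumes V: "is_pmod ZZ V" "pfd ZZ V"
  shows "\<exists>B. \<forall>m. \<not> module.dependent (scl V) (B m) \<and> module.span (scl V) (B m) = fib V (pos m) \<and>
     (odd m \<longrightarrow> basis_arrow (imap V (pos m) (pos (m + 1))) (B m) (B (m + 1)) \<and>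
                basis_arrow (imap V (pos m) (pos (m - 1))) (B m) (B (m - 1)))"
proof -
  interpret vector_space "scl V" using V by (simp add: is_pmod_def)
  have sub: "subspace (fib V (pos m))" for m using V(1) pos_ZZ by (auto simp: is_pmod_def)
  have lm: "lin_map (scl V) (scl V) (fib V (pos m)) (fib V (pos n)) (imap V (pos m) (pos n))"
    if "odd m" "n = m + 1 \<or> n = m - 1" for m n
    using V(1) pos_ZZ[of m] pos_ZZ[of n] that pos_le_iff[of m n] unfolding is_pmod_def by blast
  \<comment> \<open>Internal maps replaced by maps that are linear on the whole ambient space; for
    pairs without an arrow any linear map will do.\<close>
  define H where "H m n = (SOME g. Vector_Spaces.linear (scl V) (scl V) g \<and>
      (odd m \<and> (n = m + 1 \<or> n = m - 1) \<longrightarrow> (\<forall>x\<in>fib V (pos m). g x = imap V (pos m) (pos n) x)))" for m n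
  have H: "Vector_Spaces.linear (scl V) (scl V) (H m n) \<and>
      (odd m \<and> (n = m + 1 \<or> n = m - 1) \<longrightarrow> (\<forall>x\<in>fib V (pos m). H m n x = imap V (pos m) (pos n) x))" for m n
  proof -
    have "\<exists>g. Vector_Spaces.linear (scl V) (scl V) g \<and>
      (odd m \<and> (n = m + 1 \<or> n = m - 1) \<longrightarrow> (\<forall>x\<in>fib V (pos m). g x = imap V (pos m) (pos n) x))"
      using lin_map_extend[OF lm sub, of m n] linear_id by blast
    then show ?thesis unfolding H_def by (rule someI_ex)
  qed
  have Himg: "H m n ` fib V (pos m) \<subseteq> fib V (pos n)" if "odd m" "n = m + 1 \<or> n = m - 1" for m n
    using H[of m n] that lm[OF that] by (auto simp: lin_map_def)
  have "\<exists>F. finite F \<and> fib V (pos m) = span F" for m using V(2) pos_ZZ by (auto simp: pfd_def)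
  then obtain F where F: "\<And>m. finite (F m)" "\<And>m. fib V (pos m) = span (F m)" by metis
  \<comment> \<open>The sign \<open>\<sigma>\<close> selects the half line. The direction predicate
    is \<open>odd\<close> for both signs, since arrows leave the odd positions.\<close>
  define X where "X \<sigma> k = fib V (pos (\<sigma> * int k))" for \<sigma> k
  define h where "h \<sigma> k = (if odd k then H (\<sigma> * int k) (\<sigma> * int (Suc k))
      else H (\<sigma> * int (Suc k)) (\<sigma> * int k))" for \<sigma> k
  have hl: "halfline (scl V) (X \<sigma>) odd (h \<sigma>) (\<lambda>k. F (\<sigma> * int k))" if \<sigma>: "\<sigma> = 1 \<or> \<sigma> = -1" for \<sigma>
  proof (intro halfline.intro halfline_axioms.intro vector_space_axioms)
    show "Vector_Spaces.linear (scl V) (scl V) (h \<sigma> k)" for k using H by (simp add: h_def)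
    show "subspace (X \<sigma> k)" for k using sub by (simp add: X_def)
    show "finite (F (\<sigma> * int k))" "X \<sigma> k \<subseteq> span (F (\<sigma> * int k))" for k using F by (auto simp: X_def)
    show "h \<sigma> k ` X \<sigma> k \<subseteq> X \<sigma> (Suc k)" if "odd k" for k
      unfolding h_def X_def using that \<sigma> Himg[of "\<sigma> * int k" "\<sigma> * int (Suc k)"] by (elim disjE) simp_all
    show "h \<sigma> k ` X \<sigma> (Suc k) \<subseteq> X \<sigma> k" if "\<not> odd k" for k
      unfolding h_def X_def using that \<sigma> Himg[of "\<sigma> * int (Suc k)" "\<sigma> * int k"] by (elim disjE) simp_all
  qed
  interpret r: halfline "scl V" "X 1" odd "h 1" "\<lambda>k. F (1 * int k)" by (rule hl) simp
  interpret l: halfline "scl V" "X (-1)" odd "h (-1)" "\<lambda>k. F (-1 * int k)" by (rule hl) simp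
  have X0: "X \<sigma> 0 = fib V (pos 0)" for \<sigma> by (simp add: X_def)
  let ?R = "{U. right_chain (X 1) odd (h 1) 0 U}" and ?L = "{U. right_chain (X (-1)) odd (h (-1)) 0 U}"
  have sR: "subspace U \<and> U \<subseteq> fib V (pos 0)" if "U \<in> ?R" for U
    using r.right_chain_subspace[of 0 U] that by (simp add: X0)
  have sL: "subspace U \<and> U \<subseteq> fib V (pos 0)" if "U \<in> ?L" for U
    using l.right_chain_subspace[of 0 U] that by (simp add: X0)
  have tR: "U \<subseteq> U' \<or> U' \<subseteq> U" if "U \<in> ?R" "U' \<in> ?R" for U U'
    using that r.right_chain_total by auto
  have tL: "U \<subseteq> U' \<or> U' \<subseteq> U" if "U \<in> ?L" "U' \<in> ?L" for U U'
    using that l.right_chain_total by auto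
  have ad0: "adapted (scl V) {} U" if "subspace U" for U
    using subspace_0[OF that] by (auto simp: adapted_def)
  have "\<exists>C. {} \<subseteq> C \<and> independent C \<and> C \<subseteq> fib V (pos 0) \<and> span C = fib V (pos 0) \<and>
      (\<forall>U\<in>?R. adapted (scl V) C U) \<and> (\<forall>U\<in>?L. adapted (scl V) C U)"
    by (rule adapted_basis_extension[OF sub _ F(1)[of 0] sR tR sL tL])
       (use F sR sL ad0 in \<open>auto simp: independent_empty\<close>)
  then obtain B0 where B0: "independent B0" "span B0 = fib V (pos 0)"
    "\<And>U. right_chain (X 1) odd (h 1) 0 U \<Longrightarrow> adapted (scl V) B0 U"
    "\<And>U. right_chain (X (-1)) odd (h (-1)) 0 U \<Longrightarrow> adapted (scl V) B0 U" by blast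
  obtain R where R: "R 0 = B0" "\<And>k. independent (R k)" "\<And>k. span (R k) = X 1 k"
     "\<And>k. if odd k then basis_arrow (h 1 k) (R k) (R (Suc k)) else basis_arrow (h 1 k) (R (Suc k)) (R k)"
    using r.halfline_basis[of B0] B0 X0 by metis
  obtain L where L: "L 0 = B0" "\<And>k. independent (L k)" "\<And>k. span (L k) = X (-1) k"
     "\<And>k. if odd k then basis_arrow (h (-1) k) (L k) (L (Suc k)) else basis_arrow (h (-1) k) (L (Suc k)) (L k)"
    using l.halfline_basis[of B0] B0 X0 by metis
  define B where "B m = (if m \<ge> 0 then R (nat m) else L (nat (- m)))" for m
  have BR: "B (int k) = R k" for k by (simp add: B_def)
  have BL: "B (- int k) = L k" for k using R(1) L(1) by (simp add: B_def)
  have bas: "independent (B m) \<and> span (B m) = fib V (pos m)" for m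
    using R(2,3)[of "nat m"] L(2,3)[of "nat (- m)"] by (auto simp: B_def X_def)
  have arrowH: "basis_arrow (H m n) (B m) (B n)" if m: "odd m" "n = m + 1 \<or> n = m - 1" for m n
  proof -
    \<comment> \<open>An arrow does not cross the origin, so it belongs to one of the half lines and
      points away from 0 or towards it.\<close>
    have "(m \<ge> 0 \<and> n = m + 1) \<or> (n \<ge> 0 \<and> n = m - 1) \<or> (m \<le> 0 \<and> n = m - 1) \<or> (n \<le> 0 \<and> n = m + 1)"
      using m by presburger
    then show ?thesis
    proof (elim disjE conjE)
      assume a: "m \<ge> 0" "n = m + 1"
      then obtain k where "m = int k" using nonneg_int_cases by blast
      with R(4)[of k] show ?thesis using BR[of k] BR[of "Suc k"] a m by (simp add: h_def add.commute)
    next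
      assume a: "n \<ge> 0" "n = m - 1"
      then obtain k where "n = int k" using nonneg_int_cases by blast
      moreover from this a have "m = int (Suc k)" by simp
      ultimately show ?thesis using R(4)[of k] BR[of k] BR[of "Suc k"] m by (simp add: h_def add.commute)
    next
      assume a: "m \<le> 0" "n = m - 1"
      then obtain k where "m = - int k" using nonpos_int_cases by blast
      moreover from this a have "n = - int (Suc k)" by simp
      ultimately show ?thesis using L(4)[of k] BL[of k] BL[of "Suc k"] m by (simp add: h_def)
    next
      assume a: "n \<le> 0" "n = m + 1"
      then obtain k where "n = - int k" using nonpos_int_cases by blast
      moreover from this a have "m = - int (Suc k)" by simp
      ultimately show ?thesis using L(4)[of k] BL[of k] BL[of "Suc k"] m by (simp add: h_def)
    qed
  qed
  have arrow: "basis_arrow (imap V (pos m) (pos n)) (B m) (B n)" if m: "odd m" "n = m + 1 \<or> n = m - 1" for m n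
  proof -
    have *: "imap V (pos m) (pos n) b = H m n b" if "b \<in> B m" for b
      using H[of m n] m bas[of m] span_base[OF that] by auto
    then have "{b \<in> B m. imap V (pos m) (pos n) b \<noteq> 0} = {b \<in> B m. H m n b \<noteq> 0}"
      by auto
    moreover have "inj_on (imap V (pos m) (pos n)) {b \<in> B m. H m n b \<noteq> 0}
        = inj_on (H m n) {b \<in> B m. H m n b \<noteq> 0}"
      using * by (intro inj_on_cong) auto
    ultimately show ?thesis using arrowH[OF m] * by (simp add: basis_arrow_def)
  qed
  show ?thesis by (intro exI[of _ B]) (use bas arrow in auto)
qed

text \<open>For \<open>r m\<close> a partial bijection between \<open>B m\<close> and
  \<open>B (m + 1)\<close>, these are the maximal paths, with 0 marking positions off the path,
  together with the zero family.\<close>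

definition is_thread :: "(int \<Rightarrow> 'v::zero set) \<Rightarrow> (int \<Rightarrow> 'v \<Rightarrow> 'v \<Rightarrow> bool) \<Rightarrow> (int \<Rightarrow> 'v) \<Rightarrow> bool" where
  "is_thread B r x \<longleftrightarrow> (\<forall>m. x m = 0 \<or> x m \<in> B m)
     \<and> (\<forall>m. x m \<noteq> 0 \<and> x (m + 1) \<noteq> 0 \<longrightarrow> r m (x m) (x (m + 1)))
     \<and> (\<forall>m e. r m (x m) e \<longrightarrow> x (m + 1) = e)
     \<and> (\<forall>m e. r m e (x (m + 1)) \<longrightarrow> x m = e)
     \<and> (\<forall>l m n. l \<le> m \<and> m \<le> n \<and> x l \<noteq> 0 \<and> x n \<noteq> 0 \<longrightarrow> x m \<noteq> 0)"

text \<open>Next to a nonzero entry the relation decides; once an entry is 0, the absence of gaps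
  keeps the thread 0 further out.\<close>

lemma thread_unique:
  assumes x: "is_thread B r x" and y: "is_thread B r y" and m: "x m = y m" "x m \<noteq> 0"
  shows "x = y"
proof -
  have right: "x (m + int k) = y (m + int k)" for k
  proof (induction k)
    case (Suc k)
    have e: "m + int (Suc k) = m + int k + 1" by simp
    show ?case
    proof (cases "x (m + int k) = 0")
      case True
      have "z (m + int (Suc k)) = 0" if "is_thread B r z" "z m \<noteq> 0" "z (m + int k) = 0" for z
        using that unfolding is_thread_def by (metis add_left_mono le_add_same_cancel1 of_nat_0_le_iff of_nat_mono lessI less_imp_le)
      then show ?thesis using x y m True Suc by metis
    next
      case False
      then show ?thesis using x y Suc unfolding is_thread_def e by metis
    qed
  qed (simp add: m)
  have left: "x (m - int k) = y (m - int k)" for k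
  proof (induction k)
    case (Suc k)
    have e: "m - int k = m - int (Suc k) + 1" by simp
    show ?case
    proof (cases "x (m - int k) = 0")
      case True
      have "z (m - int (Suc k)) = 0" if z: "is_thread B r z" "z m \<noteq> 0" "z (m - int k) = 0" for z
      proof -
        have "m - int (Suc k) \<le> m - int k" "m - int k \<le> m" by auto
        then show ?thesis using z unfolding is_thread_def by blast
      qed
      then show ?thesis using x y m True Suc by metis
    next
      case False
      then show ?thesis using x y Suc unfolding is_thread_def e by metis
    qed
  qed (simp add: m)
  show ?thesis
  proof
    fix n show "x n = y n"
      using right[of "nat (n - m)"] left[of "nat (m - n)"] by (cases "m \<le> n") auto
  qed
qed

text \<open>\<open>u\<close> follows partners to the right and \<open>w\<close> to the left,
  dropping to 0 when there is none. As 0 lies in no \<open>B m\<close>, it has no partner, so a path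
  that has ended stays ended.\<close>

lemma thread_exists:
  assumes B0: "\<And>m. 0 \<notin> B m"
    and r: "\<And>m e e'. r m e e' \<Longrightarrow> e \<in> B m \<and> e' \<in> B (m + 1)"
    and func: "\<And>m e e1 e2. r m e e1 \<Longrightarrow> r m e e2 \<Longrightarrow> e1 = e2"
    and inj: "\<And>m e1 e2 e. r m e1 e \<Longrightarrow> r m e2 e \<Longrightarrow> e1 = e2"
    and e: "e \<in> B m"
  shows "\<exists>x. is_thread B r x \<and> x m = e"
proof -
  define u where "u = rec_nat e (\<lambda>k a. if \<exists>e'. r (m + int k) a e' then SOME e'. r (m + int k) a e' else 0)"
  define w where "w = rec_nat e (\<lambda>k a. if \<exists>e'. r (m - int k - 1) e' a then SOME e'. r (m - int k - 1) e' a else 0)"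
  have u0: "u 0 = e" and w0: "w 0 = e" by (simp_all add: u_def w_def)
  have uS: "u (Suc k) = (if \<exists>e'. r (m + int k) (u k) e' then SOME e'. r (m + int k) (u k) e' else 0)" for k
    by (simp only: u_def old.nat.rec)
  have wS: "w (Suc k) = (if \<exists>e'. r (m - int k - 1) e' (w k) then SOME e'. r (m - int k - 1) e' (w k) else 0)" for k
    by (simp only: w_def old.nat.rec)
  have u1: "r (m + int k) (u k) (u (Suc k)) \<or> u (Suc k) = 0 \<and> (\<forall>e'. \<not> r (m + int k) (u k) e')" for k
    unfolding uS by (auto intro: someI)
  have w1: "r (m - int k - 1) (w (Suc k)) (w k) \<or> w (Suc k) = 0 \<and> (\<forall>e'. \<not> r (m - int k - 1) e' (w k))" for k
    unfolding wS by (auto intro: someI)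
  have r0: "\<not> r n 0 a" "\<not> r n a 0" for n a using r B0 by blast+
  have mono: "f l \<noteq> 0" if "\<And>k. f (Suc k) \<noteq> 0 \<Longrightarrow> f k \<noteq> 0" "l \<le> k" "f k \<noteq> 0" for f :: "nat \<Rightarrow> 'a" and k l
    using that(2,3) by (induction rule: dec_induct) (use that(1) in auto)
  have umono: "l \<le> k \<Longrightarrow> u k \<noteq> 0 \<Longrightarrow> u l \<noteq> 0" for l k
  proof (rule mono)
    show "u k \<noteq> 0" if "u (Suc k) \<noteq> 0" for k using u1[of k] that r0[of "m + int k"] by auto
  qed
  have wmono: "l \<le> k \<Longrightarrow> w k \<noteq> 0 \<Longrightarrow> w l \<noteq> 0" for l k
  proof (rule mono)
    show "w k \<noteq> 0" if "w (Suc k) \<noteq> 0" for k using w1[of k] that r0[of "m - int k - 1"] by auto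
  qed
  have uB: "u k = 0 \<or> u k \<in> B (m + int k)" for k
  proof (cases k)
    case (Suc j)
    then show ?thesis using u1[of j] r[of "m + int j"] by (auto simp: ac_simps)
  qed (use u0 e in auto)
  have wB: "w k = 0 \<or> w k \<in> B (m - int k)" for k
  proof (cases k)
    case (Suc j)
    then show ?thesis using w1[of j] r[of "m - int j - 1"] by (auto simp: algebra_simps)
  qed (use w0 e in auto)
  define x where "x n = (if m \<le> n then u (nat (n - m)) else w (nat (m - n)))" for n
  have xu: "x (m + int k) = u k" for k by (simp add: x_def)
  have xw: "x (m - int k) = w k" for k by (cases "k = 0") (simp_all add: x_def u0 w0)
  have step: "r n (x n) (x (n + 1)) \<or> x (n + 1) = 0 \<and> (\<forall>e'. \<not> r n (x n) e')
      \<or> x n = 0 \<and> (\<forall>e'. \<not> r n e' (x (n + 1)))" for n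
  proof (cases "m \<le> n")
    case True
    then obtain k where n: "n = m + int k" using zle_iff_zadd by blast
    then have n1: "n + 1 = m + int (Suc k)" by simp
    have "x n = u k" unfolding n by (rule xu)
    moreover have "x (n + 1) = u (Suc k)" unfolding n1 by (rule xu)
    ultimately show ?thesis using u1[of k] n by auto
  next
    case False
    then have "n + 1 \<le> m" by simp
    then obtain k where k: "m = n + 1 + int k" using zle_iff_zadd by blast
    then have n: "n + 1 = m - int k" "n = m - int k - 1" "n = m - int (Suc k)" by auto
    have "x n = w (Suc k)" unfolding n(3) by (rule xw)
    moreover have "x (n + 1) = w k" unfolding n(1) by (rule xw)
    ultimately show ?thesis using w1[of k] n(2) by auto
  qed
  have "x m = e" by (simp add: x_def u0)
  moreover have "is_thread B r x"
    unfolding is_thread_def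
  proof (intro conjI allI impI)
    show "x n = 0 \<or> x n \<in> B n" for n
    proof (cases "m \<le> n")
      case True
      then have "m + int (nat (n - m)) = n" by simp
      then show ?thesis using uB[of "nat (n - m)"] True by (simp add: x_def)
    next
      case False
      then have "m - int (nat (m - n)) = n" by simp
      then show ?thesis using wB[of "nat (m - n)"] False by (simp add: x_def)
    qed
    show "r n (x n) (x (n + 1))" if "x n \<noteq> 0 \<and> x (n + 1) \<noteq> 0" for n
      using step[of n] that by blast
    show "x (n + 1) = e'" if "r n (x n) e'" for n e'
      using step[of n] that func[OF that, symmetric] r0(1)[of n e'] by metis
    show "x n = e'" if "r n e' (x (n + 1))" for n e'
      using step[of n] that inj[OF that, symmetric] r0(2)[of n e'] by metis
    show "x n \<noteq> 0" if "l \<le> n \<and> n \<le> k \<and> x l \<noteq> 0 \<and> x k \<noteq> 0" for l n k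
    proof (cases "m \<le> n")
      case True
      then have "nat (n - m) \<le> nat (k - m)" "m \<le> k" using that by auto
      moreover from this True have "x k = u (nat (k - m))" "x n = u (nat (n - m))" by (simp_all add: x_def)
      ultimately show ?thesis using umono[of "nat (n - m)" "nat (k - m)"] that by metis
    next
      case False
      then have "nat (m - n) \<le> nat (m - l)" "\<not> m \<le> l" using that by auto
      moreover from this False have "x l = w (nat (m - l))" "x n = w (nat (m - n))" by (simp_all add: x_def)
      ultimately show ?thesis using wmono[of "nat (m - n)" "nat (m - l)"] that by metis
    qed
  qed
  ultimately show ?thesis by blast
qed

text \<open>An interval decomposition of \<open>V\<close> described inside \<open>V\<close>: each
  nonzero thread spans an interval submodule, and the entries at \<open>m\<close> form a basis of
  the fibre.\<close>

definition thread_decomp :: "('k::field, 'v::ab_group_add) pmod \<Rightarrow> (int \<Rightarrow> 'v) set \<Rightarrow> bool" where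
  "thread_decomp V \<Lambda> \<longleftrightarrow>
     (\<forall>m. finite {x\<in>\<Lambda>. x m \<noteq> 0} \<and> inj_on (\<lambda>x. x m) {x\<in>\<Lambda>. x m \<noteq> 0}
        \<and> \<not> module.dependent (scl V) {x m | x. x \<in> \<Lambda> \<and> x m \<noteq> 0}
        \<and> module.span (scl V) {x m | x. x \<in> \<Lambda> \<and> x m \<noteq> 0} = fib V (pos m))
     \<and> (\<forall>x\<in>\<Lambda>. \<forall>m n. odd m \<and> (n = m + 1 \<or> n = m - 1) \<and> x m \<noteq> 0 \<longrightarrow> imap V (pos m) (pos n) (x m) = x n)
     \<and> (\<forall>x\<in>\<Lambda>. \<forall>l m n. l \<le> m \<and> m \<le> n \<and> x l \<noteq> 0 \<and> x n \<noteq> 0 \<longrightarrow> x m \<noteq> 0)"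

lemma thread_decomp_exists:
  fixes V :: "('k::field, 'v::ab_group_add) pmod"
  assumes V: "is_pmod ZZ V" "pfd ZZ V"
  shows "\<exists>\<Lambda>. thread_decomp V \<Lambda>"
proof -
  interpret vector_space "scl V" using V by (simp add: is_pmod_def)
  obtain B where B: "\<And>m. independent (B m)" "\<And>m. span (B m) = fib V (pos m)"
    and a1: "\<And>m. odd m \<Longrightarrow> basis_arrow (imap V (pos m) (pos (m + 1))) (B m) (B (m + 1))"
    and a2: "\<And>m. odd m \<Longrightarrow> basis_arrow (imap V (pos m) (pos (m - 1))) (B m) (B (m - 1))"
    using zigzag_basis[OF V] by blast
  have B0: "0 \<notin> B m" for m using B(1) dependent_zero by blast
  have finB: "finite (B m)" for m
  proof -
    obtain F where "finite F" "fib V (pos m) = span F" using V(2) pos_ZZ[of m] unfolding pfd_def by blast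
    then show ?thesis using independent_span_bound[of F "B m"] B[of m] span_superset[of "B m"] by auto
  qed
  \<comment> \<open>The arrow between \<open>m\<close> and \<open>m + 1\<close> starts at the odd
    end, hence the two readings; asking for basis vectors on both sides excludes those sent to
    0.\<close>
  define r where "r m e e' \<longleftrightarrow> e \<in> B m \<and> e' \<in> B (m + 1) \<and>
    (if odd m then imap V (pos m) (pos (m + 1)) e = e' else imap V (pos (m + 1)) (pos m) e' = e)" for m e e'
  have func: "e1 = e2" if "r m e e1" "r m e e2" for m e e1 e2
  proof (cases "odd m")
    case False
    then have "basis_arrow (imap V (pos (m + 1)) (pos m)) (B (m + 1)) (B m)" using a2[of "m + 1"] by simp
    moreover have "e \<noteq> 0" using that B0 by (auto simp: r_def)
    ultimately show ?thesis using that False by (auto simp: r_def basis_arrow_def inj_on_def)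
  qed (use that in \<open>auto simp: r_def\<close>)
  have inj: "e1 = e2" if "r m e1 e" "r m e2 e" for m e e1 e2
  proof (cases "odd m")
    case True
    moreover have "e \<noteq> 0" using that B0 by (auto simp: r_def)
    ultimately show ?thesis using that a1[OF True] by (auto simp: r_def basis_arrow_def inj_on_def)
  qed (use that in \<open>auto simp: r_def\<close>)
  have rB: "e \<in> B m \<and> e' \<in> B (m + 1)" if "r m e e'" for m e e' using that by (simp add: r_def)
  define \<Lambda> where "\<Lambda> = {x. is_thread B r x}"
  have vals: "{x m | x. x \<in> \<Lambda> \<and> x m \<noteq> 0} = B m" for m
  proof (intro equalityI subsetI)
    fix e assume "e \<in> B m"
    have "\<exists>x. is_thread B r x \<and> x m = e"
    proof (rule thread_exists[of B r])
      show "e1 = e2" if "r n a e1" "r n a e2" for n a e1 e2 using that by (rule func)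
      show "e1 = e2" if "r n e1 a" "r n e2 a" for n a e1 e2 using that by (rule inj)
    qed (use B0 rB \<open>e \<in> B m\<close> in simp_all)
    then obtain x where "is_thread B r x" "x m = e" by blast
    moreover from this have "x m \<noteq> 0" using \<open>e \<in> B m\<close> B0[of m] by metis
    ultimately show "e \<in> {x m | x. x \<in> \<Lambda> \<and> x m \<noteq> 0}" unfolding \<Lambda>_def by blast
  next
    fix e assume "e \<in> {x m | x. x \<in> \<Lambda> \<and> x m \<noteq> 0}"
    then show "e \<in> B m" unfolding \<Lambda>_def is_thread_def by blast
  qed
  have injL: "inj_on (\<lambda>x. x m) {x\<in>\<Lambda>. x m \<noteq> 0}" for m
  proof (rule inj_onI)
    fix x y assume "x \<in> {x\<in>\<Lambda>. x m \<noteq> 0}" "y \<in> {x\<in>\<Lambda>. x m \<noteq> 0}" "x m = y m"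
    then show "x = y" by (intro thread_unique[of B r x y m]) (simp_all add: \<Lambda>_def)
  qed
  have "(\<lambda>x. x m) ` {x\<in>\<Lambda>. x m \<noteq> 0} = B m" for m
    unfolding vals[of m, symmetric] setcompr_eq_image ..
  then have A1: "finite {x\<in>\<Lambda>. x m \<noteq> 0}" for m using finite_imageD[OF _ injL, of m] finB[of m] by simp
  have A2: "imap V (pos m) (pos n) (x m) = x n"
    if x: "x \<in> \<Lambda>" and m: "odd m" "n = m + 1 \<or> n = m - 1" "x m \<noteq> 0" for x m n
  proof -
    have th: "is_thread B r x" using x by (simp add: \<Lambda>_def)
    have xB: "x m \<in> B m" using th m(3) unfolding is_thread_def by metis
    have th2: "r n (x n) (x (n + 1))" if "x n \<noteq> 0" "x (n + 1) \<noteq> 0" for n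
      using th that unfolding is_thread_def by (elim conjE) blast
    have th3: "x (n + 1) = e" if "r n (x n) e" for n e
      using th that unfolding is_thread_def by (elim conjE) blast
    have th4: "x n = e" if "r n e (x (n + 1))" for n e
      using th that unfolding is_thread_def by (elim conjE) blast
    consider "n = m + 1" | "n = m - 1" using m by blast
    then show ?thesis
    proof cases
      case 1
      show ?thesis
      proof (cases "imap V (pos m) (pos n) (x m) = 0")
        case True
        have "x n = 0"
        proof (rule ccontr)
          assume "x n \<noteq> 0"
          then have "r m (x m) (x n)" using th2[of m] m 1 by simp
          then show False using True \<open>x n \<noteq> 0\<close> m 1 by (simp add: r_def)
        qed
        then show ?thesis using True by simp
      next
        case False
        then have "imap V (pos m) (pos n) (x m) \<in> B n" using a1[OF m(1)] xB 1 by (auto simp: basis_arrow_def)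
        then have "r m (x m) (imap V (pos m) (pos n) (x m))" using xB m 1 by (simp add: r_def)
        then show ?thesis using th3 1 by simp
      qed
    next
      case 2
      show ?thesis
      proof (cases "imap V (pos m) (pos n) (x m) = 0")
        case True
        have "x n = 0"
        proof (rule ccontr)
          assume "x n \<noteq> 0"
          then have "r n (x n) (x (n + 1))" using th2[of n] m 2 by simp
          then show False using True \<open>x n \<noteq> 0\<close> m 2 by (simp add: r_def)
        qed
        then show ?thesis using True by simp
      next
        case False
        then have "imap V (pos m) (pos n) (x m) \<in> B n" using a2[OF m(1)] xB 2 by (auto simp: basis_arrow_def)
        then have "r n (imap V (pos m) (pos n) (x m)) (x (n + 1))" using xB m 2 by (simp add: r_def)
        then show ?thesis using th4 2 by simp
      qed
    qed
  qed
  have A3: "x m \<noteq> 0" if "x \<in> \<Lambda>" "l \<le> m" "m \<le> n" "x l \<noteq> 0" "x n \<noteq> 0" for x l m n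
    using that unfolding \<Lambda>_def is_thread_def mem_Collect_eq by (elim conjE) blast
  have "thread_decomp V \<Lambda>"
    unfolding thread_decomp_def vals
  proof (intro conjI allI ballI impI)
    show "x m \<noteq> 0" if "x \<in> \<Lambda>" "l \<le> m \<and> m \<le> n \<and> x l \<noteq> 0 \<and> x n \<noteq> 0" for x l m n
      using A3[of x l m n] that by simp
  qed (use A1 A2 B injL in simp_all)
  then show ?thesis by blast
qed

section \<open>The block extension of a sum of threads\<close>

lemma vector_space_mult: "vector_space ((*) :: 'k::field \<Rightarrow> 'k \<Rightarrow> 'k)"
  by unfold_locales (simp_all add: distrib_left distrib_right mult.assoc)

lemma module_mult: "module ((*) :: 'k::field \<Rightarrow> 'k \<Rightarrow> 'k)"
  by (simp add: module_iff_vector_space vector_space_mult)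

lemma lin_map_sum:
  assumes s: "vector_space s" and t: "vector_space t" and A: "module.subspace s A" and f: "lin_map s t A B f"
    and a: "\<And>i. i \<in> I \<Longrightarrow> a i \<in> A"
  shows "f (\<Sum>i\<in>I. a i) = (\<Sum>i\<in>I. f (a i))"
proof -
  interpret s: vector_space s by (rule s)
  have f0: "f 0 = 0"
  proof -
    have "f (0 + 0) = f 0 + f 0" using f s.subspace_0[OF A] unfolding lin_map_def by blast
    then show ?thesis by simp
  qed
  show ?thesis using a
  proof (induction I rule: infinite_finite_induct)
    case (insert i I)
    have "(\<Sum>i\<in>I. a i) \<in> A" using insert.prems by (intro s.subspace_sum[OF A]) simp
    then have "f (a i + (\<Sum>i\<in>I. a i)) = f (a i) + f (\<Sum>i\<in>I. a i)"
      using f insert.prems unfolding lin_map_def by blast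
    then show ?case using insert by simp
  qed (simp_all add: f0)
qed

text \<open>The points \<open>p\<close> where the thread survives in the colimit over the segment
  below \<open>p\<close>: it has to enter the segment, and none of its entries at a source of the
  segment may be sent to 0 at a sink of the segment, since that kills its class.\<close>

definition blk :: "(int \<Rightarrow> 'v::zero) \<Rightarrow> pt set" where
  "blk x = {p \<in> UU. (\<exists>m. pos m \<in> below p \<and> x m \<noteq> 0) \<and>
     (\<forall>m n. odd m \<and> (n = m + 1 \<or> n = m - 1) \<and> pos m \<in> below p \<and> pos n \<in> below p \<and> x m \<noteq> 0 \<longrightarrow> x n \<noteq> 0)}"

text \<open>Uniformly in the parity, position \<open>m\<close> has the coordinates
  \<open>(m + 1) div 2\<close> and \<open>m div 2\<close>.\<close>

lemma pos_in_below:
  "pos m \<in> below p \<longleftrightarrow>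
     fst p \<le> of_int ((m + 1) div 2) \<and> of_int (m div 2) \<le> snd p"
proof -
  have "(m + 1) div 2 = (if even m then m div 2 else m div 2 + 1)" by presburger
  then show ?thesis using pos_ZZ[of m] by (auto simp: below_def opp_le_def pos_def)
qed

lemma below_convex:
  assumes "pos l \<in> below p" "pos n \<in> below p" "l \<le> m" "m \<le> n"
  shows "pos m \<in> below p"
proof -
  have "(l + 1) div 2 \<le> (m + 1) div 2" using assms(3) by (intro zdiv_mono1) simp_all
  then have "real_of_int ((l + 1) div 2) \<le> real_of_int ((m + 1) div 2)" by (simp only: of_int_le_iff)
  moreover have "m div 2 \<le> n div 2" using assms(4) by (intro zdiv_mono1) simp_all
  then have "real_of_int (m div 2) \<le> real_of_int (n div 2)" by (simp only: of_int_le_iff)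
  ultimately show ?thesis using assms(1,2) unfolding pos_in_below by (meson order_trans)
qed

lemma finite_below: "finite {m. pos m \<in> below p}"
proof (rule finite_subset)
  show "{m. pos m \<in> below p} \<subseteq> {2 * \<lceil>fst p\<rceil> - 1 .. 2 * \<lfloor>snd p\<rfloor> + 1}"
  proof
    fix m assume "m \<in> {m. pos m \<in> below p}"
    then have "\<lceil>fst p\<rceil> \<le> (m + 1) div 2" "m div 2 \<le> \<lfloor>snd p\<rfloor>"
      unfolding pos_in_below by (simp_all add: ceiling_le_iff le_floor_iff)
    then show "m \<in> {2 * \<lceil>fst p\<rceil> - 1 .. 2 * \<lfloor>snd p\<rfloor> + 1}" by simp presburger
  qed
qed simp

section \<open>Colimits below a point, computed thread by thread\<close>

locale threads =
  fixes V :: "('k::field, 'v::ab_group_add) pmod" and \<Lambda> :: "(int \<Rightarrow> 'v) set"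
  assumes V: "is_pmod ZZ V" and \<Lambda>: "thread_decomp V \<Lambda>"
begin

lemma vsV: "vector_space (scl V)"
  using V by (simp add: is_pmod_def)

sublocale V: vector_space "scl V" by (rule vsV)
sublocale W: vector_space "coprod_scl V" by (rule vector_space_coprod_scl[OF vsV])

definition act :: "int \<Rightarrow> (int \<Rightarrow> 'v) set" where
  "act m = {x \<in> \<Lambda>. x m \<noteq> 0}"

definition bas :: "int \<Rightarrow> 'v set" where
  "bas m = {x m | x. x \<in> \<Lambda> \<and> x m \<noteq> 0}"

lemma bas_eq: "bas m = (\<lambda>x. x m) ` act m"
  by (auto simp: bas_def act_def)

lemma finite_act: "finite (act m)"
  and inj_act: "inj_on (\<lambda>x. x m) (act m)"
  and indep_bas: "V.independent (bas m)"
  and span_bas: "V.span (bas m) = fib V (pos m)"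
  using \<Lambda> unfolding thread_decomp_def act_def bas_def by simp_all

lemma thread_step:
  "x \<in> \<Lambda> \<Longrightarrow> odd m \<Longrightarrow> n = m + 1 \<or> n = m - 1 \<Longrightarrow> x m \<noteq> 0 \<Longrightarrow> imap V (pos m) (pos n) (x m) = x n"
  using \<Lambda> unfolding thread_decomp_def by (elim conjE) blast

lemma thread_convex:
  assumes "x \<in> \<Lambda>" "l \<le> m" "m \<le> n" "x l \<noteq> 0" "x n \<noteq> 0"
  shows "x m \<noteq> 0"
  using \<Lambda> assms unfolding thread_decomp_def by (elim conjE) blast

lemma thread_in_fib: "x \<in> act m \<Longrightarrow> x m \<in> fib V (pos m)"
  unfolding span_bas[symmetric] bas_eq by (rule V.span_base) (rule imageI)

definition coef :: "int \<Rightarrow> (int \<Rightarrow> 'v) \<Rightarrow> 'v \<Rightarrow> 'k" where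
  "coef m x v = (if x m = 0 then 0 else V.representation (bas m) v (x m))"

lemma coef_add: "v \<in> fib V (pos m) \<Longrightarrow> w \<in> fib V (pos m) \<Longrightarrow> coef m x (v + w) = coef m x v + coef m x w"
  by (simp add: coef_def V.representation_add[OF indep_bas] span_bas)

lemma coef_scale: "v \<in> fib V (pos m) \<Longrightarrow> coef m x (scl V c v) = c * coef m x v"
  by (simp add: coef_def V.representation_scale[OF indep_bas] span_bas)

lemma coef_thread: "y \<in> act m \<Longrightarrow> x \<in> \<Lambda> \<Longrightarrow> coef m x (y m) = (if x = y then 1 else 0)"
proof -
  assume y: "y \<in> act m" and x: "x \<in> \<Lambda>"
  have "V.representation (bas m) (y m) = (\<lambda>b. if b = y m then 1 else 0)"
    by (rule V.representation_basis[OF indep_bas]) (use y in \<open>simp add: bas_eq\<close>)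
  moreover have "x = y" if "x m = y m" "x m \<noteq> 0"
    using inj_act[of m] x y that by (intro inj_onD[OF inj_act[of m]]) (simp_all add: act_def)
  ultimately show "coef m x (y m) = (if x = y then 1 else 0)"
    using y by (auto simp: coef_def act_def)
qed

lemma coef_sum:
  assumes "v \<in> fib V (pos m)"
  shows "v = (\<Sum>x\<in>act m. scl V (coef m x v) (x m))"
proof -
  have fin: "finite (bas m)" by (simp add: bas_eq finite_act)
  have "v = (\<Sum>b\<in>bas m. scl V (V.representation (bas m) v b) b)"
    using V.sum_representation_eq[OF indep_bas _ fin subset_refl, of v] assms span_bas by simp
  also have "\<dots> = (\<Sum>x\<in>act m. scl V (V.representation (bas m) v (x m)) (x m))"
    unfolding bas_eq by (subst sum.reindex[OF inj_act]) simp
  also have "\<dots> = (\<Sum>x\<in>act m. scl V (coef m x v) (x m))"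
    by (rule sum.cong) (simp_all add: coef_def act_def)
  finally show ?thesis .
qed

lemma lin_map_coef: "lin_map (scl V) (*) (fib V (pos m)) UNIV (coef m x)"
  unfolding lin_map_def using coef_add coef_scale by simp

lemma lin_map_imap: "odd m \<Longrightarrow> n = m + 1 \<or> n = m - 1 \<Longrightarrow>
    lin_map (scl V) (scl V) (fib V (pos m)) (fib V (pos n)) (imap V (pos m) (pos n))"
  using V pos_ZZ[of m] pos_ZZ[of n] pos_le_iff[of m n] unfolding is_pmod_def by blast

lemma subspace_fib: "V.subspace (fib V (pos m))"
  using span_bas[of m] V.subspace_span[of "bas m"] by simp

text \<open>An arrow sends the entry of a thread to the next entry of the same thread, and different
  threads never share a nonzero entry. So coefficients are transported unless the thread
  \<open>x\<close> itself dies between \<open>m\<close> and \<open>n\<close>.\<close>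

lemma coef_imap:
  assumes m: "odd m" "n = m + 1 \<or> n = m - 1" and v: "v \<in> fib V (pos m)"
    and x: "x \<in> \<Lambda>" "x m \<noteq> 0 \<Longrightarrow> x n \<noteq> 0"
  shows "coef n x (imap V (pos m) (pos n) v) = coef m x v"
proof -
  let ?f = "imap V (pos m) (pos n)"
  have vt: "vector_space ((*) :: 'k \<Rightarrow> 'k \<Rightarrow> 'k)" by (rule vector_space_mult)
  have sc: "scl V c w \<in> fib V (pos m)" if "w \<in> fib V (pos m)" for c w
    using V.subspace_scale[OF subspace_fib that] .
  have fin: "?f w \<in> fib V (pos n)" if "w \<in> fib V (pos m)" for w
    using lin_map_imap[OF m] that by (auto simp: lin_map_def)
  have fscl: "?f (scl V c w) = scl V c (?f w)" if "w \<in> fib V (pos m)" for c w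
    using lin_map_imap[OF m] that by (auto simp: lin_map_def)
  have "?f v = (\<Sum>y\<in>act m. ?f (scl V (coef m y v) (y m)))"
    using lin_map_sum[OF vsV vsV subspace_fib lin_map_imap[OF m], of "act m" "\<lambda>y. scl V (coef m y v) (y m)"]
      sc thread_in_fib coef_sum[OF v] by simp
  then have "coef n x (?f v) = (\<Sum>y\<in>act m. coef n x (?f (scl V (coef m y v) (y m))))"
    using lin_map_sum[OF vsV vt subspace_fib lin_map_coef, of "act m" "\<lambda>y. ?f (scl V (coef m y v) (y m))" n x]
      sc thread_in_fib fin by simp
  also have "\<dots> = (\<Sum>y\<in>act m. if y = x then coef m x v else 0)"
  proof (rule sum.cong[OF refl])
    fix y assume y: "y \<in> act m"
    then have fy: "?f (y m) = y n" using thread_step[OF _ m] by (simp add: act_def)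
    have "coef n x (?f (scl V (coef m y v) (y m))) = coef m y v * coef n x (y n)"
      using fscl[OF thread_in_fib[OF y]] coef_scale[of "y n" n x] fin[OF thread_in_fib[OF y]] fy by simp
    also have "\<dots> = (if y = x then coef m x v else 0)"
    proof (cases "y n = 0")
      case True
      moreover have "coef n x 0 = 0" by (simp add: coef_def V.representation_zero)
      ultimately show ?thesis using x y by (auto simp: act_def)
    next
      case False
      then have "y \<in> act n" using y by (simp add: act_def)
      then show ?thesis using coef_thread[of y n x] x by auto
    qed
    finally show "coef n x (?f (scl V (coef m y v) (y m))) = (if y = x then coef m x v else 0)" .
  qed
  also have "\<dots> = coef m x v"
    using finite_act[of m] x(1) by (simp add: act_def coef_def)
  finally show ?thesis .
qed

abbreviation dg :: "pt \<Rightarrow> pt \<Rightarrow> 'v \<Rightarrow> pt \<Rightarrow> 'v" where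
  "dg p a v \<equiv> colim_map V (below p) (inj_at a v)"

lemma below_pos: "a \<in> below p \<Longrightarrow> \<exists>m. a = pos m"
  using ZZ_eq by (auto simp: below_def)

text \<open>As no source entry of \<open>x\<close> dies in the segment, the coefficient functions of
  \<open>x\<close> form a cocone, and the universal property yields the functional.\<close>

lemma coord_exists:
  assumes x: "x \<in> \<Lambda>"
    and compat: "\<And>m n. odd m \<Longrightarrow> n = m + 1 \<or> n = m - 1 \<Longrightarrow> pos m \<in> below p \<Longrightarrow> pos n \<in> below p \<Longrightarrow> x m \<noteq> 0 \<Longrightarrow> x n \<noteq> 0"
  shows "\<exists>u. lin_map (coprod_scl V) (*) (colim V (below p)) UNIV u \<and>
    (\<forall>m v. pos m \<in> below p \<longrightarrow> v \<in> fib V (pos m) \<longrightarrow> u (dg p (pos m) v) = coef m x v)"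
proof -
  interpret diagram V "below p" using V by (rule diagram_below)
  have inv: "inv pos (pos m) = m" for m by (simp add: inj_pos)
  have "\<exists>u. lin_map (coprod_scl V) (*) (colim V (below p)) UNIV u \<and>
    (\<forall>a\<in>below p. \<forall>v\<in>fib V a. u (dg p a v) = coef (inv pos a) x v)"
  proof (rule universal(1))
    show "vector_space ((*) :: 'k \<Rightarrow> 'k \<Rightarrow> 'k)" by (rule vector_space_mult)
    show "module.subspace ((*) :: 'k \<Rightarrow> 'k \<Rightarrow> 'k) UNIV" by (rule module.subspace_UNIV[OF module_mult])
    fix a assume a: "a \<in> below p"
    then obtain m where am: "a = pos m" using below_pos by blast
    show "lin_map (scl V) (*) (fib V a) UNIV (coef (inv pos a) x)"
      unfolding am inv by (rule lin_map_coef)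
    fix b v assume b: "b \<in> below p" "a \<preceq> b" "v \<in> fib V a"
    obtain n where bn: "b = pos n" using b below_pos by blast
    show "coef (inv pos b) x (imap V a b v) = coef (inv pos a) x v"
    proof (cases "m = n")
      case True
      have "imap V a a v = v" using V a b below_def[of p] by (auto simp: is_pmod_def)
      then show ?thesis using True am bn by simp
    next
      case False
      then have mn: "odd m" "n = m + 1 \<or> n = m - 1" using b(2) am bn pos_le_iff by auto
      show ?thesis unfolding am bn inv
        using coef_imap[OF mn _ x, of v] compat[OF mn] a b am bn by simp
    qed
  qed
  then show ?thesis using inv by metis
qed


lemma dg_adjacent:
  assumes "x \<in> \<Lambda>" "odd m" "n = m + 1 \<or> n = m - 1" "pos m \<in> below p" "pos n \<in> below p" "x m \<noteq> 0"
  shows "dg p (pos n) (x n) = dg p (pos m) (x m)"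
proof -
  interpret diagram V "below p" using V by (rule diagram_below)
  have "pos m \<preceq> pos n" using assms pos_le_iff by blast
  moreover have "x m \<in> fib V (pos m)" using assms thread_in_fib by (simp add: act_def)
  ultimately have "dg p (pos n) (imap V (pos m) (pos n) (x m)) = dg p (pos m) (x m)"
    using assms by (intro cocone)
  then show ?thesis using thread_step[OF assms(1-3,6)] by simp
qed

text \<open>A walk along the thread, one arrow at a time. Neither the segment nor the support has
  gaps, so the walk stays inside both.\<close>

lemma dg_const_aux:
  assumes x: "x \<in> \<Lambda>" and m: "pos m \<in> below p" "x m \<noteq> 0"
  shows "pos (m + int k) \<in> below p \<Longrightarrow> x (m + int k) \<noteq> 0 \<Longrightarrow>
    dg p (pos (m + int k)) (x (m + int k)) = dg p (pos m) (x m)"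
proof (induction k)
  case (Suc k)
  let ?a = "m + int k" and ?b = "m + int (Suc k)"
  have a: "pos ?a \<in> below p" "x ?a \<noteq> 0"
    using below_convex[OF m(1) Suc.prems(1), of ?a] thread_convex[OF x, of m ?a ?b] m Suc.prems by simp_all
  have "dg p (pos ?b) (x ?b) = dg p (pos ?a) (x ?a)"
  proof (cases "odd ?a")
    case True
    then show ?thesis by (rule dg_adjacent[OF x _ _ a(1) Suc.prems(1) a(2)]) simp
  next
    case False
    then have "odd ?b" by simp
    then show ?thesis by (rule dg_adjacent[OF x _ _ Suc.prems(1) a(1) Suc.prems(2), symmetric]) simp
  qed
  then show ?case using Suc.IH[OF a] by simp
qed simp

lemma dg_const:
  assumes x: "x \<in> \<Lambda>" and m: "pos m \<in> below p" "x m \<noteq> 0" and n: "pos n \<in> below p" "x n \<noteq> 0"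
  shows "dg p (pos m) (x m) = dg p (pos n) (x n)"
proof (cases "m \<le> n")
  case True
  then obtain k where "n = m + int k" using zle_iff_zadd by blast
  then show ?thesis using dg_const_aux[OF x m, of k] n by simp
next
  case False
  then obtain k where "m = n + int k" using zle_iff_zadd[of n m] by auto
  then show ?thesis using dg_const_aux[OF x n, of k] m by simp
qed

text \<open>The failing block condition provides a source entry that the segment sends to 0, and all
  entries of the thread share its class.\<close>

lemma dg_zero:
  assumes x: "x \<in> \<Lambda>" and m: "pos m \<in> below p" "x m \<noteq> 0" and p: "p \<in> UU" "p \<notin> blk x"
  shows "dg p (pos m) (x m) = 0"
proof -
  interpret diagram V "below p" using V by (rule diagram_below)
  obtain a b where ab: "odd a" "b = a + 1 \<or> b = a - 1" "pos a \<in> below p" "pos b \<in> below p" "x a \<noteq> 0" "x b = 0"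
    using p m unfolding blk_def by blast
  have i0: "inj_at q 0 = (0 :: pt \<Rightarrow> 'v)" for q by (auto simp: inj_at_def)
  have "dg p (pos m) (x m) = dg p (pos a) (x a)" using dg_const[OF x m] ab by blast
  also have "\<dots> = dg p (pos b) (x b)" using dg_adjacent[OF x ab(1-5)] by simp
  also have "\<dots> = 0" using ab(6) i0 colim_map(3)[of 0] W.subspace_0[OF subspace_rel] by simp
  finally show ?thesis .
qed

definition active :: "pt \<Rightarrow> (int \<Rightarrow> 'v) set" where
  "active p = {x \<in> \<Lambda>. p \<in> blk x}"

lemma finite_active: "finite (active p)"
proof (rule finite_subset)
  show "active p \<subseteq> (\<Union>m\<in>{m. pos m \<in> below p}. act m)"
    by (auto simp: active_def blk_def act_def)
qed (simp add: finite_below finite_act)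

text \<open>By \<open>dg_const\<close> the class does not depend on the choice of
  \<open>m\<close>.\<close>

definition rep :: "pt \<Rightarrow> (int \<Rightarrow> 'v) \<Rightarrow> pt \<Rightarrow> 'v" where
  "rep p x = (let m = SOME m. pos m \<in> below p \<and> x m \<noteq> 0 in dg p (pos m) (x m))"

lemma rep: 
  assumes "x \<in> active p"
  obtains m where "pos m \<in> below p" "x \<in> act m" "rep p x = dg p (pos m) (x m)"
proof -
  let ?m = "SOME m. pos m \<in> below p \<and> x m \<noteq> 0"
  have "\<exists>m. pos m \<in> below p \<and> x m \<noteq> 0" using assms by (auto simp: active_def blk_def)
  then have "pos ?m \<in> below p \<and> x ?m \<noteq> 0" by (rule someI_ex)
  then show ?thesis using that[of ?m] assms by (simp add: rep_def Let_def act_def active_def)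
qed

text \<open>On the threads active at \<open>p\<close>, these functionals and the classes
  \<open>rep p\<close> are dual bases of the colimit.\<close>

definition coord :: "pt \<Rightarrow> (int \<Rightarrow> 'v) \<Rightarrow> (pt \<Rightarrow> 'v) \<Rightarrow> 'k" where
  "coord p x = (SOME u. lin_map (coprod_scl V) (*) (colim V (below p)) UNIV u \<and>
    (\<forall>m v. pos m \<in> below p \<longrightarrow> v \<in> fib V (pos m) \<longrightarrow> u (dg p (pos m) v) = coef m x v))"

lemma coord:
  assumes "x \<in> active p"
  shows "lin_map (coprod_scl V) (*) (colim V (below p)) UNIV (coord p x)"
    and "pos m \<in> below p \<Longrightarrow> v \<in> fib V (pos m) \<Longrightarrow> coord p x (dg p (pos m) v) = coef m x v"
proof -
  have "\<exists>u. lin_map (coprod_scl V) (*) (colim V (below p)) UNIV u \<and>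
    (\<forall>m v. pos m \<in> below p \<longrightarrow> v \<in> fib V (pos m) \<longrightarrow> u (dg p (pos m) v) = coef m x v)"
    using assms by (intro coord_exists) (auto simp: active_def blk_def)
  then have *: "lin_map (coprod_scl V) (*) (colim V (below p)) UNIV (coord p x) \<and>
    (\<forall>m v. pos m \<in> below p \<longrightarrow> v \<in> fib V (pos m) \<longrightarrow> coord p x (dg p (pos m) v) = coef m x v)"
    unfolding coord_def by (rule someI_ex)
  then show "lin_map (coprod_scl V) (*) (colim V (below p)) UNIV (coord p x)" by blast
  show "pos m \<in> below p \<Longrightarrow> v \<in> fib V (pos m) \<Longrightarrow> coord p x (dg p (pos m) v) = coef m x v"
    using * by blast
qed

lemma dg_in_colim: "a \<in> below p \<Longrightarrow> v \<in> fib V a \<Longrightarrow> dg p a v \<in> colim V (below p)"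
proof -
  interpret diagram V "below p" using V by (rule diagram_below)
  show "a \<in> below p \<Longrightarrow> v \<in> fib V a \<Longrightarrow> dg p a v \<in> colim V (below p)"
    unfolding colim_def by (rule imageI) (rule inj_at_coprod)
qed

lemma rep_in_colim: "x \<in> active p \<Longrightarrow> rep p x \<in> colim V (below p)"
  by (erule rep) (simp add: dg_in_colim thread_in_fib)

lemma coord_rep: "x \<in> active p \<Longrightarrow> y \<in> active p \<Longrightarrow> coord p x (rep p y) = (if x = y then 1 else 0)"
proof -
  assume x: "x \<in> active p" and y: "y \<in> active p"
  obtain m where m: "pos m \<in> below p" "y \<in> act m" "rep p y = dg p (pos m) (y m)" using rep[OF y] .
  have "coord p x (rep p y) = coef m x (y m)"
    unfolding m(3) by (rule coord(2)[OF x m(1) thread_in_fib[OF m(2)]])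
  then show "coord p x (rep p y) = (if x = y then 1 else 0)"
    using coef_thread[OF m(2), of x] x by (simp add: active_def)
qed

lemma colim_subspace: "W.subspace (colim V (below p))"
  using diagram.colim_subspace[OF diagram_below[OF V]] .

lemma lin_map_dg:
  assumes "a \<in> below p"
  shows "lin_map (scl V) (coprod_scl V) (fib V a) (colim V (below p)) (dg p a)"
proof -
  interpret diagram V "below p" using V by (rule diagram_below)
  interpret L: Vector_Spaces.linear "coprod_scl V" "coprod_scl V" "colim_map V (below p)"
    by (rule colim_map)
  have "inj_at a (v + w) = inj_at a v + inj_at a w" for v w :: 'v
    by (auto simp: inj_at_def fun_eq_iff)
  moreover have "inj_at a (scl V c v) = coprod_scl V c (inj_at a v)" for c v
    by (auto simp: inj_at_def fun_eq_iff coprod_scl_def)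
  ultimately show ?thesis
    unfolding lin_map_def using dg_in_colim[OF assms] by (auto simp: L.add L.scale)
qed

text \<open>The identity and the expansion are linear and agree on all colimit injections, so
  uniqueness in the universal property identifies them. Threads that are not active drop out by
  \<open>dg_zero\<close>.\<close>

lemma colim_expansion:
  assumes p: "p \<in> UU" and z: "z \<in> colim V (below p)"
  shows "z = (\<Sum>x\<in>active p. coprod_scl V (coord p x z) (rep p x))"
proof -
  interpret diagram V "below p" using V by (rule diagram_below)
  have vs: "vector_space (coprod_scl V)" by (rule vector_space_coprod_scl[OF vsV])
  define E where "E z = (\<Sum>x\<in>active p. coprod_scl V (coord p x z) (rep p x))" for z
  have Elin: "lin_map (coprod_scl V) (coprod_scl V) (colim V (below p)) (colim V (below p)) E"
    unfolding lin_map_def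
  proof (intro conjI ballI allI)
    show "E ` colim V (below p) \<subseteq> colim V (below p)"
      unfolding E_def
      by (intro image_subsetI W.subspace_sum[OF colim_subspace] W.subspace_scale[OF colim_subspace] rep_in_colim)
    fix y assume y: "y \<in> colim V (below p)"
    show "E (coprod_scl V c y) = coprod_scl V c (E y)" for c
      unfolding E_def W.scale_sum_right
    proof (rule sum.cong[OF refl])
      fix x assume x: "x \<in> active p"
      have "coord p x (coprod_scl V c y) = c * coord p x y"
        using coord(1)[OF x] y unfolding lin_map_def by blast
      then show "coprod_scl V (coord p x (coprod_scl V c y)) (rep p x) =
          coprod_scl V c (coprod_scl V (coord p x y) (rep p x))" by simp
    qed
    fix w assume w: "w \<in> colim V (below p)"
    show "E (y + w) = E y + E w"
      unfolding E_def sum.distrib[symmetric]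
    proof (rule sum.cong[OF refl])
      fix x assume x: "x \<in> active p"
      have "coord p x (y + w) = coord p x y + coord p x w"
        using coord(1)[OF x] y w unfolding lin_map_def by blast
      then show "coprod_scl V (coord p x (y + w)) (rep p x) =
          coprod_scl V (coord p x y) (rep p x) + coprod_scl V (coord p x w) (rep p x)"
        by (simp add: W.scale_left_distrib)
    qed
  qed
  have "(\<lambda>z. z) z = E z"
  proof (rule universal(2)[where u = "\<lambda>z. z" and u' = E and x = z and g = "dg p" and t = "coprod_scl V" and T = "colim V (below p)"])
    show "lin_map (coprod_scl V) (coprod_scl V) (colim V (below p)) (colim V (below p)) (\<lambda>z. z)"
      by (auto simp: lin_map_def)
    fix a v assume a: "a \<in> below p" "v \<in> fib V a"
    obtain m where am: "a = pos m" using a below_pos by blast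
    have pm: "pos m \<in> below p" and v: "v \<in> fib V (pos m)" using a am by auto
    have "dg p (pos m) v = (\<Sum>y\<in>act m. dg p (pos m) (scl V (coef m y v) (y m)))"
      using lin_map_sum[OF vsV vs subspace_fib lin_map_dg[OF pm], of "act m" "\<lambda>y. scl V (coef m y v) (y m)"]
        coef_sum[OF v] V.subspace_scale[OF subspace_fib thread_in_fib] by simp
    also have "\<dots> = (\<Sum>y\<in>act m. coprod_scl V (coef m y v) (dg p (pos m) (y m)))"
      using lin_map_dg[OF pm] thread_in_fib by (intro sum.cong refl) (simp add: lin_map_def)
    also have "\<dots> = (\<Sum>y\<in>act m \<inter> active p. coprod_scl V (coef m y v) (dg p (pos m) (y m)))"
    proof (rule sum.mono_neutral_right[OF finite_act], blast, rule ballI)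
      fix y assume "y \<in> act m - act m \<inter> active p"
      then have "dg p (pos m) (y m) = 0" using dg_zero[of y m p] p pm by (auto simp: act_def active_def)
      then show "coprod_scl V (coef m y v) (dg p (pos m) (y m)) = 0" by simp
    qed
    also have "\<dots> = (\<Sum>y\<in>act m \<inter> active p. coprod_scl V (coef m y v) (rep p y))"
    proof (rule sum.cong[OF refl])
      fix y assume y: "y \<in> act m \<inter> active p"
      then obtain n where n: "pos n \<in> below p" "y \<in> act n" "rep p y = dg p (pos n) (y n)" using rep by blast
      then have "dg p (pos m) (y m) = rep p y" using dg_const[of y m p n] pm y by (simp add: act_def)
      then show "coprod_scl V (coef m y v) (dg p (pos m) (y m)) = coprod_scl V (coef m y v) (rep p y)" by simp
    qed
    also have "\<dots> = (\<Sum>y\<in>active p. coprod_scl V (coef m y v) (rep p y))"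
      by (rule sum.mono_neutral_left[OF finite_active])
        (auto simp: act_def active_def coef_def)
    also have "\<dots> = E (dg p (pos m) v)"
      unfolding E_def using coord(2)[OF _ pm v] by (intro sum.cong refl) simp
    finally show "E (dg p a v) = dg p a v" using am by simp
  qed (use vs colim_subspace Elin z in \<open>simp_all add: lin_map_dg cocone\<close>)
  then show ?thesis by (simp add: E_def)
qed

end

section \<open>Direct sums of interval modules, isomorphisms and reindexing\<close>

declare split_paired_All [simp del] split_paired_Ex [simp del]

lemma dsum_interval_sel:
  shows "scl (dsum I (\<lambda>i. interval_module (J i))) = (\<lambda>c f i. c * f i)"
    and "imap (dsum I (\<lambda>i. interval_module (J i))) p q f = (\<lambda>i. if i \<in> I \<and> p \<in> J i \<and> q \<in> J i then f i else 0)"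
  by (auto simp: dsum_def interval_module_def fun_eq_iff)

lemma dsum_interval_fib:
  "f \<in> fib (dsum I (\<lambda>i. interval_module (J i))) p \<longleftrightarrow>
     (\<forall>i. f i \<noteq> 0 \<longrightarrow> i \<in> I \<and> p \<in> J i) \<and> finite {i. f i \<noteq> 0}"
proof -
  have "(\<forall>i\<in>I. f i \<in> (if p \<in> J i then UNIV else {0})) \<and> (\<forall>i. i \<notin> I \<longrightarrow> f i = 0)
      \<longleftrightarrow> (\<forall>i. f i \<noteq> 0 \<longrightarrow> i \<in> I \<and> p \<in> J i)"
    by (intro iffI conjI allI ballI impI) (force split: if_splits)+
  then show ?thesis by (simp add: dsum_def interval_module_def) blast
qed

lemma dsum_interval_fibD:
  assumes "f \<in> fib (dsum I (\<lambda>i. interval_module (J i))) p"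
  shows "finite {i. f i \<noteq> 0}" "f i \<noteq> 0 \<Longrightarrow> i \<in> I" "f i \<noteq> 0 \<Longrightarrow> p \<in> J i"
  using assms unfolding dsum_interval_fib by simp_all

lemma pmod_homD:
  assumes "pmod_hom P M N f"
  shows "a \<in> P \<Longrightarrow> lin_map (scl M) (scl N) (fib M a) (fib N a) (f a)"
    and "a \<in> P \<Longrightarrow> b \<in> P \<Longrightarrow> a \<preceq> b \<Longrightarrow> v \<in> fib M a \<Longrightarrow> f b (imap M a b v) = imap N a b (f a v)"
    and "a \<in> P \<Longrightarrow> v \<in> fib M a \<Longrightarrow> f a v \<in> fib N a"
  using assms unfolding pmod_hom_def by (simp_all add: lin_map_def image_subset_iff)

lemma lin_map_compose:
  "lin_map s t A B f \<Longrightarrow> lin_map t u B C g \<Longrightarrow> lin_map s u A C (\<lambda>x. g (f x))"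
  unfolding lin_map_def by (simp add: image_subset_iff)

lemma pmod_hom_compose:
  assumes f: "pmod_hom P M N f" and g: "pmod_hom P N K g"
  shows "pmod_hom P M K (\<lambda>a v. g a (f a v))"
  unfolding pmod_hom_def
proof (intro conjI ballI impI)
  fix a assume a: "a \<in> P"
  show "lin_map (scl M) (scl K) (fib M a) (fib K a) (\<lambda>v. g a (f a v))"
    by (rule lin_map_compose[OF pmod_homD(1)[OF f a] pmod_homD(1)[OF g a]])
  fix b v assume b: "b \<in> P" "a \<preceq> b" "v \<in> fib M a"
  have "f b (imap M a b v) = imap N a b (f a v)" using pmod_homD(2)[OF f a b] .
  moreover have "g b (imap N a b (f a v)) = imap K a b (g a (f a v))"
    using pmod_homD(2)[OF g a b(1,2) pmod_homD(3)[OF f a b(3)]] .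
  ultimately show "g b (f b (imap M a b v)) = imap K a b (g a (f a v))" by simp
qed

lemma pmod_iso_trans:
  assumes "pmod_iso P M N" "pmod_iso P N K"
  shows "pmod_iso P M K"
proof -
  obtain f g where f: "pmod_hom P M N f" "\<forall>a\<in>P. bij_betw (f a) (fib M a) (fib N a)"
    and g: "pmod_hom P N K g" "\<forall>a\<in>P. bij_betw (g a) (fib N a) (fib K a)"
    using assms unfolding pmod_iso_def by blast
  show ?thesis unfolding pmod_iso_def
  proof (intro exI conjI ballI)
    show "pmod_hom P M K (\<lambda>a v. g a (f a v))" by (rule pmod_hom_compose[OF f(1) g(1)])
    show "bij_betw (\<lambda>v. g a (f a v)) (fib M a) (fib K a)" if "a \<in> P" for a
      using bij_betw_trans[of "f a" "fib M a" "fib N a" "g a" "fib K a"] f(2) g(2) that by (simp add: comp_def)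
  qed
qed

lemma is_pmod_imap: "is_pmod P M \<Longrightarrow> a \<in> P \<Longrightarrow> b \<in> P \<Longrightarrow> a \<preceq> b \<Longrightarrow> v \<in> fib M a \<Longrightarrow> imap M a b v \<in> fib M b"
  unfolding is_pmod_def lin_map_def by blast

lemma pmod_iso_inverse:
  assumes M: "is_pmod P M" and i: "pmod_iso P M N"
  shows "\<exists>f g. pmod_hom P M N f \<and> pmod_hom P N M g \<and>
    (\<forall>a\<in>P. \<forall>v\<in>fib M a. g a (f a v) = v) \<and> (\<forall>a\<in>P. \<forall>w\<in>fib N a. f a (g a w) = w)"
proof -
  interpret vector_space "scl M" using M by (simp add: is_pmod_def)
  obtain f where f: "pmod_hom P M N f" and bij: "\<And>a. a \<in> P \<Longrightarrow> bij_betw (f a) (fib M a) (fib N a)"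
    using i unfolding pmod_iso_def by blast
  define g where "g a = inv_into (fib M a) (f a)" for a
  have fg: "f a (g a w) = w" "g a w \<in> fib M a" if "a \<in> P" "w \<in> fib N a" for a w
    using bij[OF that(1)] that(2) unfolding g_def bij_betw_def by (auto intro: f_inv_into_f inv_into_into)
  have gf: "g a (f a v) = v" if "a \<in> P" "v \<in> fib M a" for a v
    using bij[OF that(1)] that(2) unfolding g_def bij_betw_def by simp
  have flin: "lin_map (scl M) (scl N) (fib M a) (fib N a) (f a)" if "a \<in> P" for a
    using f that by (simp add: pmod_hom_def)
  have sub: "subspace (fib M a)" if "a \<in> P" for a using M that by (simp add: is_pmod_def)
  have "pmod_hom P N M g"
    unfolding pmod_hom_def
  proof (intro conjI ballI impI)
    fix a assume a: "a \<in> P"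
    show "lin_map (scl N) (scl M) (fib N a) (fib M a) (g a)"
      unfolding lin_map_def
    proof (intro conjI ballI allI)
      show "g a ` fib N a \<subseteq> fib M a" using fg(2)[OF a] by blast
      fix x assume x: "x \<in> fib N a"
      have "f a (scl M c (g a x)) = scl N c x" for c
        using flin[OF a] fg[OF a x] by (simp add: lin_map_def)
      then show "g a (scl N c x) = scl M c (g a x)" for c
        using gf[OF a subspace_scale[OF sub[OF a] fg(2)[OF a x]]] by metis
      fix y assume y: "y \<in> fib N a"
      have "f a (g a x + g a y) = x + y"
        using flin[OF a] fg[OF a x] fg[OF a y] by (simp add: lin_map_def)
      then show "g a (x + y) = g a x + g a y"
        using gf[OF a subspace_add[OF sub[OF a] fg(2)[OF a x] fg(2)[OF a y]]] by metis
    qed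
    fix b w assume b: "b \<in> P" "a \<preceq> b" "w \<in> fib N a"
    have "f b (imap M a b (g a w)) = imap N a b w"
      using f a b fg[OF a b(3)] by (simp add: pmod_hom_def)
    then show "g b (imap N a b w) = imap M a b (g a w)"
      using gf[OF b(1) is_pmod_imap[OF M a b(1,2) fg(2)[OF a b(3)]]] by metis
  qed
  then show ?thesis using f gf fg(1) by blast
qed

lemma pmod_iso_sym:
  assumes "is_pmod P M" "pmod_iso P M N"
  shows "pmod_iso P N M"
proof -
  obtain f g where fg: "pmod_hom P M N f" "pmod_hom P N M g"
    "\<And>a v. a \<in> P \<Longrightarrow> v \<in> fib M a \<Longrightarrow> g a (f a v) = v" "\<And>a w. a \<in> P \<Longrightarrow> w \<in> fib N a \<Longrightarrow> f a (g a w) = w"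
    using pmod_iso_inverse[OF assms] by blast
  have "bij_betw (g a) (fib N a) (fib M a)" if "a \<in> P" for a
    by (rule bij_betw_byWitness[where f' = "f a"])
      (use fg(3,4)[OF that] pmod_homD(3)[OF fg(1) that] pmod_homD(3)[OF fg(2) that] in \<open>simp_all add: image_subset_iff\<close>)
  then show ?thesis unfolding pmod_iso_def using fg(2) by blast
qed

lemma dsum_interval_reindex:
  fixes J :: "'i \<Rightarrow> pt set" and J' :: "'j \<Rightarrow> pt set"
  assumes \<beta>: "bij_betw \<beta> I I'" and J: "\<And>i. i \<in> I \<Longrightarrow> J' (\<beta> i) = J i"
  shows "pmod_iso P (dsum I (\<lambda>i. interval_module (J i) :: ('k::field, 'k) pmod)) (dsum I' (\<lambda>i. interval_module (J' i)))"
    (is "pmod_iso P ?M ?N")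
proof -
  define \<gamma> where "\<gamma> = inv_into I \<beta>"
  have \<gamma>: "\<gamma> k \<in> I" "\<beta> (\<gamma> k) = k" if "k \<in> I'" for k
    using \<beta> that unfolding \<gamma>_def bij_betw_def by (auto intro: f_inv_into_f inv_into_into)
  have \<gamma>\<beta>: "\<gamma> (\<beta> i) = i" "\<beta> i \<in> I'" if "i \<in> I" for i
    using \<beta> that unfolding \<gamma>_def bij_betw_def by auto
  define F where "F f = (\<lambda>k. if k \<in> I' then f (\<gamma> k) else 0)" for f :: "'i \<Rightarrow> 'k"
  define G where "G f = (\<lambda>i. if i \<in> I then f (\<beta> i) else 0)" for f :: "'j \<Rightarrow> 'k"
  have Fnz: "k \<in> I' \<and> f (\<gamma> k) \<noteq> 0" if "F f k \<noteq> 0" for f k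
    using that unfolding F_def by presburger
  have Gnz: "i \<in> I \<and> g (\<beta> i) \<noteq> 0" if "G g i \<noteq> 0" for g i
    using that unfolding G_def by presburger
  have Ff: "F f \<in> fib ?N p" if f: "f \<in> fib ?M p" for f p
    unfolding dsum_interval_fib
  proof (intro conjI allI impI)
    show "k \<in> I'" if "F f k \<noteq> 0" for k using Fnz[OF that] by blast
    show "p \<in> J' k" if "F f k \<noteq> 0" for k
    proof -
      have "p \<in> J (\<gamma> k)" using dsum_interval_fibD(3)[OF f] Fnz[OF that] by blast
      then show ?thesis using J[OF \<gamma>(1), of k] \<gamma>(2)[of k] Fnz[OF that] by simp
    qed
    have "{k. F f k \<noteq> 0} \<subseteq> \<beta> ` {i. f i \<noteq> 0}"
    proof
      fix k assume "k \<in> {k. F f k \<noteq> 0}"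
      then have k: "k \<in> I'" "f (\<gamma> k) \<noteq> 0" using Fnz by blast+
      have "k = \<beta> (\<gamma> k)" using \<gamma>(2)[OF k(1)] ..
      then show "k \<in> \<beta> ` {i. f i \<noteq> 0}" using k(2) by (rule image_eqI[OF _ CollectI])
    qed
    then show "finite {k. F f k \<noteq> 0}"
      by (rule finite_subset) (rule finite_imageI[OF dsum_interval_fibD(1)[OF f]])
  qed
  have Gg: "G g \<in> fib ?M p" if g: "g \<in> fib ?N p" for g p
    unfolding dsum_interval_fib
  proof (intro conjI allI impI)
    show "i \<in> I" if "G g i \<noteq> 0" for i using Gnz[OF that] by blast
    show "p \<in> J i" if "G g i \<noteq> 0" for i
    proof -
      have "p \<in> J' (\<beta> i)" using dsum_interval_fibD(3)[OF g] Gnz[OF that] by blast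
      then show ?thesis using J[of i] Gnz[OF that] by simp
    qed
    have "{i. G g i \<noteq> 0} \<subseteq> \<gamma> ` {k. g k \<noteq> 0}"
    proof
      fix i assume "i \<in> {i. G g i \<noteq> 0}"
      then have i: "i \<in> I" "g (\<beta> i) \<noteq> 0" using Gnz by blast+
      have "i = \<gamma> (\<beta> i)" using \<gamma>\<beta>(1)[OF i(1)] ..
      then show "i \<in> \<gamma> ` {k. g k \<noteq> 0}" using i(2) by (rule image_eqI[OF _ CollectI])
    qed
    then show "finite {i. G g i \<noteq> 0}"
      by (rule finite_subset) (rule finite_imageI[OF dsum_interval_fibD(1)[OF g]])
  qed
  have FG: "F (G g) = g" if "g \<in> fib ?N p" for g p
  proof
    fix k show "F (G g) k = g k"
      using dsum_interval_fibD(2)[OF that, of k] \<gamma>[of k] by (auto simp: F_def G_def)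
  qed
  have GF: "G (F f) = f" if "f \<in> fib ?M p" for f p
  proof
    fix k show "G (F f) k = f k"
      using dsum_interval_fibD(2)[OF that, of k] \<gamma>\<beta>[of k] by (auto simp: F_def G_def)
  qed
  show ?thesis unfolding pmod_iso_def
  proof (intro exI conjI ballI)
    show "pmod_hom P ?M ?N (\<lambda>p. F)"
      unfolding pmod_hom_def
    proof (intro conjI ballI impI)
      show "lin_map (scl ?M) (scl ?N) (fib ?M a) (fib ?N a) F" for a
        unfolding lin_map_def
      proof (intro conjI ballI allI)
        show "F ` fib ?M a \<subseteq> fib ?N a" using Ff by (rule image_subsetI)
      qed (simp_all add: F_def dsum_interval_sel fun_eq_iff)
      show "F (imap ?M a b v) = imap ?N a b (F v)" for a b v
        unfolding dsum_interval_sel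
      proof
        fix k
        show "F (\<lambda>i. if i \<in> I \<and> a \<in> J i \<and> b \<in> J i then v i else 0) k =
          (if k \<in> I' \<and> a \<in> J' k \<and> b \<in> J' k then F v k else 0)"
        proof (cases "k \<in> I'")
          case True
          then have "J' k = J (\<gamma> k)" using J[OF \<gamma>(1), of k] \<gamma>(2)[of k] by simp
          then show ?thesis using True \<gamma>(1)[of k] by (simp add: F_def)
        qed (simp add: F_def)
      qed
    qed
    show "bij_betw F (fib ?M a) (fib ?N a)" for a
      by (rule bij_betw_byWitness[where f' = G]) (use FG[of _ a] GF[of _ a] Ff[of _ a] Gg[of _ a] in \<open>simp_all add: image_subset_iff\<close>)
  qed
qed

text \<open>Barcodes store multiplicities, so the indices with equal interval are numbered within
  their class.\<close>

lemma multiplicity_reindex: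
  assumes fin: "\<And>J. finite {i \<in> I. b i = J}"
  shows "\<exists>C \<beta>. bij_betw \<beta> I (bars C) \<and> (\<forall>i\<in>I. fst (\<beta> i) = b i)"
proof -
  define C where "C J = card {i \<in> I. b i = J}" for J
  have "\<exists>h. bij_betw h {i \<in> I. b i = J} {0..<C J}" for J
    unfolding C_def by (rule ex_bij_betw_finite_nat[OF fin])
  then obtain h where h: "\<And>J. bij_betw (h J) {i \<in> I. b i = J} {0..<C J}" by metis
  have "bij_betw (\<lambda>i. (b i, h (b i) i)) I (bars C)"
  proof (rule bij_betwI')
    fix x y assume "x \<in> I" "y \<in> I"
    then show "((b x, h (b x) x) = (b y, h (b y) y)) = (x = y)"
      using h[of "b x"] unfolding bij_betw_def inj_on_def by auto
  next
    fix x assume "x \<in> I"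
    then have "h (b x) x \<in> {0..<C (b x)}" using bij_betwE[OF h[of "b x"]] by simp
    then show "(b x, h (b x) x) \<in> bars C" by (simp add: bars_def)
  next
    fix y assume "y \<in> bars C"
    then obtain J n where y: "y = (J, n)" "n \<in> {0..<C J}" by (auto simp: bars_def)
    then have "n \<in> h J ` {i \<in> I. b i = J}" using h[of J] by (simp add: bij_betw_def)
    then show "\<exists>x\<in>I. y = (b x, h (b x) x)" using y(1) by auto
  qed
  then show ?thesis by (intro exI[of _ C] exI[of _ "\<lambda>i. (b i, h (b i) i)"]) simp
qed

section \<open>The block extension as a direct sum\<close>

context threads
begin

text \<open>Both sides are functionals on the colimit at \<open>p\<close>, so by uniqueness they
  need only be compared on the injections of the fibres.\<close>

lemma coord_natural:
  assumes p: "p \<in> UU" "p \<preceq> q" and x: "x \<in> active q" and z: "z \<in> colim V (below p)"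
  shows "coord q x (colim_map V (below q) z) = (if x \<in> active p then coord p x z else 0)"
proof -
  interpret diagram V "below p" using V by (rule diagram_below)
  have inv: "inv pos (pos m) = m" for m by (simp add: inj_pos)
  define G where "G a v = coef (inv pos a) x v" for a v
  have vt: "vector_space ((*) :: 'k \<Rightarrow> 'k \<Rightarrow> 'k)" by (rule vector_space_mult)
  have mono: "below p \<subseteq> below q" using below_mono[OF p(2)] .
  have trans: "colim_map V (below q) (dg p a v) = dg q a v" for a v
    using block_ext_imap[OF V p(2)] by (simp add: block_ext_def)
  \<comment> \<open>The condition on dying entries passes to smaller segments. A thread active at
    \<open>q\<close> but not at \<open>p\<close> can therefore fail only by not entering the segment
    below \<open>p\<close>.\<close>
  have inactive: "x m = 0" if "x \<notin> active p" "pos m \<in> below p" for m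
  proof (rule ccontr)
    assume "x m \<noteq> 0"
    then have "p \<in> blk x" using p(1) x mono that(2) unfolding blk_def active_def by blast
    then show False using that x by (simp add: active_def)
  qed
  have lq: "lin_map (coprod_scl V) (coprod_scl V) (colim V (below p)) (colim V (below q)) (colim_map V (below q))"
    using is_pmod_block_ext[OF V, of UNIV] p(2) unfolding is_pmod_def by (simp add: block_ext_def)
  show ?thesis
  proof (rule universal(2)[where u = "\<lambda>z. coord q x (colim_map V (below q) z)"
        and u' = "\<lambda>z. if x \<in> active p then coord p x z else 0" and x = z and g = G and t = "(*)" and T = UNIV])
    show "lin_map (coprod_scl V) (*) (colim V (below p)) UNIV (\<lambda>z. coord q x (colim_map V (below q) z))"
      by (rule lin_map_compose[OF lq coord(1)[OF x]])
    show "lin_map (coprod_scl V) (*) (colim V (below p)) UNIV (\<lambda>z. if x \<in> active p then coord p x z else 0)"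
      using coord(1)[of x p] by (cases "x \<in> active p") (simp_all add: lin_map_def)
    show "module.subspace ((*) :: 'k \<Rightarrow> 'k \<Rightarrow> 'k) UNIV" by (rule module.subspace_UNIV[OF module_mult])
    fix a assume a: "a \<in> below p"
    then obtain m where am: "a = pos m" using below_pos by blast
    show "lin_map (scl V) (*) (fib V a) UNIV (G a)" unfolding am G_def inv by (rule lin_map_coef)
    fix v assume v: "v \<in> fib V a"
    show "coord q x (colim_map V (below q) (dg p a v)) = G a v"
      unfolding trans using coord(2)[OF x, of m v] a v mono by (simp add: am G_def inv subset_iff)
    show "(if x \<in> active p then coord p x (dg p a v) else 0) = G a v"
      using coord(2)[of x p m v] inactive[of m] a v by (simp add: am G_def inv coef_def)
    fix b assume b: "b \<in> below p" "a \<preceq> b"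
    then obtain n where bn: "b = pos n" using below_pos by blast
    have "coord q x (dg q b (imap V a b v)) = coord q x (dg q a v)"
      using diagram.cocone[OF diagram_below[OF V], of a q b v] a b v mono by (simp add: subset_iff)
    moreover have "imap V a b v \<in> fib V b"
      using a b v V by (intro is_pmod_imap[OF V]) (auto simp: below_def)
    ultimately show "G b (imap V a b v) = G a v"
      using coord(2)[OF x, of n "imap V a b v"] coord(2)[OF x, of m v] a b v mono
      by (simp add: am bn G_def inv subset_iff)
  qed (use vt z in simp_all)
qed

text \<open>Threads with empty block, such as the zero family, contribute nothing and are dropped,
  because an interval has to be nonempty.\<close>

lemma block_ext_iso:
  "pmod_iso UU (block_ext V) (dsum {x \<in> \<Lambda>. blk x \<noteq> {}} (\<lambda>x. interval_module (blk x)))"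
  (is "pmod_iso UU _ ?N")
  unfolding pmod_iso_def
proof (intro exI conjI ballI)
  let ?I = "{x \<in> \<Lambda>. blk x \<noteq> {}}"
  define F where "F p z = (\<lambda>x. if x \<in> active p then coord p x z else 0)" for p z
  have FN: "F p z \<in> fib ?N p" for p z
    unfolding dsum_interval_fib
  proof (intro conjI allI impI)
    show "x \<in> ?I" "p \<in> blk x" if "F p z x \<noteq> 0" for x
      using that by (auto simp: F_def active_def split: if_splits)
    show "finite {x. F p z x \<noteq> 0}"
      by (rule finite_subset[OF _ finite_active[of p]]) (auto simp: F_def split: if_splits)
  qed
  show "pmod_hom UU (block_ext V) ?N F"
    unfolding pmod_hom_def
  proof (intro conjI ballI impI)
    fix p assume p: "p \<in> UU"
    show "lin_map (scl (block_ext V)) (scl ?N) (fib (block_ext V) p) (fib ?N p) (F p)"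
      unfolding lin_map_def
    proof (intro conjI ballI allI)
      show "F p ` fib (block_ext V) p \<subseteq> fib ?N p" using FN by blast
      fix z assume "z \<in> fib (block_ext V) p"
      then have z: "z \<in> colim V (below p)" by (simp add: block_ext_def)
      have "coord p x (coprod_scl V c z) = c * coord p x z" if "x \<in> active p" for x c
        using coord(1)[OF that] z by (simp add: lin_map_def)
      then show "F p (scl (block_ext V) c z) = scl ?N c (F p z)" for c
        by (simp add: F_def dsum_interval_sel block_ext_def fun_eq_iff)
      fix w assume "w \<in> fib (block_ext V) p"
      then have w: "w \<in> colim V (below p)" by (simp add: block_ext_def)
      have "coord p x (z + w) = coord p x z + coord p x w" if "x \<in> active p" for x
        using coord(1)[OF that] z w by (simp add: lin_map_def)
      then show "F p (z + w) = F p z + F p w" by (simp add: F_def fun_eq_iff)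
    qed
    fix q z assume q: "q \<in> UU" "p \<preceq> q" and "z \<in> fib (block_ext V) p"
    then have z: "z \<in> colim V (below p)" by (simp add: block_ext_def)
    show "F q (imap (block_ext V) p q z) = imap ?N p q (F p z)"
    proof
      fix x
      show "F q (imap (block_ext V) p q z) x = imap ?N p q (F p z) x"
        using coord_natural[OF p q(2) _ z, of x]
        by (auto simp: F_def dsum_interval_sel block_ext_def active_def)
    qed
  qed
  fix p assume p: "p \<in> UU"
  show "bij_betw (F p) (fib (block_ext V) p) (fib ?N p)"
  proof (rule bij_betw_byWitness[where f' = "\<lambda>g. \<Sum>x\<in>active p. coprod_scl V (g x) (rep p x)"])
    show "\<forall>z\<in>fib (block_ext V) p. (\<Sum>x\<in>active p. coprod_scl V (F p z x) (rep p x)) = z"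
    proof
      fix z assume "z \<in> fib (block_ext V) p"
      then have "z \<in> colim V (below p)" by (simp add: block_ext_def)
      from colim_expansion[OF p this]
      have "(\<Sum>x\<in>active p. coprod_scl V (coord p x z) (rep p x)) = z" ..
      then show "(\<Sum>x\<in>active p. coprod_scl V (F p z x) (rep p x)) = z" by (simp add: F_def)
    qed
    show "F p ` fib (block_ext V) p \<subseteq> fib ?N p" using FN by blast
    have inc: "coprod_scl V (g x) (rep p x) \<in> colim V (below p)" if "x \<in> active p" for g x
      using rep_in_colim[OF that] by (rule W.subspace_scale[OF colim_subspace])
    show "(\<lambda>g. \<Sum>x\<in>active p. coprod_scl V (g x) (rep p x)) ` fib ?N p \<subseteq> fib (block_ext V) p"
      using inc by (auto simp: block_ext_def intro!: W.subspace_sum[OF colim_subspace])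
    show "\<forall>g\<in>fib ?N p. F p (\<Sum>x\<in>active p. coprod_scl V (g x) (rep p x)) = g"
    proof (intro ballI ext)
      fix g y assume g: "g \<in> fib ?N p"
      show "F p (\<Sum>x\<in>active p. coprod_scl V (g x) (rep p x)) y = g y"
      proof (cases "y \<in> active p")
        case True
        have "coord p y (\<Sum>x\<in>active p. coprod_scl V (g x) (rep p x)) = (\<Sum>x\<in>active p. coord p y (coprod_scl V (g x) (rep p x)))"
          by (rule lin_map_sum[OF vector_space_coprod_scl[OF vsV] vector_space_mult colim_subspace coord(1)[OF True] inc])
        also have "\<dots> = (\<Sum>x\<in>active p. if x = y then g y else 0)"
        proof (rule sum.cong[OF refl])
          fix x assume x: "x \<in> active p"
          have "coord p y (coprod_scl V (g x) (rep p x)) = g x * coord p y (rep p x)"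
            using coord(1)[OF True] rep_in_colim[OF x] by (simp add: lin_map_def)
          then show "coord p y (coprod_scl V (g x) (rep p x)) = (if x = y then g y else 0)"
            using coord_rep[OF True x] by auto
        qed
        also have "\<dots> = g y" using True finite_active by simp
        finally show ?thesis using True by (simp add: F_def)
      next
        case False
        then have "g y = 0" using g unfolding dsum_interval_fib active_def by blast
        then show ?thesis using False by (simp add: F_def)
      qed
    qed
  qed
qed

end

section \<open>Blocks and middle exactness\<close>

definition upset :: "real set \<Rightarrow> bool" where
  "upset E \<longleftrightarrow> (\<forall>x\<in>E. \<forall>y\<ge>x. y \<in> E)"

definition downset :: "real set \<Rightarrow> bool" where
  "downset D \<longleftrightarrow> (\<forall>x\<in>D. \<forall>y\<le>x. y \<in> D)"

text \<open>
  The flag \<open>l\<close> (resp. \<open>r\<close>) says whether the left (resp. right) end of the corresponding zigzag interval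
  is closed; an infinite end may be taken to be closed.
\<close>

definition block :: "bool \<Rightarrow> real set \<Rightarrow> bool \<Rightarrow> real set \<Rightarrow> pt set" where
  "block l E r D = {p \<in> UU. (if l then snd p else fst p) \<in> E \<and> (if r then fst p else snd p) \<in> D}"

lemma block_iff: "(a, b) \<in> block l E r D \<longleftrightarrow> a \<le> b \<and> (if l then b else a) \<in> E \<and> (if r then a else b) \<in> D"
  by (simp add: block_def UU_def)

lemma UU_iff: "(a, b) \<in> UU \<longleftrightarrow> a \<le> b" by (simp add: UU_def)

text \<open>What middle exactness amounts to for a single interval module. Here
  \<open>(a', b)\<close> and \<open>(a, b')\<close> are the middle corners of the square.\<close>

definition square_exact :: "pt set \<Rightarrow> bool" where
  "square_exact J \<longleftrightarrow> (\<forall>a' a b b'. a' \<le> a \<and> a \<le> b \<and> b \<le> b' \<longrightarrow>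
     ((a', b) \<in> J \<and> (a, b') \<in> J \<longrightarrow> (a, b) \<in> J \<and> (a', b') \<in> J) \<and>
     ((a', b) \<in> J \<or> (a, b') \<in> J \<longrightarrow> (a, b) \<in> J \<or> (a', b') \<in> J))"

text \<open>Exactness at the middle term of the sequence from the first corner through the direct
  sum of the two middle corners to the last corner, for squares inside \<open>UU\<close>.\<close>

definition middle_exact :: "('k::field, 'v::ab_group_add) pmod \<Rightarrow> bool" where
  "middle_exact M \<longleftrightarrow> (\<forall>a' a b b'. a' \<le> a \<and> a \<le> b \<and> b \<le> b' \<longrightarrow>
     (\<forall>v\<in>fib M (a', b). \<forall>w\<in>fib M (a, b'). imap M (a', b) (a', b') v = imap M (a, b') (a', b') w \<longrightarrow>
       (\<exists>u\<in>fib M (a, b). imap M (a, b) (a', b) u = v \<and> imap M (a, b) (a, b') u = w)))"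

lemma upsetD: "upset E \<Longrightarrow> x \<in> E \<Longrightarrow> x \<le> y \<Longrightarrow> y \<in> E"
  by (simp add: upset_def)

lemma downsetD: "downset D \<Longrightarrow> x \<in> D \<Longrightarrow> y \<le> x \<Longrightarrow> y \<in> D"
  by (simp add: downset_def)

lemma block_square_exact:
  assumes "upset E" "downset D"
  shows "square_exact (block l E r D)"
  unfolding square_exact_def block_iff
proof (intro allI impI)
  fix a' a b b' :: real assume le: "a' \<le> a \<and> a \<le> b \<and> b \<le> b'"
  have E: "a' \<in> E \<Longrightarrow> a \<in> E" "b \<in> E \<Longrightarrow> b' \<in> E" and D: "a \<in> D \<Longrightarrow> a' \<in> D" "b' \<in> D \<Longrightarrow> b \<in> D"
    using le upsetD[OF assms(1)] downsetD[OF assms(2)] by blast+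
  show "((a' \<le> b \<and> (if l then b else a') \<in> E \<and> (if r then a' else b) \<in> D) \<and>
        a \<le> b' \<and> (if l then b' else a) \<in> E \<and> (if r then a else b') \<in> D \<longrightarrow>
        (a \<le> b \<and> (if l then b else a) \<in> E \<and> (if r then a else b) \<in> D) \<and>
        a' \<le> b' \<and> (if l then b' else a') \<in> E \<and> (if r then a' else b') \<in> D) \<and>
       (a' \<le> b \<and> (if l then b else a') \<in> E \<and> (if r then a' else b) \<in> D \<or>
        a \<le> b' \<and> (if l then b' else a) \<in> E \<and> (if r then a else b') \<in> D \<longrightarrow>
        a \<le> b \<and> (if l then b else a) \<in> E \<and> (if r then a else b) \<in> D \<or>
        a' \<le> b' \<and> (if l then b' else a') \<in> E \<and> (if r then a' else b') \<in> D)"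
    using le E D by (cases l; cases r) auto
qed

text \<open>Closure under joins provides a path of two comparisons between any two points, hence
  connectedness.\<close>

lemma block_join:
  assumes "upset E" "downset D" "(a, b) \<in> block l E r D" "(c, d) \<in> block l E r D"
  shows "(min a c, max b d) \<in> block l E r D"
  using assms(3,4) unfolding block_iff by (auto simp: min_def max_def)

lemma block_interval:
  assumes E: "upset E" and D: "downset D" and ne: "block l E r D \<noteq> {}"
  shows "interval UU (block l E r D)"
  unfolding interval_def
proof (intro conjI ballI impI)
  let ?J = "block l E r D"
  show "?J \<noteq> {}" by (rule ne)
  show "?J \<subseteq> UU" by (auto simp: block_def)
next
  let ?J = "block l E r D"
  fix p q s assume p: "p \<in> ?J" and q: "q \<in> UU" and s: "s \<in> ?J" and pq: "p \<preceq> q \<and> q \<preceq> s"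
  obtain a b where [simp]: "p = (a, b)" by (cases p)
  obtain a' b' where [simp]: "q = (a', b')" by (cases q)
  obtain c d where [simp]: "s = (c, d)" by (cases s)
  have le: "a' \<le> a" "b \<le> b'" "c \<le> a'" "b' \<le> d" "a' \<le> b'"
    using pq q by (simp_all add: opp_le_def UU_iff)
  have "b \<in> E \<Longrightarrow> b' \<in> E" "c \<in> E \<Longrightarrow> a' \<in> E" "a \<in> D \<Longrightarrow> a' \<in> D" "d \<in> D \<Longrightarrow> b' \<in> D"
    using le upsetD[OF E] downsetD[OF D] by blast+
  then show "q \<in> ?J" using p s le(5) by (cases l; cases r) (simp_all add: block_iff)
next
  let ?J = "block l E r D"
  let ?R = "{(x, y). x \<in> ?J \<and> y \<in> ?J \<and> (x \<preceq> y \<or> y \<preceq> x)}"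
  fix p q assume p: "p \<in> ?J" and q: "q \<in> ?J"
  let ?m = "(min (fst p) (fst q), max (snd p) (snd q))"
  have m: "?m \<in> ?J" using block_join[OF E D, of "fst p" "snd p" l r "fst q" "snd q"] p q by simp
  have "(p, ?m) \<in> ?R" "(?m, q) \<in> ?R" using p q m by (simp_all add: opp_le_def)
  then show "(p, q) \<in> ?R\<^sup>*" by (rule converse_rtrancl_into_rtrancl[OF _ r_into_rtrancl])
qed

lemma dsum_middle_exact:
  fixes J :: "'i \<Rightarrow> pt set"
  assumes J: "\<And>i. i \<in> I \<Longrightarrow> square_exact (J i)"
  shows "middle_exact (dsum I (\<lambda>i. interval_module (J i) :: ('k::field, 'k) pmod))" (is "middle_exact ?M")
  unfolding middle_exact_def
proof (intro allI impI ballI)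
  fix a' a b b' v w
  assume le: "a' \<le> a \<and> a \<le> b \<and> b \<le> b'" and v: "v \<in> fib ?M (a', b)" and w: "w \<in> fib ?M (a, b')"
    and vw: "imap ?M (a', b) (a', b') v = imap ?M (a, b') (a', b') w"
  \<comment> \<open>The lift is found componentwise; if both middle corners lie in
    \<open>J i\<close>, then so does the last corner and the entries of \<open>v\<close> and
    \<open>w\<close> agree.\<close>
  define u where "u i = (if (a, b) \<in> J i then if (a', b) \<in> J i then v i else w i else 0)" for i
  have fin: "finite {i. u i \<noteq> 0}"
    by (rule finite_subset[OF _ finite_UnI[OF dsum_interval_fibD(1)[OF v] dsum_interval_fibD(1)[OF w]]])
       (auto simp: u_def split: if_splits)
  have main: "(i \<in> I \<and> (a, b) \<in> J i \<or> u i = 0) \<and>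
     (if i \<in> I \<and> (a, b) \<in> J i \<and> (a', b) \<in> J i then u i else 0) = v i \<and>
     (if i \<in> I \<and> (a, b) \<in> J i \<and> (a, b') \<in> J i then u i else 0) = w i" for i
  proof (cases "i \<in> I")
    case True
    have c: "(a', b) \<in> J i \<and> (a, b') \<in> J i \<longrightarrow> (a, b) \<in> J i \<and> (a', b') \<in> J i"
      "(a', b) \<in> J i \<or> (a, b') \<in> J i \<longrightarrow> (a, b) \<in> J i \<or> (a', b') \<in> J i"
      using J[OF True] le unfolding square_exact_def by blast+
    have "(if i \<in> I \<and> (a', b) \<in> J i \<and> (a', b') \<in> J i then v i else 0) =
        (if i \<in> I \<and> (a, b') \<in> J i \<and> (a', b') \<in> J i then w i else 0)"
      using fun_cong[OF vw, of i] unfolding dsum_interval_sel .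
    moreover have "(a', b) \<notin> J i \<Longrightarrow> v i = 0" "(a, b') \<notin> J i \<Longrightarrow> w i = 0"
      using dsum_interval_fibD(3)[OF v, of i] dsum_interval_fibD(3)[OF w, of i] by blast+
    ultimately show ?thesis using c True by (auto simp: u_def split: if_splits)
  next
    case False
    then have "v i = 0" "w i = 0"
      using dsum_interval_fibD(2)[OF v, of i] dsum_interval_fibD(2)[OF w, of i] by blast+
    then show ?thesis using False by (simp add: u_def)
  qed
  show "\<exists>u\<in>fib ?M (a, b). imap ?M (a, b) (a', b) u = v \<and> imap ?M (a, b) (a, b') u = w"
  proof (intro bexI conjI)
    show "u \<in> fib ?M (a, b)" unfolding dsum_interval_fib using main fin by blast
    show "imap ?M (a, b) (a', b) u = v" "imap ?M (a, b) (a, b') u = w"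
      unfolding dsum_interval_sel using main by blast+
  qed
qed

text \<open>Exactness is tested on vectors supported at the index \<open>i\<close>. The values (1,
  0), (1, 1) and (0, 1) at the two middle corners detect every failure of the square
  conditions.\<close>

lemma square_exact_of_dsum:
  fixes J :: "'i \<Rightarrow> pt set"
  assumes M: "middle_exact (dsum I (\<lambda>i. interval_module (J i) :: ('k::field, 'k) pmod))" and i: "i \<in> I"
  shows "square_exact (J i)"
  unfolding square_exact_def
proof (intro allI impI)
  let ?M = "dsum I (\<lambda>i. interval_module (J i) :: ('k, 'k) pmod)"
  fix a' a b b' :: real assume le: "a' \<le> a \<and> a \<le> b \<and> b \<le> b'"
  define e :: "'k \<Rightarrow> 'i \<Rightarrow> 'k" where "e c j = (if j = i then c else 0)" for c j
  have ef: "e c \<in> fib ?M p" if "p \<in> J i \<or> c = 0" for c p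
    unfolding dsum_interval_fib using that i
    by (auto simp: e_def intro: finite_subset[of _ "{i}"] split: if_splits)
  have ei: "imap ?M p q (e c) = e (if p \<in> J i \<and> q \<in> J i then c else 0)" for p q c
    unfolding dsum_interval_sel using i by (auto simp: e_def fun_eq_iff)
  have ex: "\<exists>u. ((a, b) \<in> J i \<or> u = 0) \<and> (if (a, b) \<in> J i \<and> (a', b) \<in> J i then u else 0) = c \<and>
      (if (a, b) \<in> J i \<and> (a, b') \<in> J i then u else 0) = d"
    if c: "(a', b) \<in> J i \<or> c = 0" and d: "(a, b') \<in> J i \<or> d = 0"
      and cd: "(if (a', b) \<in> J i \<and> (a', b') \<in> J i then c else 0) = (if (a, b') \<in> J i \<and> (a', b') \<in> J i then d else 0)"
    for c d :: 'k
  proof -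
    have "imap ?M (a', b) (a', b') (e c) = imap ?M (a, b') (a', b') (e d)" unfolding ei cd ..
    then obtain u where u: "u \<in> fib ?M (a, b)" "imap ?M (a, b) (a', b) u = e c" "imap ?M (a, b) (a, b') u = e d"
      using M le ef[OF c] ef[OF d] unfolding middle_exact_def by blast
    have "(a, b) \<in> J i \<or> u i = 0" using dsum_interval_fibD(3)[OF u(1)] by blast
    moreover have "(if i \<in> I \<and> (a, b) \<in> J i \<and> (a', b) \<in> J i then u i else 0) = e c i"
      using fun_cong[OF u(2), of i] unfolding dsum_interval_sel .
    moreover have "(if i \<in> I \<and> (a, b) \<in> J i \<and> (a, b') \<in> J i then u i else 0) = e d i"
      using fun_cong[OF u(3), of i] unfolding dsum_interval_sel .
    ultimately show ?thesis using i by (intro exI[of _ "u i"]) (simp add: e_def)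
  qed
  show "((a', b) \<in> J i \<and> (a, b') \<in> J i \<longrightarrow> (a, b) \<in> J i \<and> (a', b') \<in> J i) \<and>
     ((a', b) \<in> J i \<or> (a, b') \<in> J i \<longrightarrow> (a, b) \<in> J i \<or> (a', b') \<in> J i)"
    using ex[of 1 0] ex[of 1 1] ex[of 0 1]
    by (cases "(a, b) \<in> J i"; cases "(a', b) \<in> J i"; cases "(a, b') \<in> J i"; cases "(a', b') \<in> J i") simp_all
qed

lemma middle_exact_iso:
  assumes M: "\<And>p q v. p \<preceq> q \<Longrightarrow> v \<in> fib M p \<Longrightarrow> imap M p q v \<in> fib M q"
    and i: "pmod_iso UU M N" and N: "middle_exact N"
  shows "middle_exact M"
proof -
  obtain f where f: "pmod_hom UU M N f" and bij: "\<forall>a\<in>UU. bij_betw (f a) (fib M a) (fib N a)"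
    using i unfolding pmod_iso_def by blast
  show ?thesis unfolding middle_exact_def
  proof (intro allI impI ballI)
    fix a' a b b' v w
    assume le: "a' \<le> a \<and> a \<le> b \<and> b \<le> b'" and v: "v \<in> fib M (a', b)" and w: "w \<in> fib M (a, b')"
      and vw: "imap M (a', b) (a', b') v = imap M (a, b') (a', b') w"
    have U: "(a, b) \<in> UU" "(a', b) \<in> UU" "(a, b') \<in> UU" "(a', b') \<in> UU" using le by (simp_all add: UU_iff)
    have o: "(a, b) \<preceq> (a', b)" "(a, b) \<preceq> (a, b')" "(a', b) \<preceq> (a', b')" "(a, b') \<preceq> (a', b')"
      using le by (simp_all add: opp_le_def)
    have "imap N (a', b) (a', b') (f (a', b) v) = imap N (a, b') (a', b') (f (a, b') w)"
      using pmod_homD(2)[OF f U(2,4) o(3) v] pmod_homD(2)[OF f U(3,4) o(4) w] vw by simp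
    then obtain u' where u': "u' \<in> fib N (a, b)" "imap N (a, b) (a', b) u' = f (a', b) v"
        "imap N (a, b) (a, b') u' = f (a, b') w"
      using N le pmod_homD(3)[OF f U(2) v] pmod_homD(3)[OF f U(3) w] unfolding middle_exact_def by blast
    obtain u where u: "u \<in> fib M (a, b)" "u' = f (a, b) u"
      using bij U(1) u'(1) unfolding bij_betw_def by blast
    have "f (a', b) (imap M (a, b) (a', b) u) = f (a', b) v"
      using pmod_homD(2)[OF f U(1,2) o(1) u(1)] u'(2) u(2) by simp
    then have "imap M (a, b) (a', b) u = v"
      using bij U(2) M[OF o(1) u(1)] v unfolding bij_betw_def inj_on_def by blast
    moreover have "f (a, b') (imap M (a, b) (a, b') u) = f (a, b') w"
      using pmod_homD(2)[OF f U(1,3) o(2) u(1)] u'(3) u(2) by simp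
    then have "imap M (a, b) (a, b') u = w"
      using bij U(3) M[OF o(2) u(1)] w unfolding bij_betw_def inj_on_def by blast
    ultimately show "\<exists>u\<in>fib M (a, b). imap M (a, b) (a', b) u = v \<and> imap M (a, b) (a, b') u = w"
      using u(1) by blast
  qed
qed

text \<open>The conditions involving \<open>UNIV\<close> normalise the type: a side without a bound
  counts as closed. A point beyond the bound of an open side then always exists, which is how
  morphisms detect the type.\<close>

definition is_block :: "pt set \<Rightarrow> bool" where
  "is_block J \<longleftrightarrow> (\<exists>l E r D. upset E \<and> downset D \<and> (\<not> l \<longrightarrow> E \<noteq> UNIV) \<and> (\<not> r \<longrightarrow> D \<noteq> UNIV)
     \<and> J = block l E r D \<and> J \<noteq> {})"

section \<open>Intervals with the square conditions are blocks\<close>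

locale exact_interval =
  fixes J :: "pt set"
  assumes int: "interval UU J" and sq: "square_exact J"
begin

lemma sub: "(a, b) \<in> J \<Longrightarrow> a \<le> b"
  using int unfolding interval_def UU_def by auto

lemma conv: "(a, b) \<in> J \<Longrightarrow> (c, d) \<in> J \<Longrightarrow> a' \<le> a \<Longrightarrow> b \<le> b' \<Longrightarrow> c \<le> a' \<Longrightarrow> b' \<le> d \<Longrightarrow> (a', b') \<in> J"
proof -
  assume a: "(a, b) \<in> J" "(c, d) \<in> J" "a' \<le> a" "b \<le> b'" "c \<le> a'" "b' \<le> d"
  have "\<forall>p\<in>J. \<forall>q\<in>UU. \<forall>s\<in>J. p \<preceq> q \<and> q \<preceq> s \<longrightarrow> q \<in> J" using int unfolding interval_def by blast
  moreover have "(a', b') \<in> UU" "(a, b) \<preceq> (a', b')" "(a', b') \<preceq> (c, d)"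
    using a sub[OF a(1)] by (simp_all add: UU_iff opp_le_def)
  ultimately show ?thesis using a(1,2) by blast
qed

lemma sq1: "a' \<le> a \<Longrightarrow> a \<le> b \<Longrightarrow> b \<le> b' \<Longrightarrow> (a', b) \<in> J \<Longrightarrow> (a, b') \<in> J \<Longrightarrow> (a, b) \<in> J \<and> (a', b') \<in> J"
  using sq unfolding square_exact_def by blast

lemma sq2: "a' \<le> a \<Longrightarrow> a \<le> b \<Longrightarrow> b \<le> b' \<Longrightarrow> (a', b) \<in> J \<or> (a, b') \<in> J \<Longrightarrow> (a, b) \<in> J \<or> (a', b') \<in> J"
  using sq unfolding square_exact_def by blast

text \<open>The upward reach of \<open>J\<close> from \<open>p\<close>, completed below
  \<open>p\<close>; \<open>left\<close> is its horizontal counterpart. Both turn out to be the same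
  for all points of \<open>J\<close>.\<close>

definition up :: "pt \<Rightarrow> real set" where
  "up p = {t. t \<le> snd p \<or> (fst p, t) \<in> J}"

definition left :: "pt \<Rightarrow> real set" where
  "left p = {t. fst p \<le> t \<or> (t, snd p) \<in> J}"

text \<open>Along the direction of the reach convexity suffices. Across it, \<open>sq1\<close>
  carries the reach over to the larger point and convexity brings it back.\<close>

lemma up_left_mono:
  assumes p: "(a, b) \<in> J" and q: "(a', b') \<in> J" and le: "a' \<le> a" "b \<le> b'"
  shows "up (a, b) = up (a', b')" "left (a, b) = left (a', b')"
proof -
  have ab: "a \<le> b" using sub[OF p] .
  have c1: "(a, b') \<in> J" and c2: "(a', b) \<in> J" using conv[OF p q] le by blast+
  have u1: "t \<in> up (a, b) \<longleftrightarrow> t \<in> up (a, b')" for t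
    using conv[OF p c1, of a t] le unfolding up_def by (cases "b \<le> t") auto
  have u2: "t \<in> up (a, b') \<longleftrightarrow> t \<in> up (a', b')" for t
    using sq1[of a' a b' t] q conv[OF c1, of a' t a t] le ab unfolding up_def by (cases "b' \<le> t") auto
  show "up (a, b) = up (a', b')" using u1 u2 by blast
  have l1: "t \<in> left (a, b) \<longleftrightarrow> t \<in> left (a', b)" for t
    using conv[OF p c2, of t b] le unfolding left_def by (cases "t \<le> a") auto
  have l2: "t \<in> left (a', b) \<longleftrightarrow> t \<in> left (a', b')" for t
    using sq1[of t a' b b'] q conv[OF c2, of t b' t b] le ab unfolding left_def by (cases "t \<le> a'") auto
  show "left (a, b) = left (a', b')" using l1 l2 by blast
qed

lemma up_left_const:
  assumes p: "p \<in> J" and q: "q \<in> J"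
  shows "up p = up q \<and> left p = left q"
proof -
  have "(p, q) \<in> {(x, y). x \<in> J \<and> y \<in> J \<and> (x \<preceq> y \<or> y \<preceq> x)}\<^sup>*"
    using int p q unfolding interval_def by blast
  then show ?thesis
  proof (induction rule: rtrancl_induct)
    case (step y z)
    obtain a b a' b' where yz: "y = (a, b)" "z = (a', b')" by (cases y; cases z)
    have "up y = up z \<and> left y = left z"
      using step(2) up_left_mono[of a b a' b'] up_left_mono[of a' b' a b] unfolding yz opp_le_def by auto
    then show ?case using step.IH by simp
  qed simp
qed

lemma is_block: "is_block J"
proof -
  have "J \<noteq> {}" using int by (simp add: interval_def)
  then obtain p0 where p0: "p0 \<in> J" by blast
  define D where "D = up p0"
  define E where "E = left p0"
  have upD: "up (a, b) = D" and leftE: "left (a, b) = E" if "(a, b) \<in> J" for a b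
    using up_left_const[OF that p0] by (simp_all add: D_def E_def)
  have inD: "b \<in> D" and inE: "a \<in> E" if "(a, b) \<in> J" for a b
    using upD[OF that] leftE[OF that] by (auto simp: up_def left_def)
  have upJ: "(a, t) \<in> J" if "(a, b) \<in> J" "t \<in> D" "b \<le> t" for a b t
    using upD[OF that(1)] that by (auto simp: up_def)
  have leftJ: "(t, b) \<in> J" if "(a, b) \<in> J" "t \<in> E" "t \<le> a" for a b t
    using leftE[OF that(1)] that by (auto simp: left_def)
  obtain a0 b0 where ab0: "p0 = (a0, b0)" by (cases p0)
  have dD: "downset D"
    unfolding downset_def
  proof (intro ballI allI impI)
    fix t s assume t: "t \<in> D" "s \<le> t"
    show "s \<in> D"
    proof (cases "s \<le> b0")
      case True then show ?thesis by (simp add: D_def ab0 up_def)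
    next
      case False
      then have "(a0, t) \<in> J" using upJ[of a0 b0 t] p0 t by (simp add: ab0)
      then have "(a0, s) \<in> J" using conv[of a0 b0 a0 t a0 s] p0 t False by (simp add: ab0)
      then show ?thesis by (rule inD)
    qed
  qed
  have uE: "upset E"
    unfolding upset_def
  proof (intro ballI allI impI)
    fix t s assume t: "t \<in> E" "t \<le> s"
    show "s \<in> E"
    proof (cases "a0 \<le> s")
      case True then show ?thesis by (simp add: E_def ab0 left_def)
    next
      case False
      then have "(t, b0) \<in> J" using leftJ[of a0 b0 t] p0 t by (simp add: ab0)
      then have "(s, b0) \<in> J" using conv[of a0 b0 t b0 s b0] p0 t False by (simp add: ab0)
      then show ?thesis by (rule inE)
    qed
  qed
  \<comment> \<open>A bound on the left gives a point \<open>(a', b)\<close> outside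
    \<open>J\<close>; \<open>sq2\<close> then forces the points below \<open>(a, b)\<close> down to
    the diagonal into \<open>J\<close>.\<close>
  have down: "(a, s) \<in> J" if nE: "E \<noteq> UNIV" and p: "(a, b) \<in> J" and s: "a \<le> s" "s \<le> b" for a b s
  proof -
    obtain a' where a': "a' \<notin> E" using nE by blast
    then have lt: "a' < a" using upsetD[OF uE inE[OF p], of a'] by fastforce
    have "(a', b) \<notin> J" using a' inE by blast
    then show ?thesis using sq2[of a' a s b] lt s p by auto
  qed
  have right: "(s, b) \<in> J" if nD: "D \<noteq> UNIV" and p: "(a, b) \<in> J" and s: "a \<le> s" "s \<le> b" for a b s
  proof -
    obtain b' where b': "b' \<notin> D" using nD by blast
    then have lt: "b < b'" using downsetD[OF dD inD[OF p], of b'] by fastforce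
    have "(a, b') \<notin> J" using b' inD by blast
    then show ?thesis using sq2[of a s b b'] lt s p by auto
  qed
  have maxD: "max x y \<in> D" if "x \<in> D" "y \<in> D" for x y using that by (simp add: max_def)
  have minE: "min x y \<in> E" if "x \<in> E" "y \<in> E" for x y using that by (simp add: min_def)
  \<comment> \<open>For a side without a bound the constraint moves to the other coordinate:
    \<open>E1\<close> bounds the second coordinate from below, \<open>D1\<close> the first from
    above.\<close>
  define E1 where "E1 = {y. \<exists>a b. (a, b) \<in> J \<and> b \<le> y}"
  define D1 where "D1 = {x. \<exists>a b. (a, b) \<in> J \<and> x \<le> a}"
  have uE1: "upset E1" unfolding upset_def E1_def by (auto intro: order_trans)
  have dD1: "downset D1" unfolding downset_def D1_def by (auto intro: order_trans)
  have inE1: "b \<in> E1" and inD1: "a \<in> D1" if "(a, b) \<in> J" for a b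
    using that unfolding E1_def D1_def by blast+
  have p0J: "(a0, b0) \<in> J" using p0 ab0 by simp
  define l where "l \<longleftrightarrow> E = UNIV"
  define r where "r \<longleftrightarrow> D = UNIV"
  have "J = block l (if l then E1 else E) r (if r then D1 else D)"
  proof (intro equalityI subsetI)
    fix p assume "p \<in> J"
    then show "p \<in> block l (if l then E1 else E) r (if r then D1 else D)"
      using sub inE inD inE1 inD1 by (cases p) (simp add: block_iff)
  next
    fix p assume p: "p \<in> block l (if l then E1 else E) r (if r then D1 else D)"
    obtain c d where cd: "p = (c, d)" by (cases p)
    have le: "c \<le> d" using p by (simp add: cd block_iff)
    show "p \<in> J"
    proof (cases l; cases r)
      \<comment> \<open>The route from the base point to \<open>(c, d)\<close> goes up, left, down
        and right.\<close>
      assume lr: "\<not> l" "\<not> r"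
      then have "c \<in> E" "d \<in> D" using p by (simp_all add: cd block_iff)
      then have "(a0, max b0 d) \<in> J" using upJ[OF p0J] maxD inD[OF p0J] by simp
      then have "(min a0 c, max b0 d) \<in> J" using leftJ minE inE[OF p0J] \<open>c \<in> E\<close> by simp
      then have "(min a0 c, d) \<in> J" using down le lr by (simp add: l_def)
      then show ?thesis using right le lr by (simp add: r_def cd)
    next
      assume lr: "\<not> l" "r"
      then have "c \<in> E" and "c \<in> D1" and D: "D = UNIV" using p by (simp_all add: cd block_iff r_def)
      then obtain a b where ab: "(a, b) \<in> J" "c \<le> a" by (auto simp: D1_def)
      then have "(a, max b d) \<in> J" using upJ D by simp
      then have "(c, max b d) \<in> J" using leftJ \<open>c \<in> E\<close> ab(2) by simp
      then show ?thesis using down le lr by (simp add: l_def cd)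
    next
      assume lr: "l" "\<not> r"
      then have "d \<in> D" and "d \<in> E1" and E: "E = UNIV" using p by (simp_all add: cd block_iff l_def)
      then obtain a b where ab: "(a, b) \<in> J" "b \<le> d" by (auto simp: E1_def)
      then have "(a, d) \<in> J" using upJ \<open>d \<in> D\<close> by simp
      then have "(min a c, d) \<in> J" using leftJ E by simp
      then show ?thesis using right le lr by (simp add: r_def cd)
    next
      assume lr: "l" "r"
      then have "c \<in> D1" and "d \<in> E1" and ED: "E = UNIV" "D = UNIV" using p by (simp_all add: cd block_iff l_def r_def)
      then obtain a1 b1 a2 b2 where 1: "(a1, b1) \<in> J" "c \<le> a1" and 2: "(a2, b2) \<in> J" "b2 \<le> d"
        by (auto simp: E1_def D1_def)
      have z: "(c, b1) \<in> J" using leftJ[OF 1(1)] 1(2) ED by simp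
      have y: "(a2, d) \<in> J" using upJ[OF 2(1)] 2(2) ED by simp
      show ?thesis
      proof (cases "b1 \<le> d \<or> c \<le> a2")
        case True
        then show ?thesis using upJ[OF z, of d] leftJ[OF y, of c] ED by (auto simp: cd)
      next
        \<comment> \<open>Now \<open>(a2, d)\<close> and \<open>(c, b1)\<close> are the middle
          corners of a square whose first corner is \<open>(c, d)\<close>.\<close>
        case False
        then show ?thesis using sq1[of a2 c d b1] y z le by (simp add: cd)
      qed
    qed
  qed
  moreover have "upset (if l then E1 else E)" "downset (if r then D1 else D)"
    using uE uE1 dD dD1 by simp_all
  moreover have "\<not> l \<longrightarrow> (if l then E1 else E) \<noteq> UNIV" "\<not> r \<longrightarrow> (if r then D1 else D) \<noteq> UNIV"
    by (simp_all add: l_def r_def)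
  ultimately show ?thesis unfolding is_block_def using p0 by blast
qed

end

text \<open>There are more unknowns than equations; induction eliminates a pivot \<open>j\<close>.
  This is the form in which rank is used below, for counting bars and for Hall's condition.\<close>

lemma homogeneous_system:
  fixes x :: "'i \<Rightarrow> 's \<Rightarrow> 'k::field"
  assumes "finite S" "finite A" "card S < card A"
  shows "\<exists>c. (\<exists>i\<in>A. c i \<noteq> 0) \<and> (\<forall>s\<in>S. (\<Sum>i\<in>A. c i * x i s) = 0)"
  using assms
proof (induction S arbitrary: A x)
  case empty
  then obtain i where "i \<in> A" by fastforce
  then show ?case by (intro exI[of _ "\<lambda>_. 1"]) auto
next
  case (insert s S)
  show ?case
  proof (cases "\<forall>i\<in>A. x i s = 0")
    case True
    have "card S < card A" using insert by simp
    then obtain c where "\<exists>i\<in>A. c i \<noteq> 0" "\<forall>s\<in>S. (\<Sum>i\<in>A. c i * x i s) = 0"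
      using insert.IH[of A x] insert.prems by blast
    then show ?thesis using True by (intro exI[of _ c]) simp
  next
    case False
    then obtain j where j: "j \<in> A" "x j s \<noteq> 0" by blast
    define y where "y i t = x i t - x i s / x j s * x j t" for i t
    have "card S < card (A - {j})" using insert j by (simp add: card_Diff_singleton)
    then obtain c where c: "\<exists>i\<in>A - {j}. c i \<noteq> 0" "\<forall>t\<in>S. (\<Sum>i\<in>A - {j}. c i * y i t) = 0"
      using insert.IH[of "A - {j}" y] insert.prems by blast
    define m where "m = - (\<Sum>i\<in>A - {j}. c i * (x i s / x j s))"
    define d where "d i = (if i = j then m else c i)" for i
    have sd: "(\<Sum>i\<in>A. d i * x i t) = (\<Sum>i\<in>A - {j}. c i * y i t)" for t
    proof -
      have "(\<Sum>i\<in>A. d i * x i t) = m * x j t + (\<Sum>i\<in>A - {j}. d i * x i t)"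
        using sum.remove[OF insert.prems(1) j(1), of "\<lambda>i. d i * x i t"] by (simp add: d_def)
      also have "(\<Sum>i\<in>A - {j}. d i * x i t) = (\<Sum>i\<in>A - {j}. c i * x i t)"
        by (rule sum.cong) (simp_all add: d_def)
      also have "m * x j t = (\<Sum>i\<in>A - {j}. - (c i * (x i s / x j s * x j t)))"
        by (simp add: m_def sum_distrib_right sum_negf mult.assoc)
      finally show ?thesis
        by (simp add: y_def right_diff_distrib sum_subtractf sum_negf)
    qed
    have "y i s = 0" for i using j by (simp add: y_def)
    then have "(\<Sum>i\<in>A. d i * x i t) = 0" if "t \<in> insert s S" for t
      using that c(2) unfolding sd by auto
    moreover have "\<exists>i\<in>A. d i \<noteq> 0" using c(1) by (auto simp: d_def)
    ultimately show ?thesis by blast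
  qed
qed

lemma int_bounded_below_least:
  fixes S :: "int set"
  assumes "s \<in> S" "\<And>x. x \<in> S \<Longrightarrow> b \<le> x"
  shows "\<exists>l\<in>S. \<forall>x\<in>S. l \<le> x"
proof -
  obtain n where n: "b + int n \<in> S" "\<forall>k. b + int k \<in> S \<longrightarrow> n \<le> k"
    using ex_has_least_nat[of "\<lambda>n. b + int n \<in> S" "nat (s - b)" "\<lambda>n. n"] assms by auto
  have "b + int n \<le> x" if "x \<in> S" for x
    using n(2)[rule_format, of "nat (x - b)"] assms(2)[OF that] that by simp
  then show ?thesis using n(1) by blast
qed

section \<open>The block of a thread\<close>

context threads
begin

text \<open>An even left end of the support is a sink, where the thread only has to be reached: this
  bounds \<open>b\<close> from below. An odd left end is a source whose entry dies at the sink to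
  its left, so \<open>a\<close> must lie beyond that sink. The last position of the segment is
  \<open>2 * \<lfloor>b\<rfloor> + 1\<close>.\<close>

lemma blk_left_cond:
  assumes x: "x \<in> \<Lambda>" and s: "x s \<noteq> 0"
  shows "\<exists>l E. upset E \<and> (\<forall>a b. a \<le> b \<longrightarrow>
     ((if l then b else a) \<in> E \<longleftrightarrow>
       (\<exists>m. x m \<noteq> 0 \<and> m \<le> 2 * \<lfloor>b\<rfloor> + 1) \<and>
       \<not> (\<exists>m. odd m \<and> pos m \<in> below (a, b) \<and> pos (m - 1) \<in> below (a, b) \<and> x m \<noteq> 0 \<and> x (m - 1) = 0)))"
proof (cases "\<exists>b. \<forall>m. x m \<noteq> 0 \<longrightarrow> b \<le> m")
  case False
  have "x m \<noteq> 0" if "x n \<noteq> 0" "m \<le> n" for m n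
  proof -
    obtain k where k: "x k \<noteq> 0" "k < m" using False by (metis not_le)
    show ?thesis by (rule thread_convex[OF x _ that(2) k(1) that(1)]) (use k in simp)
  qed
  moreover have "\<exists>m. x m \<noteq> 0 \<and> m \<le> n" for n using False by (metis not_le order_less_imp_le)
  ultimately show ?thesis by (intro exI[of _ True] exI[of _ UNIV]) (auto simp: upset_def)
next
  case True
  then obtain b where "\<And>m. x m \<noteq> 0 \<Longrightarrow> b \<le> m" by blast
  then obtain n where n: "x n \<noteq> 0" "\<And>m. x m \<noteq> 0 \<Longrightarrow> n \<le> m"
    using int_bounded_below_least[of s "{m. x m \<noteq> 0}" b] s by auto
  have only_n: "m = n" if "x m \<noteq> 0" "x (m - 1) = 0" for m
  proof (rule ccontr)
    assume "m \<noteq> n"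
    then have "n \<le> m - 1" using n(2)[OF that(1)] by simp
    then show False using thread_convex[OF x _ _ n(1) that(1), of "m - 1"] that(2) by simp
  qed
  have nn: "x (n - 1) = 0" using n(2)[of "n - 1"] by fastforce
  show ?thesis
  proof (cases "even n")
    case True
    let ?E = "{b. of_int (n div 2) \<le> b}"
    have "(\<exists>m. x m \<noteq> 0 \<and> m \<le> 2 * \<lfloor>b\<rfloor> + 1) \<longleftrightarrow> of_int (n div 2) \<le> b" for b :: real
    proof -
      have "(\<exists>m. x m \<noteq> 0 \<and> m \<le> 2 * \<lfloor>b\<rfloor> + 1) \<longleftrightarrow> n \<le> 2 * \<lfloor>b\<rfloor> + 1"
        using n by (meson order_trans)
      also have "\<dots> \<longleftrightarrow> n div 2 \<le> \<lfloor>b\<rfloor>" using True by presburger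
      finally show ?thesis by (simp add: le_floor_iff)
    qed
    moreover have "\<not> (\<exists>m. odd m \<and> x m \<noteq> 0 \<and> x (m - 1) = 0)" using only_n True by blast
    moreover have "upset ?E" by (auto simp: upset_def)
    ultimately show ?thesis by (intro exI[of _ True] exI[of _ ?E]) auto
  next
    case False
    let ?E = "{a. of_int (n div 2) < a}"
    have "((\<exists>m. x m \<noteq> 0 \<and> m \<le> 2 * \<lfloor>b\<rfloor> + 1) \<and>
       \<not> (\<exists>m. odd m \<and> pos m \<in> below (a, b) \<and> pos (m - 1) \<in> below (a, b) \<and> x m \<noteq> 0 \<and> x (m - 1) = 0))
       \<longleftrightarrow> of_int (n div 2) < a" if ab: "a \<le> b" for a b :: real
    proof -
      have 1: "(\<exists>m. x m \<noteq> 0 \<and> m \<le> 2 * \<lfloor>b\<rfloor> + 1) \<longleftrightarrow> of_int (n div 2) \<le> b"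
      proof -
        have "(\<exists>m. x m \<noteq> 0 \<and> m \<le> 2 * \<lfloor>b\<rfloor> + 1) \<longleftrightarrow> n \<le> 2 * \<lfloor>b\<rfloor> + 1"
          using n by (meson order_trans)
        also have "\<dots> \<longleftrightarrow> n div 2 \<le> \<lfloor>b\<rfloor>" using False by presburger
        finally show ?thesis by (simp add: le_floor_iff)
      qed
      have e: "(n - 1 + 1) div 2 = n div 2" "(n - 1) div 2 = n div 2" "(n + 1) div 2 = n div 2 + 1"
        using False by presburger+
      have "(\<exists>m. odd m \<and> pos m \<in> below (a, b) \<and> pos (m - 1) \<in> below (a, b) \<and> x m \<noteq> 0 \<and> x (m - 1) = 0)
         \<longleftrightarrow> pos n \<in> below (a, b) \<and> pos (n - 1) \<in> below (a, b)"
        using only_n n(1) nn False by blast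
      also have "\<dots> \<longleftrightarrow> a \<le> of_int (n div 2) \<and> of_int (n div 2) \<le> b"
        unfolding pos_in_below e by auto
      finally show ?thesis using 1 ab by auto
    qed
    moreover have "upset ?E" by (auto simp: upset_def)
    ultimately show ?thesis by (intro exI[of _ False] exI[of _ ?E]) simp
  qed
qed

text \<open>Mirror image of the left end, with \<open>2 * \<lceil>a\<rceil> - 1\<close> as the first
  position of the segment.\<close>

lemma blk_right_cond:
  assumes x: "x \<in> \<Lambda>" and s: "x s \<noteq> 0"
  shows "\<exists>r D. downset D \<and> (\<forall>a b. a \<le> b \<longrightarrow>
     ((if r then a else b) \<in> D \<longleftrightarrow>
       (\<exists>m. x m \<noteq> 0 \<and> 2 * \<lceil>a\<rceil> - 1 \<le> m) \<and>
       \<not> (\<exists>m. odd m \<and> pos m \<in> below (a, b) \<and> pos (m + 1) \<in> below (a, b) \<and> x m \<noteq> 0 \<and> x (m + 1) = 0)))"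
proof (cases "\<exists>b. \<forall>m. x m \<noteq> 0 \<longrightarrow> m \<le> b")
  case False
  have "x m \<noteq> 0" if "x n \<noteq> 0" "n \<le> m" for m n
  proof -
    obtain k where k: "x k \<noteq> 0" "m < k" using False by (metis not_le)
    show ?thesis by (rule thread_convex[OF x that(2) _ that(1) k(1)]) (use k in simp)
  qed
  moreover have "\<exists>m. x m \<noteq> 0 \<and> n \<le> m" for n using False by (metis not_le order_less_imp_le)
  ultimately show ?thesis by (intro exI[of _ True] exI[of _ UNIV]) (auto simp: downset_def)
next
  case True
  then obtain b where b: "\<forall>m. x m \<noteq> 0 \<longrightarrow> m \<le> b" by blast
  \<comment> \<open>The greatest position of the support is found as a least one after a change of
    sign.\<close>
  have "\<exists>l\<in>{m. x (- m) \<noteq> 0}. \<forall>m\<in>{m. x (- m) \<noteq> 0}. l \<le> m"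
    by (rule int_bounded_below_least[of "- s" _ "- b"]) (use s b in fastforce)+
  then obtain n' where n': "x (- n') \<noteq> 0" "\<And>m. x (- m) \<noteq> 0 \<Longrightarrow> n' \<le> m" by auto
  define n where "n = - n'"
  have n: "x n \<noteq> 0" "\<And>m. x m \<noteq> 0 \<Longrightarrow> m \<le> n" using n'(1) n'(2)[of "- m" for m] by (force simp: n_def)+
  have only_n: "m = n" if "x m \<noteq> 0" "x (m + 1) = 0" for m
  proof (rule ccontr)
    assume "m \<noteq> n"
    then have "m + 1 \<le> n" using n(2)[OF that(1)] by simp
    then show False using thread_convex[OF x _ _ that(1) n(1), of "m + 1"] that(2) by simp
  qed
  have nn: "x (n + 1) = 0" using n(2)[of "n + 1"] by fastforce
  have ex: "(\<exists>m. x m \<noteq> 0 \<and> 2 * \<lceil>a\<rceil> - 1 \<le> m) \<longleftrightarrow> 2 * \<lceil>a\<rceil> - 1 \<le> n" for a :: real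
    using n by (meson order_trans)
  show ?thesis
  proof (cases "even n")
    case True
    let ?D = "{a. a \<le> of_int (n div 2)}"
    have "(\<exists>m. x m \<noteq> 0 \<and> 2 * \<lceil>a\<rceil> - 1 \<le> m) \<longleftrightarrow> a \<le> of_int (n div 2)" for a :: real
    proof -
      have "2 * \<lceil>a\<rceil> - 1 \<le> n \<longleftrightarrow> \<lceil>a\<rceil> \<le> n div 2" using True by presburger
      then show ?thesis unfolding ex by (simp add: ceiling_le_iff)
    qed
    moreover have "\<not> (\<exists>m. odd m \<and> x m \<noteq> 0 \<and> x (m + 1) = 0)" using only_n True by blast
    moreover have "downset ?D" by (auto simp: downset_def)
    ultimately show ?thesis by (intro exI[of _ True] exI[of _ ?D]) auto
  next
    case False
    let ?D = "{b. b < of_int (n div 2 + 1)}"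
    have "((\<exists>m. x m \<noteq> 0 \<and> 2 * \<lceil>a\<rceil> - 1 \<le> m) \<and>
       \<not> (\<exists>m. odd m \<and> pos m \<in> below (a, b) \<and> pos (m + 1) \<in> below (a, b) \<and> x m \<noteq> 0 \<and> x (m + 1) = 0))
       \<longleftrightarrow> b < of_int (n div 2 + 1)" if ab: "a \<le> b" for a b :: real
    proof -
      have "2 * \<lceil>a\<rceil> - 1 \<le> n \<longleftrightarrow> \<lceil>a\<rceil> \<le> n div 2 + 1" using False by presburger
      then have 1: "(\<exists>m. x m \<noteq> 0 \<and> 2 * \<lceil>a\<rceil> - 1 \<le> m) \<longleftrightarrow> a \<le> of_int (n div 2 + 1)"
        unfolding ex by (simp only: ceiling_le_iff)
      have e: "(n + 1 + 1) div 2 = n div 2 + 1" "(n + 1) div 2 = n div 2 + 1"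
        using False by presburger+
      have "(\<exists>m. odd m \<and> pos m \<in> below (a, b) \<and> pos (m + 1) \<in> below (a, b) \<and> x m \<noteq> 0 \<and> x (m + 1) = 0)
         \<longleftrightarrow> pos n \<in> below (a, b) \<and> pos (n + 1) \<in> below (a, b)"
        using only_n n(1) nn False by blast
      also have "\<dots> \<longleftrightarrow> a \<le> of_int (n div 2 + 1) \<and> of_int (n div 2 + 1) \<le> b"
        unfolding pos_in_below e by auto
      finally show ?thesis using 1 ab by auto
    qed
    moreover have "downset ?D" by (auto simp: downset_def)
    ultimately show ?thesis by (intro exI[of _ False] exI[of _ ?D]) simp
  qed
qed

text \<open>Neither the segment nor the support has gaps, so they miss each other only if the
  support lies entirely on one side. Hence entering the segment splits into a left and a right
  condition, as dying inside it does.\<close>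

lemma blk_is_block:
  assumes x: "x \<in> \<Lambda>" and ne: "blk x \<noteq> {}"
  shows "\<exists>l E r D. upset E \<and> downset D \<and> blk x = block l E r D"
proof -
  obtain s where s: "x s \<noteq> 0" using ne unfolding blk_def by blast
  obtain l E where E: "upset E" "\<forall>a b. a \<le> b \<longrightarrow> ((if l then b else a) \<in> E \<longleftrightarrow>
       (\<exists>m. x m \<noteq> 0 \<and> m \<le> 2 * \<lfloor>b\<rfloor> + 1) \<and>
       \<not> (\<exists>m. odd m \<and> pos m \<in> below (a, b) \<and> pos (m - 1) \<in> below (a, b) \<and> x m \<noteq> 0 \<and> x (m - 1) = 0))"
    using blk_left_cond[OF x s] by (elim exE conjE) (rule that)
  obtain r D where D: "downset D" "\<forall>a b. a \<le> b \<longrightarrow> ((if r then a else b) \<in> D \<longleftrightarrow>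
       (\<exists>m. x m \<noteq> 0 \<and> 2 * \<lceil>a\<rceil> - 1 \<le> m) \<and>
       \<not> (\<exists>m. odd m \<and> pos m \<in> below (a, b) \<and> pos (m + 1) \<in> below (a, b) \<and> x m \<noteq> 0 \<and> x (m + 1) = 0))"
    using blk_right_cond[OF x s] by (elim exE conjE) (rule that)
  have "(a, b) \<in> blk x \<longleftrightarrow> (a, b) \<in> block l E r D" for a b
  proof (cases "a \<le> b")
    case False then show ?thesis by (simp add: blk_def block_iff UU_iff)
  next
    case ab: True
    have seg: "pos m \<in> below (a, b) \<longleftrightarrow> 2 * \<lceil>a\<rceil> - 1 \<le> m \<and> m \<le> 2 * \<lfloor>b\<rfloor> + 1" for m
    proof -
      have "pos m \<in> below (a, b) \<longleftrightarrow> \<lceil>a\<rceil> \<le> (m + 1) div 2 \<and> m div 2 \<le> \<lfloor>b\<rfloor>"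
        by (simp add: pos_in_below ceiling_le_iff le_floor_iff)
      then show ?thesis by presburger
    qed
    \<comment> \<open>Because of \<open>a \<le> b\<close> the segment is never empty.\<close>
    have AB: "2 * \<lceil>a\<rceil> - 1 \<le> 2 * \<lfloor>b\<rfloor> + 1"
    proof -
      have "\<lceil>a\<rceil> \<le> \<lfloor>b\<rfloor> + 1" using ab by linarith
      then show ?thesis by simp
    qed
    have ne: "(\<exists>m. pos m \<in> below (a, b) \<and> x m \<noteq> 0) \<longleftrightarrow>
        (\<exists>m. x m \<noteq> 0 \<and> m \<le> 2 * \<lfloor>b\<rfloor> + 1) \<and> (\<exists>m. x m \<noteq> 0 \<and> 2 * \<lceil>a\<rceil> - 1 \<le> m)"
    proof
      assume "(\<exists>m. x m \<noteq> 0 \<and> m \<le> 2 * \<lfloor>b\<rfloor> + 1) \<and> (\<exists>m. x m \<noteq> 0 \<and> 2 * \<lceil>a\<rceil> - 1 \<le> m)"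
      then obtain m n where mn: "x m \<noteq> 0" "m \<le> 2 * \<lfloor>b\<rfloor> + 1" "x n \<noteq> 0" "2 * \<lceil>a\<rceil> - 1 \<le> n" by blast
      show "\<exists>m. pos m \<in> below (a, b) \<and> x m \<noteq> 0"
      proof (cases "2 * \<lceil>a\<rceil> - 1 \<le> m")
        case True then show ?thesis using mn seg by blast
      next
        case False
        then have "x (2 * \<lceil>a\<rceil> - 1) \<noteq> 0" using thread_convex[OF x _ mn(4) mn(1,3)] by simp
        then show ?thesis using AB unfolding seg by blast
      qed
    qed (unfold seg, blast)
    have cl: "(\<forall>m n. odd m \<and> (n = m + 1 \<or> n = m - 1) \<and> pos m \<in> below (a, b) \<and> pos n \<in> below (a, b) \<and> x m \<noteq> 0 \<longrightarrow> x n \<noteq> 0)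
      \<longleftrightarrow> \<not> (\<exists>m. odd m \<and> pos m \<in> below (a, b) \<and> pos (m - 1) \<in> below (a, b) \<and> x m \<noteq> 0 \<and> x (m - 1) = 0) \<and>
         \<not> (\<exists>m. odd m \<and> pos m \<in> below (a, b) \<and> pos (m + 1) \<in> below (a, b) \<and> x m \<noteq> 0 \<and> x (m + 1) = 0)"
      by blast
    have "(a, b) \<in> blk x \<longleftrightarrow> (\<exists>m. pos m \<in> below (a, b) \<and> x m \<noteq> 0) \<and>
      (\<forall>m n. odd m \<and> (n = m + 1 \<or> n = m - 1) \<and> pos m \<in> below (a, b) \<and> pos n \<in> below (a, b) \<and> x m \<noteq> 0 \<longrightarrow> x n \<noteq> 0)"
      using ab by (simp add: blk_def UU_iff)
    then show ?thesis unfolding ne cl block_iff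
      using E(2)[rule_format, OF ab] D(2)[rule_format, OF ab] ab by blast
  qed
  then have "blk x = block l E r D" by (intro set_eqI) (simp only: split_paired_all)
  then show ?thesis using E(1) D(1) by blast
qed

end

section \<open>Barcodes of block extensions\<close>

lemma vector_space_fun: "vector_space (\<lambda>c (f :: 'i \<Rightarrow> 'k::field) i. c * f i)"
  by unfold_locales (simp_all add: fun_eq_iff distrib_left distrib_right mult.assoc)

lemma subspace_dsum_fib:
  fixes J :: "'i \<Rightarrow> pt set"
  shows "module.subspace (\<lambda>c (f :: 'i \<Rightarrow> 'k::field) i. c * f i) (fib (dsum I (\<lambda>i. interval_module (J i))) p)"
proof -
  interpret vector_space "\<lambda>c (f :: 'i \<Rightarrow> 'k) i. c * f i" by (rule vector_space_fun)
  show ?thesis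
  proof (rule subspaceI)
    show "0 \<in> fib (dsum I (\<lambda>i. interval_module (J i) :: ('k, 'k) pmod)) p" unfolding dsum_interval_fib by simp
    fix f g assume f: "f \<in> fib (dsum I (\<lambda>i. interval_module (J i) :: ('k, 'k) pmod)) p"
      and g: "g \<in> fib (dsum I (\<lambda>i. interval_module (J i) :: ('k, 'k) pmod)) p"
    have nz: "f i \<noteq> 0 \<or> g i \<noteq> 0" if "(f + g) i \<noteq> 0" for i using that by auto
    show "f + g \<in> fib (dsum I (\<lambda>i. interval_module (J i) :: ('k, 'k) pmod)) p"
      unfolding dsum_interval_fib
    proof (intro conjI allI impI)
      fix i assume "(f + g) i \<noteq> 0"
      then show "i \<in> I" "p \<in> J i" using nz dsum_interval_fibD(2,3)[OF f] dsum_interval_fibD(2,3)[OF g] by blast+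
    next
      show "finite {i. (f + g) i \<noteq> 0}"
        by (rule finite_subset[OF _ finite_UnI[OF dsum_interval_fibD(1)[OF f] dsum_interval_fibD(1)[OF g]]])
          (use nz in blast)
    qed
  next
    fix c f assume f: "f \<in> fib (dsum I (\<lambda>i. interval_module (J i) :: ('k, 'k) pmod)) p"
    have "{i. c * f i \<noteq> 0} \<subseteq> {i. f i \<noteq> 0}" by auto
    then show "(\<lambda>i. c * f i) \<in> fib (dsum I (\<lambda>i. interval_module (J i) :: ('k, 'k) pmod)) p"
      unfolding dsum_interval_fib using dsum_interval_fibD[OF f] finite_subset by auto
  qed
qed

definition unit_at :: "'i \<Rightarrow> 'i \<Rightarrow> 'k::field" where
  "unit_at i = (\<lambda>j. if j = i then 1 else 0)"

lemma unit_at_fib: "i \<in> I \<Longrightarrow> p \<in> J i \<Longrightarrow> unit_at i \<in> fib (dsum I (\<lambda>i. interval_module (J i))) p"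
  unfolding dsum_interval_fib by (simp add: unit_at_def)

lemma lin_map_combination:
  fixes J :: "'i \<Rightarrow> pt set" and J' :: "'j \<Rightarrow> pt set" and F :: "('i \<Rightarrow> 'k::field) \<Rightarrow> ('j \<Rightarrow> 'k)"
  assumes F: "lin_map (scl (dsum I (\<lambda>i. interval_module (J i)))) (scl (dsum I' (\<lambda>i. interval_module (J' i))))
      (fib (dsum I (\<lambda>i. interval_module (J i))) p) B F"
    and T: "finite T" "\<And>i. i \<in> T \<Longrightarrow> i \<in> I \<and> p \<in> J i"
  shows "(\<lambda>i. if i \<in> T then c i else 0) \<in> fib (dsum I (\<lambda>i. interval_module (J i))) p"
    and "F (\<lambda>i. if i \<in> T then c i else 0) j = (\<Sum>i\<in>T. c i * F (unit_at i) j)"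
proof -
  let ?M = "dsum I (\<lambda>i. interval_module (J i) :: ('k, 'k) pmod)"
  let ?s = "\<lambda>c (f :: 'i \<Rightarrow> 'k) i. c * f i" and ?t = "\<lambda>c (f :: 'j \<Rightarrow> 'k) i. c * f i"
  have F': "lin_map ?s ?t (fib ?M p) B F" using F unfolding dsum_interval_sel .
  have sub: "module.subspace ?s (fib ?M p)" by (rule subspace_dsum_fib)
  interpret vector_space ?s by (rule vector_space_fun)
  have u: "unit_at i \<in> fib ?M p" if "i \<in> T" for i
    by (rule unit_at_fib) (use T(2)[OF that] in simp_all)
  have cu: "?s (c i) (unit_at i) \<in> fib ?M p" if "i \<in> T" for i using subspace_scale[OF sub u[OF that]] .
  have sum_at: "(\<Sum>i\<in>T. h i) k = (\<Sum>i\<in>T. h i k)" for h :: "'i \<Rightarrow> 'l \<Rightarrow> 'k" and k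
    by (induction T rule: infinite_finite_induct) simp_all
  have eq: "(\<lambda>i. if i \<in> T then c i else 0) = (\<Sum>i\<in>T. ?s (c i) (unit_at i))"
  proof
    fix k
    have "(\<Sum>i\<in>T. ?s (c i) (unit_at i)) k = (\<Sum>i\<in>T. if k = i then c i else 0)"
      unfolding sum_at by (rule sum.cong) (auto simp: unit_at_def)
    also have "\<dots> = (if k \<in> T then c k else 0)" using T(1) by simp
    finally show "(if k \<in> T then c k else 0) = (\<Sum>i\<in>T. ?s (c i) (unit_at i)) k" ..
  qed
  show "(\<lambda>i. if i \<in> T then c i else 0) \<in> fib ?M p"
    unfolding eq by (rule subspace_sum[OF sub cu])
  have "F (\<Sum>i\<in>T. ?s (c i) (unit_at i)) = (\<Sum>i\<in>T. F (?s (c i) (unit_at i)))"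
    by (rule lin_map_sum[OF vector_space_fun vector_space_fun sub F' cu])
  also have "\<dots> = (\<Sum>i\<in>T. ?t (c i) (F (unit_at i)))"
    using F' u by (intro sum.cong refl) (simp add: lin_map_def)
  finally show "F (\<lambda>i. if i \<in> T then c i else 0) j = (\<Sum>i\<in>T. c i * F (unit_at i) j)"
    unfolding eq by (simp add: sum_at)
qed

text \<open>With more bars through \<open>p\<close> on the left than on the right, some nontrivial
  combination of unit vectors would be killed by the injective map \<open>f p\<close>.\<close>

lemma finite_bars_iso:
  fixes J :: "'i \<Rightarrow> pt set" and J' :: "'j \<Rightarrow> pt set"
  assumes iso: "pmod_iso P (dsum I (\<lambda>i. interval_module (J i) :: ('k::field, 'k) pmod)) (dsum I' (\<lambda>i. interval_module (J' i)))"
    and p: "p \<in> P" and fin: "finite {i \<in> I'. p \<in> J' i}"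
  shows "finite {i \<in> I. p \<in> J i}"
proof (rule ccontr)
  let ?M = "dsum I (\<lambda>i. interval_module (J i) :: ('k, 'k) pmod)"
  let ?N = "dsum I' (\<lambda>i. interval_module (J' i) :: ('k, 'k) pmod)"
  let ?S = "{i \<in> I'. p \<in> J' i}"
  obtain f where f: "pmod_hom P ?M ?N f" and bij: "bij_betw (f p) (fib ?M p) (fib ?N p)"
    using iso p unfolding pmod_iso_def by blast
  assume "infinite {i \<in> I. p \<in> J i}"
  then obtain T where T: "T \<subseteq> {i \<in> I. p \<in> J i}" "finite T" "card T = Suc (card ?S)"
    using infinite_arbitrarily_large by blast
  have TI: "\<And>i. i \<in> T \<Longrightarrow> i \<in> I \<and> p \<in> J i" using T(1) by blast
  have lin: "lin_map (scl ?M) (scl ?N) (fib ?M p) (fib ?N p) (f p)" using pmod_homD(1)[OF f p] .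
  obtain c where c: "\<exists>i\<in>T. c i \<noteq> 0" "\<forall>s\<in>?S. (\<Sum>i\<in>T. c i * f p (unit_at i) s) = 0"
    using homogeneous_system[OF fin T(2), of "\<lambda>i. f p (unit_at i)"] T(3) by auto
  define v where "v = (\<lambda>i. if i \<in> T then c i else 0)"
  have v: "v \<in> fib ?M p" unfolding v_def by (rule lin_map_combination(1)[OF lin T(2) TI])
  have z: "f p v s = 0" for s
  proof (cases "s \<in> ?S")
    case True
    moreover have "f p v s = (\<Sum>i\<in>T. c i * f p (unit_at i) s)"
      unfolding v_def by (rule lin_map_combination(2)[OF lin T(2) TI])
    ultimately show ?thesis using c(2) by simp
  next
    case False
    have "f p v \<in> fib ?N p" using pmod_homD(3)[OF f p v] .
    then show ?thesis using dsum_interval_fibD(2,3)[of "f p v" I' J' p s] False by blast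
  qed
  \<comment> \<open>The zero vector, written as a combination so that its image is computed by the
    same rule.\<close>
  define w :: "'i \<Rightarrow> 'k" where "w = (\<lambda>i. if i \<in> T then (\<lambda>_. 0) i else 0)"
  have w: "w \<in> fib ?M p" unfolding w_def by (rule lin_map_combination(1)[OF lin T(2) TI])
  have "f p w s = (\<Sum>i\<in>T. (\<lambda>_. 0) i * f p (unit_at i) s)" for s
    unfolding w_def by (rule lin_map_combination(2)[OF lin T(2) TI])
  then have "f p v = f p w" using z by (intro ext) simp
  then have "v = w" using bij v w unfolding bij_betw_def inj_on_def by blast
  then have "v i = 0" for i by (simp add: w_def)
  then show False using c(1) unfolding v_def by metis
qed

definition bsum :: "barcode \<Rightarrow> ('k::field, pt set \<times> nat \<Rightarrow> 'k) pmod" where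
  "bsum C = dsum (bars C) (\<lambda>x. interval_module (fst x))"

lemma is_barcode_bsum:
  "is_barcode P M C \<longleftrightarrow> (\<forall>J. 0 < C J \<longrightarrow> interval P J) \<and> pmod_iso P M (bsum C)"
  by (simp add: is_barcode_def bsum_def case_prod_beta')

lemma (in threads) blk_interval_exact:
  assumes "x \<in> \<Lambda>" "blk x \<noteq> {}"
  shows "interval UU (blk x)" and "square_exact (blk x)"
proof -
  obtain l E r D where B: "upset E" "downset D" "blk x = block l E r D"
    using blk_is_block[OF assms] by (elim exE conjE) (rule that)
  show "interval UU (blk x)" using block_interval[OF B(1,2), of l r] assms(2) unfolding B(3) .
  show "square_exact (blk x)" unfolding B(3) by (rule block_square_exact[OF B(1,2)])
qed

text \<open>Middle exactness and finiteness over each point are known for the sum over threads. Both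
  are carried to the chosen barcode by an isomorphism, and middle exactness then descends to the
  single bars.\<close>

theorem barcode_block_ext:
  fixes V :: "('k::field, 'v::ab_group_add) pmod"
  assumes V: "is_pmod ZZ V" "pfd ZZ V"
  defines "C \<equiv> barcode_of UU (block_ext V)"
  shows "pmod_iso UU (block_ext V) (bsum C)"
    and "0 < C J \<Longrightarrow> is_block J"
    and "finite {x \<in> bars C. p \<in> fst x}"
proof -
  obtain \<Lambda> where L: "thread_decomp V \<Lambda>" using thread_decomp_exists[OF V] by blast
  interpret threads V \<Lambda> using V(1) L by unfold_locales
  let ?I = "{x \<in> \<Lambda>. blk x \<noteq> {}}"
  have fin: "finite {x \<in> ?I. p \<in> blk x}" for p
    by (rule finite_subset[OF _ finite_active[of p]]) (auto simp: active_def)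
  have "finite {x \<in> ?I. blk x = J}" for J
  proof (cases "J = {}")
    case False
    then obtain p where "p \<in> J" by blast
    then have "{x \<in> ?I. blk x = J} \<subseteq> {x \<in> ?I. p \<in> blk x}" by blast
    then show ?thesis using fin finite_subset by blast
  qed simp
  \<comment> \<open>Some barcode has to exist before the choice \<open>C\<close> is known to be
    one.\<close>
  then obtain C0 \<beta> where \<beta>: "bij_betw \<beta> ?I (bars C0)" "\<And>x. x \<in> ?I \<Longrightarrow> fst (\<beta> x) = blk x"
    using multiplicity_reindex[of ?I blk] by blast
  have iso0: "pmod_iso UU (block_ext V) (bsum C0)"
    unfolding bsum_def by (rule pmod_iso_trans[OF block_ext_iso dsum_interval_reindex[where J = blk and J' = fst, OF \<beta>]])
  have "interval UU J" if "0 < C0 J" for J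
  proof -
    have "(J, 0) \<in> bars C0" using that by (simp add: bars_def)
    then have "(J, 0) \<in> \<beta> ` ?I" using bij_betw_imp_surj_on[OF \<beta>(1)] by simp
    then obtain x where x: "(J, 0) = \<beta> x" "x \<in> ?I" by (rule imageE)
    have Jx: "J = blk x" using \<beta>(2)[OF x(2)] arg_cong[OF x(1), of fst] by simp
    show ?thesis unfolding Jx by (rule blk_interval_exact) (use x(2) in simp_all)
  qed
  then have "is_barcode UU (block_ext V) C0" using iso0 unfolding is_barcode_bsum by simp
  then have C: "is_barcode UU (block_ext V) C"
    unfolding C_def barcode_of_def by (rule someI[of "is_barcode UU (block_ext V)"])
  then show iso: "pmod_iso UU (block_ext V) (bsum C)" unfolding is_barcode_bsum by blast
  have iso': "pmod_iso UU (bsum C) (dsum ?I (\<lambda>x. interval_module (blk x) :: ('k, 'k) pmod))"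
    by (rule pmod_iso_trans[OF pmod_iso_sym[OF is_pmod_block_ext[OF V(1)] iso] block_ext_iso])
  have sq: "square_exact (fst x)" if "x \<in> bars C" for x
  proof -
    have "middle_exact (dsum ?I (\<lambda>x. interval_module (blk x) :: ('k, 'k) pmod))"
      by (rule dsum_middle_exact) (simp add: blk_interval_exact)
    moreover have "imap (bsum C) p q v \<in> fib (bsum C :: ('k, pt set \<times> nat \<Rightarrow> 'k) pmod) q"
      if "v \<in> fib (bsum C) p" for p q and v :: "pt set \<times> nat \<Rightarrow> 'k"
    proof -
      have v: "v \<in> fib (dsum (bars C) (\<lambda>x. interval_module (fst x))) p" using that by (simp add: bsum_def)
      have "{x. (if x \<in> bars C \<and> p \<in> fst x \<and> q \<in> fst x then v x else 0) \<noteq> 0} \<subseteq> {x. v x \<noteq> 0}"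
        by auto
      then have "finite {x. (if x \<in> bars C \<and> p \<in> fst x \<and> q \<in> fst x then v x else 0) \<noteq> 0}"
        by (rule finite_subset) (rule dsum_interval_fibD(1)[OF v])
      then show ?thesis unfolding bsum_def dsum_interval_sel dsum_interval_fib by presburger
    qed
    ultimately have "middle_exact (bsum C :: ('k, pt set \<times> nat \<Rightarrow> 'k) pmod)"
      using middle_exact_iso[OF _ iso'] by blast
    then show ?thesis using square_exact_of_dsum[of "bars C" fst] that unfolding bsum_def by blast
  qed
  show "is_block J" if J: "0 < C J"
  proof -
    have "(J, 0) \<in> bars C" using J by (simp add: bars_def)
    from sq[OF this] have "square_exact J" by simp
    moreover have "interval UU J" using C J unfolding is_barcode_bsum by blast
    ultimately show ?thesis by (intro exact_interval.is_block exact_interval.intro)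
  qed
  show "finite {x \<in> bars C. p \<in> fst x}"
  proof (cases "p \<in> UU")
    case True
    show ?thesis using finite_bars_iso[OF iso'[unfolded bsum_def] True fin] .
  next
    case False
    have "p \<notin> fst x" if "x \<in> bars C" for x
    proof -
      have "0 < C (fst x)" using that by (auto simp: bars_def)
      then have "interval UU (fst x)" using C unfolding is_barcode_bsum by blast
      then show ?thesis using False unfolding interval_def by blast
    qed
    then have "{x \<in> bars C. p \<in> fst x} = {}" by blast
    then show ?thesis by (simp only: finite.emptyI)
  qed
qed

section \<open>Extension by zero outside \<open>UU\<close>\<close>

lemma UU_up: "a \<in> UU \<Longrightarrow> a \<preceq> b \<Longrightarrow> b \<in> UU"
  by (cases a; cases b) (simp add: UU_iff opp_le_def)

text \<open>\<open>UU\<close> is closed upwards, so a composite that starts in \<open>UU\<close>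
  never passes through a zero fibre outside it.\<close>

lemma is_pmod_extend_zero:
  fixes M :: "('k::field, 'v::ab_group_add) pmod"
  assumes M: "is_pmod UU M"
  shows "is_pmod UNIV (extend_zero UU M)"
proof -
  interpret vector_space "scl M" using M by (simp add: is_pmod_def)
  have 0: "imap M a b 0 = 0" if "a \<in> UU" "b \<in> UU" "a \<preceq> b" for a b
  proof -
    have l: "lin_map (scl M) (scl M) (fib M a) (fib M b) (imap M a b)" and s: "subspace (fib M a)"
      using M that unfolding is_pmod_def by blast+
    have "imap M a b (0 + 0) = imap M a b 0 + imap M a b 0"
      using l subspace_0[OF s] unfolding lin_map_def by blast
    then show ?thesis by simp
  qed
  have l: "lin_map (scl M) (scl M) (fib M a) (fib M b) (imap M a b)"
    and c: "\<And>c v. c \<in> UU \<Longrightarrow> b \<preceq> c \<Longrightarrow> v \<in> fib M a \<Longrightarrow> imap M b c (imap M a b v) = imap M a c v"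
    and s: "subspace (fib M a)"
    if "a \<in> UU" "b \<in> UU" "a \<preceq> b" for a b
    using M that unfolding is_pmod_def by blast+
  have i: "imap M a a v = v" if "a \<in> UU" "v \<in> fib M a" for a v
    using M that unfolding is_pmod_def by blast
  show ?thesis
    unfolding is_pmod_def
  proof (intro conjI ballI impI)
    show "vector_space (scl (extend_zero UU M))" by (simp add: extend_zero_def vector_space_axioms)
    fix a
    show "module.subspace (scl (extend_zero UU M)) (fib (extend_zero UU M) a)"
      using s[of a a] by (simp add: extend_zero_def opp_le_def subspace_single_0)
    show "imap (extend_zero UU M) a a v = v" if "v \<in> fib (extend_zero UU M) a" for v
      using that i[of a v] by (auto simp: extend_zero_def split: if_splits)
    fix b
    show "lin_map (scl (extend_zero UU M)) (scl (extend_zero UU M)) (fib (extend_zero UU M) a)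
        (fib (extend_zero UU M) b) (imap (extend_zero UU M) a b)" if ab: "a \<preceq> b"
    proof (cases "a \<in> UU")
      case True
      then show ?thesis using l[OF True UU_up[OF True ab] ab] UU_up[OF True ab]
        by (simp add: extend_zero_def lin_map_def)
    next
      case False
      have "0 \<in> fib M b" if "b \<in> UU" using subspace_0[OF s[OF that that]] by (simp add: opp_le_def)
      then show ?thesis using False by (simp add: extend_zero_def lin_map_def)
    qed
    fix c' v assume o: "a \<preceq> b \<and> b \<preceq> c'" and v: "v \<in> fib (extend_zero UU M) a"
    show "imap (extend_zero UU M) b c' (imap (extend_zero UU M) a b v) = imap (extend_zero UU M) a c' v"
    proof (cases "a \<in> UU")
      case True
      then have "b \<in> UU" "c' \<in> UU" using UU_up o by blast+
      then show ?thesis using c[OF True, of b c' v] o v True by (simp add: extend_zero_def)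
    next
      case False
      then show ?thesis using 0[of b c'] o by (simp add: extend_zero_def)
    qed
  qed
qed

lemma pmod_iso_extend_zero:
  fixes M :: "('k::field, 'v::ab_group_add) pmod"
  assumes M: "is_pmod UU M" and iso: "pmod_iso UU M (bsum C)" and C: "\<And>J. 0 < C J \<Longrightarrow> J \<subseteq> UU"
  shows "pmod_iso UNIV (extend_zero UU M) (bsum C)"
proof -
  have J: "fst x \<subseteq> UU" if "x \<in> bars C" for x using C[of "fst x"] that by (auto simp: bars_def)
  obtain f where f: "pmod_hom UU M (bsum C) f" and bij: "\<And>a. a \<in> UU \<Longrightarrow> bij_betw (f a) (fib M a) (fib (bsum C) a)"
    using iso unfolding pmod_iso_def by blast
  define g where "g a = (if a \<in> UU then f a else (\<lambda>_. 0))" for a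
  have out: "fib (bsum C :: ('k, pt set \<times> nat \<Rightarrow> 'k) pmod) a = {0}" if "a \<notin> UU" for a
  proof (intro equalityI subsetI)
    fix v assume v: "v \<in> fib (bsum C :: ('k, pt set \<times> nat \<Rightarrow> 'k) pmod) a"
    have "v x = 0" for x
      using dsum_interval_fibD(2,3)[OF v[unfolded bsum_def], of x] J[of x] that by blast
    then show "v \<in> {0}" by (simp add: fun_eq_iff)
  qed (simp add: bsum_def dsum_interval_fib)
  have im0: "imap (bsum C) a b v = (0 :: pt set \<times> nat \<Rightarrow> 'k)" if "a \<notin> UU" for a b v
  proof
    fix x show "imap (bsum C) a b v x = (0 :: pt set \<times> nat \<Rightarrow> 'k) x"
      using J[of x] that by (auto simp: bsum_def dsum_interval_sel)
  qed
  show ?thesis unfolding pmod_iso_def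
  proof (intro exI conjI ballI)
    show "pmod_hom UNIV (extend_zero UU M) (bsum C) g"
      unfolding pmod_hom_def
    proof (intro conjI ballI impI)
      fix a
      show "lin_map (scl (extend_zero UU M)) (scl (bsum C)) (fib (extend_zero UU M) a) (fib (bsum C) a) (g a)"
      proof (cases "a \<in> UU")
        case True
        then show ?thesis using pmod_homD(1)[OF f True] by (simp add: extend_zero_def g_def)
      next
        case False
        then show ?thesis unfolding out[OF False] by (simp add: extend_zero_def g_def lin_map_def bsum_def dsum_interval_sel fun_eq_iff)
      qed
      fix b v assume ab: "a \<preceq> b" and v: "v \<in> fib (extend_zero UU M) a"
      show "g b (imap (extend_zero UU M) a b v) = imap (bsum C) a b (g a v)"
      proof (cases "a \<in> UU")
        case True
        then have "b \<in> UU" using UU_up ab by blast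
        then show ?thesis using pmod_homD(2)[OF f True _ ab, of v] v True by (simp add: extend_zero_def g_def)
      next
        case False
        have "g b 0 = 0"
        proof (cases "b \<in> UU")
          case True
          have "module.subspace (scl M) (fib M b)" "vector_space (scl M)"
            using M True by (simp_all add: is_pmod_def)
          moreover have "vector_space (scl (bsum C :: ('k, pt set \<times> nat \<Rightarrow> 'k) pmod))"
            unfolding bsum_def dsum_interval_sel by (rule vector_space_fun)
          ultimately show ?thesis
            using lin_map_sum[OF _ _ _ pmod_homD(1)[OF f True], of "{}" undefined] True by (simp add: g_def)
        qed (simp add: g_def)
        then show ?thesis using False im0[OF False] by (simp add: extend_zero_def)
      qed
    qed
    show "bij_betw (g a) (fib (extend_zero UU M) a) (fib (bsum C) a)" for a
      using bij[of a] out[of a] by (cases "a \<in> UU") (simp_all add: g_def extend_zero_def bij_betw_def)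
  qed
qed

section \<open>From matchings to interleavings\<close>

lemma shift_pt_shift_pt: "shift_pt e (shift_pt e a) = shift_pt (2 * e) a"
  by (simp add: shift_pt_def)

lemma shift_pt_mono: "a \<preceq> b \<Longrightarrow> shift_pt e a \<preceq> shift_pt e b"
  by (simp add: shift_pt_def opp_le_def)

lemma shift_pt_le: "0 \<le> e \<Longrightarrow> a \<preceq> shift_pt e a"
  by (simp add: shift_pt_def opp_le_def)

lemma shift_sel: "scl (shift e M) = scl M" "fib (shift e M) a = fib M (shift_pt e a)"
  "imap (shift e M) a b = imap M (shift_pt e a) (shift_pt e b)"
  by (simp_all add: shift_def)

lemma pmod_hom_shift:
  assumes "pmod_hom UNIV M N f"
  shows "pmod_hom UNIV (shift e M) (shift e N) (\<lambda>a. f (shift_pt e a))"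
  using pmod_homD[OF assms] unfolding pmod_hom_def shift_sel by (simp add: shift_pt_mono)

text \<open>The interleaving morphisms are conjugated by the isomorphisms; inverse pairs cancel in
  the middle of the composites.\<close>

lemma interleaved_transfer:
  assumes e: "0 \<le> e"
    and f: "pmod_hom UNIV M M' f" "pmod_hom UNIV M' M f'" "\<And>a v. v \<in> fib M' a \<Longrightarrow> f a (f' a v) = v"
    and g: "pmod_hom UNIV N N' g" "pmod_hom UNIV N' N g'" "\<And>a v. v \<in> fib N' a \<Longrightarrow> g a (g' a v) = v"
    and f'f: "\<And>a v. v \<in> fib M a \<Longrightarrow> f' a (f a v) = v" and g'g: "\<And>a v. v \<in> fib N a \<Longrightarrow> g' a (g a v) = v"
    and I: "interleaved e M N"
  shows "interleaved e M' N'"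
proof -
  let ?s = "shift_pt e"
  obtain h k where h: "pmod_hom UNIV M (shift e N) h" and k: "pmod_hom UNIV N (shift e M) k"
    and hk: "\<And>a v. v \<in> fib M a \<Longrightarrow> k (?s a) (h a v) = shift_map (2 * e) M a v"
    and kh: "\<And>a v. v \<in> fib N a \<Longrightarrow> h (?s a) (k a v) = shift_map (2 * e) N a v"
    using I unfolding interleaved_def by blast
  let ?h = "\<lambda>a v. g (?s a) (h a (f' a v))" and ?k = "\<lambda>a v. f (?s a) (k a (g' a v))"
  have h': "pmod_hom UNIV M' (shift e N') ?h"
    by (rule pmod_hom_compose[OF pmod_hom_compose[OF f(2) h] pmod_hom_shift[OF g(1)]])
  have k': "pmod_hom UNIV N' (shift e M') ?k"
    by (rule pmod_hom_compose[OF pmod_hom_compose[OF g(2) k] pmod_hom_shift[OF f(1)]])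
  have "?k (?s a) (?h a v) = shift_map (2 * e) M' a v" if v: "v \<in> fib M' a" for a v
  proof -
    have v': "f' a v \<in> fib M a" using pmod_homD(3)[OF f(2) UNIV_I v] .
    have "h a (f' a v) \<in> fib N (?s a)" using pmod_homD(3)[OF h UNIV_I v'] by (simp add: shift_sel)
    then have "?k (?s a) (?h a v) = f (?s (?s a)) (k (?s a) (h a (f' a v)))" by (simp add: g'g)
    also have "\<dots> = f (shift_pt (2 * e) a) (imap M a (shift_pt (2 * e) a) (f' a v))"
      unfolding hk[OF v'] by (simp add: shift_pt_shift_pt shift_map_def)
    also have "\<dots> = imap M' a (shift_pt (2 * e) a) (f a (f' a v))"
      by (rule pmod_homD(2)[OF f(1) UNIV_I UNIV_I _ v']) (use e in \<open>simp add: shift_pt_le\<close>)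
    finally show ?thesis using f(3)[OF v] by (simp add: shift_map_def)
  qed
  moreover have "?h (?s a) (?k a v) = shift_map (2 * e) N' a v" if v: "v \<in> fib N' a" for a v
  proof -
    have v': "g' a v \<in> fib N a" using pmod_homD(3)[OF g(2) UNIV_I v] .
    have "k a (g' a v) \<in> fib M (?s a)" using pmod_homD(3)[OF k UNIV_I v'] by (simp add: shift_sel)
    then have "?h (?s a) (?k a v) = g (?s (?s a)) (h (?s a) (k a (g' a v)))" by (simp add: f'f)
    also have "\<dots> = g (shift_pt (2 * e) a) (imap N a (shift_pt (2 * e) a) (g' a v))"
      unfolding kh[OF v'] by (simp add: shift_pt_shift_pt shift_map_def)
    also have "\<dots> = imap N' a (shift_pt (2 * e) a) (g a (g' a v))"
      by (rule pmod_homD(2)[OF g(1) UNIV_I UNIV_I _ v']) (use e in \<open>simp add: shift_pt_le\<close>)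
    finally show ?thesis using g(3)[OF v] by (simp add: shift_map_def)
  qed
  ultimately show ?thesis unfolding interleaved_def using h' k' by blast
qed

lemma interleaved_iso:
  assumes e: "0 \<le> e" and M: "is_pmod UNIV M" "pmod_iso UNIV M M'" and N: "is_pmod UNIV N" "pmod_iso UNIV N N'"
  shows "interleaved e M N \<longleftrightarrow> interleaved e M' N'"
proof -
  obtain f f' where f: "pmod_hom UNIV M M' f" "pmod_hom UNIV M' M f'"
    "\<And>a v. v \<in> fib M a \<Longrightarrow> f' a (f a v) = v" "\<And>a w. w \<in> fib M' a \<Longrightarrow> f a (f' a w) = w"
    using pmod_iso_inverse[OF M] by blast
  obtain g g' where g: "pmod_hom UNIV N N' g" "pmod_hom UNIV N' N g'"
    "\<And>a v. v \<in> fib N a \<Longrightarrow> g' a (g a v) = v" "\<And>a w. w \<in> fib N' a \<Longrightarrow> g a (g' a w) = w"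
    using pmod_iso_inverse[OF N] by blast
  show ?thesis
    using interleaved_transfer[OF e f(1,2,4) g(1,2,4) f(3) g(3)]
      interleaved_transfer[OF e f(2,1,3) g(2,1,3) f(4) g(4)] by blast
qed

lemma interval_module_sel: "scl (interval_module J) = (*)" "fib (interval_module J) a = (if a \<in> J then UNIV else {0})"
  "imap (interval_module J) a b v = (if a \<in> J \<and> b \<in> J then v else 0)"
  by (simp_all add: interval_module_def)

lemma diagonal_hom:
  fixes F :: "'i \<Rightarrow> pt \<Rightarrow> 'k::field \<Rightarrow> 'k" and J :: "'i \<Rightarrow> pt set" and J' :: "'j \<Rightarrow> pt set"
  assumes \<sigma>: "bij_betw \<sigma> I0 I0'" "I0 \<subseteq> I" "I0' \<subseteq> I'"
    and F: "\<And>x. x \<in> I0 \<Longrightarrow> pmod_hom UNIV (interval_module (J x)) (shift e (interval_module (J' (\<sigma> x)))) (F x)"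
  shows "pmod_hom UNIV (dsum I (\<lambda>x. interval_module (J x))) (shift e (dsum I' (\<lambda>x. interval_module (J' x))))
     (\<lambda>a v y. if y \<in> I0' then F (inv_into I0 \<sigma> y) a (v (inv_into I0 \<sigma> y)) else 0)"
    (is "pmod_hom UNIV ?M (shift e ?N) ?H")
proof -
  define \<tau> where "\<tau> = inv_into I0 \<sigma>"
  have \<tau>: "\<tau> y \<in> I0" "\<sigma> (\<tau> y) = y" if "y \<in> I0'" for y
    using \<sigma>(1) that unfolding \<tau>_def bij_betw_def by (auto intro: f_inv_into_f inv_into_into)
  define H where "H a v y = (if y \<in> I0' then F (\<tau> y) a (v (\<tau> y)) else 0)" for a v y
  have vf: "v x \<in> fib (interval_module (J x)) a" if "v \<in> fib ?M a" for v x a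
    using dsum_interval_fibD(3)[OF that, of x] by (auto simp: interval_module_sel)
  have Fy: "pmod_hom UNIV (interval_module (J (\<tau> y))) (shift e (interval_module (J' y))) (F (\<tau> y))" if "y \<in> I0'" for y
    using F[OF \<tau>(1)[OF that]] \<tau>(2)[OF that] by simp
  have Fadd: "F (\<tau> y) a (v + w) = F (\<tau> y) a v + F (\<tau> y) a w"
    if "y \<in> I0'" "v \<in> fib (interval_module (J (\<tau> y))) a" "w \<in> fib (interval_module (J (\<tau> y))) a" for y a v w
    using pmod_homD(1)[OF Fy[OF that(1)] UNIV_I, of a] that(2,3) unfolding lin_map_def by blast
  have Fscl: "F (\<tau> y) a (c * v) = c * F (\<tau> y) a v"
    if "y \<in> I0'" "v \<in> fib (interval_module (J (\<tau> y))) a" for y a v c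
    using pmod_homD(1)[OF Fy[OF that(1)] UNIV_I, of a] that(2) unfolding lin_map_def shift_sel interval_module_sel(1) by blast
  have F0: "F (\<tau> y) a 0 = 0" if "y \<in> I0'" for y a
    using Fscl[OF that, of 0 a 0] by (cases "a \<in> J (\<tau> y)") (simp_all add: interval_module_sel)
  have Ffib: "a' \<in> J' y" if "y \<in> I0'" "v \<in> fib (interval_module (J (\<tau> y))) a" "F (\<tau> y) a v \<noteq> 0" "a' = shift_pt e a" for y a v a'
    using pmod_homD(3)[OF Fy[OF that(1)] UNIV_I that(2)] that(3,4)
    by (auto simp: shift_sel interval_module_sel split: if_splits)
  have "pmod_hom UNIV ?M (shift e ?N) H"
    unfolding pmod_hom_def shift_sel
  proof (intro conjI ballI impI)
    fix a
    show "lin_map (scl ?M) (scl ?N) (fib ?M a) (fib ?N (shift_pt e a)) (H a)"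
      unfolding lin_map_def
    proof (intro conjI ballI allI image_subsetI)
      fix v assume v: "v \<in> fib ?M a"
      have nz: "y \<in> I0' \<and> v (\<tau> y) \<noteq> 0" if "H a v y \<noteq> 0" for y
        using that F0[of y a] unfolding H_def by (cases "y \<in> I0'"; cases "v (\<tau> y) = 0") simp_all
      show "H a v \<in> fib ?N (shift_pt e a)"
        unfolding dsum_interval_fib
      proof (intro conjI allI impI)
        fix y assume y: "H a v y \<noteq> 0"
        show "y \<in> I'" using nz[OF y] \<sigma>(3) by blast
        show "shift_pt e a \<in> J' y"
          using Ffib[of y "v (\<tau> y)" a "shift_pt e a"] nz[OF y] vf[OF v, of "\<tau> y"] y by (simp add: H_def)
      next
        have "{y. H a v y \<noteq> 0} \<subseteq> \<sigma> ` {x. v x \<noteq> 0}"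
        proof
          fix y assume "y \<in> {y. H a v y \<noteq> 0}"
          then have y: "y \<in> I0'" "v (\<tau> y) \<noteq> 0" using nz by blast+
          have "y = \<sigma> (\<tau> y)" using \<tau>(2)[OF y(1)] ..
          then show "y \<in> \<sigma> ` {x. v x \<noteq> 0}" using y(2) by (rule image_eqI[OF _ CollectI])
        qed
        then show "finite {y. H a v y \<noteq> 0}"
          by (rule finite_subset) (rule finite_imageI[OF dsum_interval_fibD(1)[OF v]])
      qed
      show "H a (scl ?M c v) = scl ?N c (H a v)" for c
      proof
        fix y show "H a (scl ?M c v) y = scl ?N c (H a v) y"
          using Fscl[of y "v (\<tau> y)" a c] vf[OF v, of "\<tau> y"] by (simp add: H_def dsum_interval_sel)
      qed
      fix w assume w: "w \<in> fib ?M a"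
      show "H a (v + w) = H a v + H a w"
      proof
        fix y show "H a (v + w) y = (H a v + H a w) y"
          using Fadd[of y "v (\<tau> y)" a "w (\<tau> y)"] vf[OF v, of "\<tau> y"] vf[OF w, of "\<tau> y"] by (simp add: H_def)
      qed
    qed
    fix b v assume ab: "a \<preceq> b" and v: "v \<in> fib ?M a"
    show "H b (imap ?M a b v) = imap ?N (shift_pt e a) (shift_pt e b) (H a v)"
    proof
      fix y
      show "H b (imap ?M a b v) y = imap ?N (shift_pt e a) (shift_pt e b) (H a v) y"
      proof (cases "y \<in> I0'")
        case True
        have "F (\<tau> y) b (imap (interval_module (J (\<tau> y))) a b (v (\<tau> y))) =
          imap (shift e (interval_module (J' y))) a b (F (\<tau> y) a (v (\<tau> y)))"
          by (rule pmod_homD(2)[OF Fy[OF True] UNIV_I UNIV_I ab vf[OF v]])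
        moreover have "\<tau> y \<in> I" "y \<in> I'" using \<tau>(1)[OF True] True \<sigma>(2,3) by blast+
        ultimately show ?thesis using True
          by (simp add: H_def dsum_interval_sel shift_sel interval_module_sel)
      qed (simp add: H_def dsum_interval_sel)
    qed
  qed
  then show ?thesis unfolding H_def[abs_def] \<tau>_def .
qed

text \<open>The interleavings of matched bars are added up. On unmatched bars both morphisms are 0,
  as they should be, because the internal map over \<open>2 * e\<close> vanishes there.\<close>

lemma matching_interleaved:
  assumes e: "0 \<le> e" and m: "is_matching TYPE('k::field) e C D C' D' \<sigma>"
  shows "interleaved e (bsum C :: ('k, pt set \<times> nat \<Rightarrow> 'k) pmod) (bsum D :: ('k, pt set \<times> nat \<Rightarrow> 'k) pmod)"
proof -
  let ?I = "\<lambda>x. interval_module (fst x) :: ('k, 'k) pmod"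
  have sub: "C' \<subseteq> bars C" "D' \<subseteq> bars D" and \<sigma>: "bij_betw \<sigma> C' D'"
    and tC: "\<And>x. x \<in> bars C \<Longrightarrow> x \<notin> C' \<Longrightarrow> trivial_interval TYPE('k) (2 * e) (fst x)"
    and tD: "\<And>x. x \<in> bars D \<Longrightarrow> x \<notin> D' \<Longrightarrow> trivial_interval TYPE('k) (2 * e) (fst x)"
    and il: "\<And>x. x \<in> C' \<Longrightarrow> interleaved e (?I x) (?I (\<sigma> x))"
    using m unfolding is_matching_def intervals_interleaved_def by blast+
  have "\<exists>F G. \<forall>x\<in>C'. pmod_hom UNIV (?I x) (shift e (?I (\<sigma> x))) (F x) \<and> pmod_hom UNIV (?I (\<sigma> x)) (shift e (?I x)) (G x)
     \<and> (\<forall>a. \<forall>v\<in>fib (?I x) a. G x (shift_pt e a) (F x a v) = shift_map (2 * e) (?I x) a v)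
     \<and> (\<forall>a. \<forall>w\<in>fib (?I (\<sigma> x)) a. F x (shift_pt e a) (G x a w) = shift_map (2 * e) (?I (\<sigma> x)) a w)"
    using il unfolding interleaved_def by metis
  then obtain F G where F: "\<And>x. x \<in> C' \<Longrightarrow> pmod_hom UNIV (?I x) (shift e (?I (\<sigma> x))) (F x)"
    and G: "\<And>x. x \<in> C' \<Longrightarrow> pmod_hom UNIV (?I (\<sigma> x)) (shift e (?I x)) (G x)"
    and GF: "\<And>x a v. x \<in> C' \<Longrightarrow> v \<in> fib (?I x) a \<Longrightarrow> G x (shift_pt e a) (F x a v) = shift_map (2 * e) (?I x) a v"
    and FG: "\<And>x a w. x \<in> C' \<Longrightarrow> w \<in> fib (?I (\<sigma> x)) a \<Longrightarrow> F x (shift_pt e a) (G x a w) = shift_map (2 * e) (?I (\<sigma> x)) a w"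
    by (elim exE) (rule that, blast+)
  define \<tau> where "\<tau> = inv_into C' \<sigma>"
  have \<tau>: "\<tau> y \<in> C'" "\<sigma> (\<tau> y) = y" if "y \<in> D'" for y
    using \<sigma> that unfolding \<tau>_def bij_betw_def by (auto intro: f_inv_into_f inv_into_into)
  have \<sigma>': "\<sigma> x \<in> D'" "\<tau> (\<sigma> x) = x" if "x \<in> C'" for x
    using \<sigma> that unfolding \<tau>_def bij_betw_def by auto
  have \<tau>bij: "bij_betw \<tau> D' C'" unfolding \<tau>_def by (rule bij_betw_inv_into[OF \<sigma>])
  have inv\<tau>: "inv_into D' \<tau> x = \<sigma> x" if "x \<in> C'" for x
    using inv_into_f_f[OF bij_betw_imp_inj_on[OF \<tau>bij] \<sigma>'(1)[OF that]] \<sigma>'(2)[OF that] by simp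
  define f where "f = (\<lambda>a v y. if y \<in> D' then F (\<tau> y) a (v (\<tau> y)) else (0::'k))"
  define g where "g = (\<lambda>a w x. if x \<in> C' then G x a (w (\<sigma> x)) else (0::'k))"
  have f: "pmod_hom UNIV (bsum C) (shift e (bsum D)) f"
    unfolding f_def \<tau>_def bsum_def by (rule diagonal_hom[where J = fst and J' = fst and F = F, OF \<sigma> sub F])
  have "g = (\<lambda>a w x. if x \<in> C' then G (\<tau> (inv_into D' \<tau> x)) a (w (inv_into D' \<tau> x)) else 0)"
    unfolding g_def by (intro ext) (simp add: inv\<tau> \<sigma>')
  moreover have "pmod_hom UNIV (bsum D) (shift e (bsum C))
      (\<lambda>a w x. if x \<in> C' then G (\<tau> (inv_into D' \<tau> x)) a (w (inv_into D' \<tau> x)) else 0)"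
    unfolding bsum_def
  proof (rule diagonal_hom[where J = fst and J' = fst and F = "\<lambda>y. G (\<tau> y)", OF \<tau>bij sub(2,1)])
    show "pmod_hom UNIV (?I y) (shift e (?I (\<tau> y))) (G (\<tau> y))" if "y \<in> D'" for y
      using G[OF \<tau>(1)[OF that]] \<tau>(2)[OF that] by simp
  qed
  ultimately have g: "pmod_hom UNIV (bsum D) (shift e (bsum C)) g" by simp
  have vf: "v x \<in> fib (?I x) a" if "v \<in> fib (bsum B) a" for v x a B
    using dsum_interval_fibD(3)[OF that[unfolded bsum_def], of x] by (auto simp: interval_module_sel)
  have sm: "shift_map (2 * e) (bsum B) a v x = (if x \<in> bars B then shift_map (2 * e) (?I x) a (v x) else 0)" for a v x B
    by (simp add: shift_map_def bsum_def dsum_interval_sel interval_module_sel)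
  have "g (shift_pt e a) (f a v) = shift_map (2 * e) (bsum C) a v" if v: "v \<in> fib (bsum C) a" for a v
  proof
    fix x
    show "g (shift_pt e a) (f a v) x = shift_map (2 * e) (bsum C) a v x"
    proof (cases "x \<in> C'")
      case True
      then show ?thesis using \<sigma>'[OF True] GF[OF True vf[OF v]] sub(1) unfolding sm by (auto simp: g_def f_def)
    next
      case False
      then show ?thesis using tC[OF _ False] vf[OF v] unfolding sm by (auto simp: g_def trivial_interval_def)
    qed
  qed
  moreover have "f (shift_pt e a) (g a w) = shift_map (2 * e) (bsum D) a w" if w: "w \<in> fib (bsum D) a" for a w
  proof
    fix y
    show "f (shift_pt e a) (g a w) y = shift_map (2 * e) (bsum D) a w y"
    proof (cases "y \<in> D'")
      case True
      have "F (\<tau> y) (shift_pt e a) (G (\<tau> y) a (w y)) = shift_map (2 * e) (?I y) a (w y)"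
        using FG[OF \<tau>(1)[OF True], of "w y" a] \<tau>(2)[OF True] vf[OF w, of y] by simp
      then show ?thesis using \<tau>[OF True] True sub(2) unfolding sm by (auto simp: g_def f_def)
    next
      case False
      then show ?thesis using tD[OF _ False] vf[OF w] unfolding sm by (auto simp: f_def trivial_interval_def)
    qed
  qed
  ultimately show ?thesis unfolding interleaved_def using f g by blast
qed

section \<open>Matching theory\<close>

text \<open>
  Rado's argument: in a minimal subfamily that still satisfies Hall's condition every set is a
  singleton. Finiteness of the sets makes Zorn's lemma applicable.
\<close>

lemma marriage:
  fixes N :: "'i \<Rightarrow> 'y set"
  assumes fin: "\<And>i. i \<in> I \<Longrightarrow> finite (N i)"
    and hall: "\<And>A. finite A \<Longrightarrow> A \<subseteq> I \<Longrightarrow> card A \<le> card (\<Union>i\<in>A. N i)"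
  shows "\<exists>h. inj_on h I \<and> (\<forall>i\<in>I. h i \<in> N i)"
proof -
  define M where "M Q i = {y \<in> N i. (i, y) \<notin> Q}" for Q i
  define \<A> where "\<A> = {Q. Q \<subseteq> Sigma I N \<and> (\<forall>A. finite A \<and> A \<subseteq> I \<longrightarrow> card A \<le> card (\<Union>i\<in>A. M Q i))}"
  have finM: "finite (\<Union>i\<in>A. M Q i)" if "finite A" "A \<subseteq> I" for A Q
    using that fin by (auto simp: M_def)
  have "{} \<in> \<A>" using hall by (simp add: \<A>_def M_def)
  have "\<exists>Q\<in>\<A>. \<forall>X\<in>\<A>. Q \<subseteq> X \<longrightarrow> X = Q"
  proof (rule subset_Zorn_nonempty)
    show "\<A> \<noteq> {}" using \<open>{} \<in> \<A>\<close> by blast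
    fix \<C> assume ne: "\<C> \<noteq> {}" and ch: "subset.chain \<A> \<C>"
    have CA: "\<C> \<subseteq> \<A>" using ch by (simp add: subset.chain_def)
    have "card A \<le> card (\<Union>i\<in>A. M (\<Union>\<C>) i)" if A: "finite A" "A \<subseteq> I" for A
    proof -
      \<comment> \<open>Only finitely many deleted pairs concern \<open>A\<close>, so one member of
        the chain contains them all.\<close>
      have "finite (\<Union>\<C> \<inter> Sigma A N)" using A fin by (intro finite_Int disjI2 finite_SigmaI) auto
      moreover have "\<Union>\<C> \<inter> Sigma A N \<subseteq> \<Union>\<C>" by blast
      ultimately obtain Q where Q: "Q \<in> \<C>" "\<Union>\<C> \<inter> Sigma A N \<subseteq> Q"
        using finite_subset_Union_chain[OF _ _ ne ch] by blast
      have "M (\<Union>\<C>) i = M Q i" if "i \<in> A" for i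
        using Q that unfolding M_def by blast
      then have "(\<Union>i\<in>A. M (\<Union>\<C>) i) = (\<Union>i\<in>A. M Q i)" by simp
      then show ?thesis using Q(1) CA A by (auto simp: \<A>_def)
    qed
    moreover have "\<Union>\<C> \<subseteq> Sigma I N" using CA by (auto simp: \<A>_def)
    ultimately show "\<Union>\<C> \<in> \<A>" by (simp add: \<A>_def)
  qed
  then obtain Q where Q: "Q \<in> \<A>" and Qmax: "\<And>X. X \<in> \<A> \<Longrightarrow> Q \<subseteq> X \<Longrightarrow> X = Q" by blast
  have Qsub: "Q \<subseteq> Sigma I N" using Q by (simp add: \<A>_def)
  have hallQ: "card A \<le> card (\<Union>i\<in>A. M Q i)" if "finite A" "A \<subseteq> I" for A
    using Q that by (simp add: \<A>_def)
  \<comment> \<open>By maximality of \<open>Q\<close>, one more deletion violates Hall's condition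
    for some set containing \<open>i\<close>; \<open>B\<close> is that set without
    \<open>i\<close>.\<close>
  have critical: "\<exists>B. finite B \<and> B \<subseteq> I \<and> card ((\<Union>j\<in>B. M Q j) \<union> (M Q i - {y})) \<le> card B \<and> i \<notin> B"
    if i: "i \<in> I" and y: "y \<in> M Q i" for i y
  proof -
    have yN: "y \<in> N i" "(i, y) \<notin> Q" using y unfolding M_def by blast+
    have nA: "insert (i, y) Q \<notin> \<A>"
    proof
      assume "insert (i, y) Q \<in> \<A>"
      then have "insert (i, y) Q = Q" by (rule Qmax) blast
      then show False using yN(2) by blast
    qed
    have sub: "insert (i, y) Q \<subseteq> Sigma I N" using Qsub i yN(1) by blast
    have "\<not> (\<forall>A. finite A \<and> A \<subseteq> I \<longrightarrow> card A \<le> card (\<Union>j\<in>A. M (insert (i, y) Q) j))"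
    proof
      assume "\<forall>A. finite A \<and> A \<subseteq> I \<longrightarrow> card A \<le> card (\<Union>j\<in>A. M (insert (i, y) Q) j)"
      with sub have "insert (i, y) Q \<in> \<A>" unfolding \<A>_def by (intro CollectI conjI)
      then show False using nA by contradiction
    qed
    then obtain A where A: "finite A" "A \<subseteq> I" "\<not> card A \<le> card (\<Union>j\<in>A. M (insert (i, y) Q) j)"
      by blast
    have Mi: "M (insert (i, y) Q) i = M Q i - {y}" unfolding M_def by blast
    have Mj: "M (insert (i, y) Q) j = M Q j" if "j \<noteq> i" for j using that unfolding M_def by blast
    have cong: "(\<Union>j\<in>B. M (insert (i, y) Q) j) = (\<Union>j\<in>B. M Q j)" if "i \<notin> B" for B
      using Mj that by (intro SUP_cong refl) metis
    have "i \<in> A"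
    proof (rule ccontr)
      assume "i \<notin> A"
      show False using A(3) hallQ[OF A(1,2)] unfolding cong[OF \<open>i \<notin> A\<close>] by simp
    qed
    let ?B = "A - {i}"
    have "(\<Union>j\<in>A. M (insert (i, y) Q) j) = (\<Union>j\<in>?B. M Q j) \<union> (M Q i - {y})"
    proof -
      have "(\<Union>j\<in>A. M (insert (i, y) Q) j) = M (insert (i, y) Q) i \<union> (\<Union>j\<in>?B. M (insert (i, y) Q) j)"
        using \<open>i \<in> A\<close> by blast
      moreover have "(\<Union>j\<in>?B. M (insert (i, y) Q) j) = (\<Union>j\<in>?B. M Q j)" by (rule cong) blast
      ultimately show ?thesis unfolding Mi by (simp only: Un_commute)
    qed
    then have "card ((\<Union>j\<in>?B. M Q j) \<union> (M Q i - {y})) < card A" using A(3) by simp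
    moreover have "card A = Suc (card ?B)" using A(1) \<open>i \<in> A\<close> by (rule card.remove)
    ultimately have "card ((\<Union>j\<in>?B. M Q j) \<union> (M Q i - {y})) \<le> card ?B" by linarith
    moreover have "finite ?B" "?B \<subseteq> I" "i \<notin> ?B" using A(1,2) by blast+
    ultimately show ?thesis by blast
  qed
  \<comment> \<open>Two elements give two critical sets; inclusion and exclusion contradicts Hall's
    condition for their union with \<open>i\<close> and for their intersection.\<close>
  have single: "y1 = y2" if i: "i \<in> I" and y: "y1 \<in> M Q i" "y2 \<in> M Q i" for i y1 y2
  proof (rule ccontr)
    assume ne: "y1 \<noteq> y2"
    obtain B1 where B1: "finite B1" "B1 \<subseteq> I" "card ((\<Union>j\<in>B1. M Q j) \<union> (M Q i - {y1})) \<le> card B1" "i \<notin> B1"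
      using critical[OF i y(1)] by blast
    obtain B2 where B2: "finite B2" "B2 \<subseteq> I" "card ((\<Union>j\<in>B2. M Q j) \<union> (M Q i - {y2})) \<le> card B2" "i \<notin> B2"
      using critical[OF i y(2)] by blast
    let ?X1 = "(\<Union>j\<in>B1. M Q j) \<union> (M Q i - {y1})" and ?X2 = "(\<Union>j\<in>B2. M Q j) \<union> (M Q i - {y2})"
    have fi: "finite (M Q i)" using fin[OF i] by (simp add: M_def)
    have fX: "finite ?X1" "finite ?X2" using finM B1(1,2) B2(1,2) fi by auto
    have "(\<Union>j\<in>insert i (B1 \<union> B2). M Q j) = ?X1 \<union> ?X2" using ne by auto
    then have "card (insert i (B1 \<union> B2)) \<le> card (?X1 \<union> ?X2)"
      using hallQ[of "insert i (B1 \<union> B2)"] B1(1,2) B2(1,2) i by simp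
    moreover have "card (insert i (B1 \<union> B2)) = Suc (card (B1 \<union> B2))" using B1 B2 by simp
    moreover have "card (B1 \<inter> B2) \<le> card (?X1 \<inter> ?X2)"
    proof -
      have "card (B1 \<inter> B2) \<le> card (\<Union>j\<in>B1 \<inter> B2. M Q j)" by (rule hallQ) (use B1 in auto)
      also have "\<dots> \<le> card (?X1 \<inter> ?X2)" using fX by (intro card_mono) auto
      finally show ?thesis .
    qed
    ultimately show False
      using card_Un_Int[OF fX] card_Un_Int[OF B1(1) B2(1)] B1(3) B2(3) by linarith
  qed
  have ne: "\<exists>y. y \<in> M Q i" if "i \<in> I" for i
  proof (rule ccontr)
    assume "\<nexists>y. y \<in> M Q i"
    then have "M Q i = {}" by blast
    then show False using hallQ[of "{i}"] that by simp
  qed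
  define h where "h i = (SOME y. y \<in> M Q i)" for i
  have h: "h i \<in> M Q i" if "i \<in> I" for i unfolding h_def using ne[OF that] by (rule someI_ex)
  have "inj_on h I"
  proof (rule inj_onI, rule ccontr)
    fix i j assume ij: "i \<in> I" "j \<in> I" "h i = h j" "i \<noteq> j"
    have "M Q i = {h i}" "M Q j = {h i}" using h single ij by fastforce+
    then have "(\<Union>k\<in>{i, j}. M Q k) = {h i}" by simp
    then show False using hallQ[of "{i, j}"] ij by simp
  qed
  moreover have "\<forall>i\<in>I. h i \<in> N i" using h by (simp add: M_def)
  ultimately show ?thesis by blast
qed

text \<open>As in the Cantor-Bernstein theorem, \<open>\<sigma>\<close> is \<open>h1\<close> on the
  least fixed point \<open>T\<close> and inverts \<open>h2\<close> on the rest. The fixed point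
  equation makes all of \<open>X\<close> and all of \<open>Y\<close> covered, although
  \<open>h1\<close> and \<open>h2\<close> may leave \<open>Y\<close> and \<open>X\<close>.\<close>

lemma combine_injections:
  assumes h1: "inj_on h1 X" "h1 ` X \<subseteq> B" and h2: "inj_on h2 Y" "h2 ` Y \<subseteq> A" and X: "X \<subseteq> A" and Y: "Y \<subseteq> B"
  shows "\<exists>A' B' \<sigma>. X \<subseteq> A' \<and> A' \<subseteq> A \<and> Y \<subseteq> B' \<and> B' \<subseteq> B \<and> bij_betw \<sigma> A' B' \<and>
     (\<forall>x\<in>A'. x \<in> X \<and> \<sigma> x = h1 x \<or> \<sigma> x \<in> Y \<and> h2 (\<sigma> x) = x)"
proof -
  define F where "F T = X - h2 ` (Y - h1 ` T)" for T
  define T where "T = lfp F"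
  have "F S \<subseteq> F S'" if "S \<subseteq> S'" for S S'
  proof -
    have "h2 ` (Y - h1 ` S') \<subseteq> h2 ` (Y - h1 ` S)" using that by (intro image_mono) blast
    then show ?thesis unfolding F_def by blast
  qed
  then have "mono F" by (rule monoI)
  then have "T = F T" unfolding T_def by (rule lfp_unfold)
  then have T: "T = X - h2 ` (Y - h1 ` T)" by (rule trans[OF _ F_def])
  let ?Y = "Y - h1 ` T"
  define \<sigma> where "\<sigma> x = (if x \<in> T then h1 x else inv_into Y h2 x)" for x
  have TX: "T \<subseteq> X" and disj: "T \<inter> h2 ` ?Y = {}" using T by blast+
  have \<sigma>2: "\<sigma> (h2 y) = y" if "y \<in> ?Y" for y
    using that disj inv_into_f_f[OF h2(1), of y] by (auto simp: \<sigma>_def)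
  have "bij_betw \<sigma> T (h1 ` T)"
    using inj_on_subset[OF h1(1) TX] by (intro bij_betw_cong[THEN iffD1, OF _ inj_on_imp_bij_betw]) (simp_all add: \<sigma>_def)
  moreover have "bij_betw \<sigma> (h2 ` ?Y) ?Y"
    by (rule bij_betw_byWitness[where f' = h2]) (use \<sigma>2 in auto)
  ultimately have "bij_betw \<sigma> (T \<union> h2 ` ?Y) (h1 ` T \<union> ?Y)"
    by (rule bij_betw_combine) blast
  moreover have "\<forall>x\<in>T \<union> h2 ` ?Y. x \<in> X \<and> \<sigma> x = h1 x \<or> \<sigma> x \<in> Y \<and> h2 (\<sigma> x) = x"
  proof
    fix x assume "x \<in> T \<union> h2 ` ?Y"
    then consider "x \<in> T" | y where "y \<in> ?Y" "x = h2 y" by blast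
    then show "x \<in> X \<and> \<sigma> x = h1 x \<or> \<sigma> x \<in> Y \<and> h2 (\<sigma> x) = x"
    proof cases
      case 1 then show ?thesis using TX by (auto simp: \<sigma>_def)
    next
      case 2 then show ?thesis using \<sigma>2[OF 2(1)] by simp
    qed
  qed
  moreover have "X \<subseteq> T \<union> h2 ` ?Y" using T by blast
  moreover have "T \<union> h2 ` ?Y \<subseteq> A" "Y \<subseteq> h1 ` T \<union> ?Y" "h1 ` T \<union> ?Y \<subseteq> B" using TX X Y h1(2) h2(2) by blast+
  ultimately show ?thesis by blast
qed

section \<open>Morphisms between blocks\<close>

definition block_data :: "pt set \<Rightarrow> bool \<times> real set \<times> bool \<times> real set \<Rightarrow> bool" where
  "block_data J d \<longleftrightarrow> (case d of (l, E, r, D) \<Rightarrow> upset E \<and> downset D \<and> (\<not> l \<longrightarrow> E \<noteq> UNIV) \<and> (\<not> r \<longrightarrow> D \<noteq> UNIV)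
     \<and> J = block l E r D)"

text \<open>One choice of parameters per block makes type and ends functions of the
  interval.\<close>

definition bdata :: "pt set \<Rightarrow> bool \<times> real set \<times> bool \<times> real set" where
  "bdata J = (SOME d. block_data J d)"

definition bL where "bL J = fst (bdata J)"
definition bE where "bE J = fst (snd (bdata J))"
definition bR where "bR J = fst (snd (snd (bdata J)))"
definition bD where "bD J = snd (snd (snd (bdata J)))"

lemma block_params:
  assumes "is_block J"
  shows "upset (bE J)" "downset (bD J)" "\<not> bL J \<Longrightarrow> bE J \<noteq> UNIV" "\<not> bR J \<Longrightarrow> bD J \<noteq> UNIV"
    "(a, b) \<in> J \<longleftrightarrow> a \<le> b \<and> (if bL J then b else a) \<in> bE J \<and> (if bR J then a else b) \<in> bD J"
proof -
  obtain l E r D where "upset E" "downset D" "\<not> l \<longrightarrow> E \<noteq> UNIV" "\<not> r \<longrightarrow> D \<noteq> UNIV" "J = block l E r D"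
    using assms unfolding is_block_def by (elim exE conjE) (rule that)
  then have "block_data J (l, E, r, D)" by (simp add: block_data_def)
  then have "block_data J (bdata J)" unfolding bdata_def by (rule someI)
  moreover have "bdata J = (bL J, bE J, bR J, bD J)" by (simp add: bL_def bE_def bR_def bD_def)
  ultimately have *: "upset (bE J) \<and> downset (bD J) \<and> (\<not> bL J \<longrightarrow> bE J \<noteq> UNIV) \<and> (\<not> bR J \<longrightarrow> bD J \<noteq> UNIV)
     \<and> J = block (bL J) (bE J) (bR J) (bD J)" by (simp add: block_data_def)
  then show "upset (bE J)" "downset (bD J)" "\<not> bL J \<Longrightarrow> bE J \<noteq> UNIV" "\<not> bR J \<Longrightarrow> bD J \<noteq> UNIV" by simp_all
  have "J = block (bL J) (bE J) (bR J) (bD J)" using * by (elim conjE)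
  then have "(a, b) \<in> J \<longleftrightarrow> (a, b) \<in> block (bL J) (bE J) (bR J) (bD J)" by (rule arg_cong)
  then show "(a, b) \<in> J \<longleftrightarrow> a \<le> b \<and> (if bL J then b else a) \<in> bE J \<and> (if bR J then a else b) \<in> bD J"
    unfolding block_iff .
qed

lemma shift_pt_pair: "shift_pt e (a, b) = (a - e, b + e)" by (simp add: shift_pt_def)

text \<open>
  The conditions that a nonzero morphism from the interval module of \<open>I\<close> to the \<open>e\<close>-shift of that
  of \<open>K\<close> imposes on the two sides of the blocks: a side bounded from above in the poset can only be
  mapped to a side bounded from above.
\<close>

definition homc :: "real \<Rightarrow> pt set \<Rightarrow> pt set \<Rightarrow> bool" where
  "homc e I K \<longleftrightarrow> (\<not> bL I \<longrightarrow> \<not> bL K) \<and> (\<not> bR I \<longrightarrow> \<not> bR K) \<and>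
    (bL I = bL K \<longrightarrow> (if bL I then \<forall>x\<in>bE I. x + e \<in> bE K else \<forall>x\<in>bE K. x + e \<in> bE I)) \<and>
    (bR I = bR K \<longrightarrow> (if bR I then \<forall>x\<in>bD I. x - e \<in> bD K else \<forall>x\<in>bD K. x - e \<in> bD I))"

lemma homcD:
  assumes "homc e I K" "bL I = bL K" "bR I = bR K"
  shows "bL K \<Longrightarrow> x \<in> bE I \<Longrightarrow> x + e \<in> bE K" "\<not> bL K \<Longrightarrow> x \<in> bE K \<Longrightarrow> x + e \<in> bE I"
    "bR K \<Longrightarrow> x \<in> bD I \<Longrightarrow> x - e \<in> bD K" "\<not> bR K \<Longrightarrow> x \<in> bD K \<Longrightarrow> x - e \<in> bD I"
  using assms unfolding homc_def by simp_all

text \<open>\<open>c p\<close> is the scalar by which a morphism acts at \<open>p\<close>, and the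
  hypotheses are naturality. Common points have a common join, so the scalar is constant. If it is
  nonzero, a point above a common point that lies in the shifted \<open>K\<close> lies in
  \<open>I\<close>, and a point of \<open>I\<close> below a common point lies in the shifted
  \<open>K\<close>; this gives all conditions on the ends.\<close>

lemma hom_coefficients:
  fixes c :: "pt \<Rightarrow> 'k::zero"
  assumes I: "is_block I" and K: "is_block K" and e: "0 \<le> e"
    and N1: "\<And>p q. p \<preceq> q \<Longrightarrow> p \<in> I \<Longrightarrow> q \<in> I \<Longrightarrow> shift_pt e p \<in> K \<Longrightarrow> shift_pt e q \<in> K \<Longrightarrow> c p = c q"
    and N2: "\<And>p q. p \<preceq> q \<Longrightarrow> p \<in> I \<Longrightarrow> q \<notin> I \<Longrightarrow> shift_pt e p \<in> K \<Longrightarrow> shift_pt e q \<in> K \<Longrightarrow> c p = 0"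
    and N3: "\<And>p q. q \<preceq> p \<Longrightarrow> p \<in> I \<Longrightarrow> q \<in> I \<Longrightarrow> shift_pt e p \<in> K \<Longrightarrow> shift_pt e q \<notin> K \<Longrightarrow> c p = 0"
    and p: "p \<in> I" "shift_pt e p \<in> K"
  shows "q \<in> I \<Longrightarrow> shift_pt e q \<in> K \<Longrightarrow> c p = c q" and "c p \<noteq> 0 \<Longrightarrow> homc e I K"
proof -
  note Ib = block_params[OF I] and Kb = block_params[OF K]
  have IE: "x \<in> bE I \<Longrightarrow> x \<le> y \<Longrightarrow> y \<in> bE I" and KE: "x \<in> bE K \<Longrightarrow> x \<le> y \<Longrightarrow> y \<in> bE K"
    and ID: "y \<in> bD I \<Longrightarrow> x \<le> y \<Longrightarrow> x \<in> bD I" and KD: "y \<in> bD K \<Longrightarrow> x \<le> y \<Longrightarrow> x \<in> bD K" for x y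
    using upsetD[OF Ib(1)] upsetD[OF Kb(1)] downsetD[OF Ib(2)] downsetD[OF Kb(2)] by blast+
  obtain a b where pab: "p = (a, b)" by (cases p)
  have pI: "a \<le> b" "(if bL I then b else a) \<in> bE I" "(if bR I then a else b) \<in> bD I"
    using p(1) unfolding pab Ib(5) by blast+
  have pK: "(if bL K then b + e else a - e) \<in> bE K" "(if bR K then a - e else b + e) \<in> bD K"
    using p(2) unfolding pab shift_pt_pair Kb(5) by blast+
  show "c p = c q" if q: "q \<in> I" "shift_pt e q \<in> K"
  proof -
    obtain a' b' where qab: "q = (a', b')" by (cases q)
    let ?j = "(min a a', max b b')"
    have "?j \<in> I" using p(1) q(1) unfolding pab qab Ib(5) by (auto simp: min_def max_def)
    moreover have "shift_pt e ?j \<in> K"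
      using p(2) q(2) unfolding pab qab shift_pt_pair Kb(5) by (auto simp: min_def max_def)
    ultimately have "c p = c ?j" "c q = c ?j"
      using N1[of p ?j] N1[of q ?j] p q by (simp_all add: pab qab opp_le_def)
    then show ?thesis by simp
  qed
  assume nz: "c p \<noteq> 0"
  have up: "q \<in> I" if "p \<preceq> q" "shift_pt e q \<in> K" for q
    using N2[of p q] nz p that by blast
  show "homc e I K"
    unfolding homc_def
  proof (intro conjI impI)
    show "\<not> bL K" if n: "\<not> bL I"
    proof
      assume K: "bL K"
      \<comment> \<open>Moving left beyond the bound of \<open>I\<close> does not leave the shifted
        \<open>K\<close> when its left side constrains only the second coordinate.\<close>
      obtain x where x: "x \<notin> bE I" using Ib(3)[OF n] by blast
      have "x < a" using IE[of a x] x pI(2) n by fastforce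
      then have "shift_pt e (x, b) \<in> K" "p \<preceq> (x, b)"
        using pI(1) pK K e KD[of "a - e" "x - e"] unfolding shift_pt_pair Kb(5) pab opp_le_def by auto
      then have "(x, b) \<in> I" by (intro up)
      then show False using x n unfolding Ib(5) by simp
    qed
    show "\<not> bR K" if n: "\<not> bR I"
    proof
      assume K: "bR K"
      obtain x where x: "x \<notin> bD I" using Ib(4)[OF n] by blast
      have "b < x" using ID[of b x] x pI(3) n by fastforce
      then have "shift_pt e (a, x) \<in> K" "p \<preceq> (a, x)"
        using pI(1) pK K e KE[of "b + e" "x + e"] unfolding shift_pt_pair Kb(5) pab opp_le_def by auto
      then have "(a, x) \<in> I" by (intro up)
      then show False using x n unfolding Ib(5) by simp
    qed
    assume L: "bL I = bL K"
    show "if bL I then \<forall>x\<in>bE I. x + e \<in> bE K else \<forall>x\<in>bE K. x + e \<in> bE I"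
    proof (cases "bL I")
      case True
      have "x + e \<in> bE K" if x: "x \<in> bE I" for x
      proof (cases "b \<le> x")
        case True
        then show ?thesis using KE[of "b + e" "x + e"] pK(1) L \<open>bL I\<close> by simp
      next
        case False
        \<comment> \<open>Moving left to \<open>m\<close> keeps \<open>(m, x)\<close> in the half
          plane.\<close>
        define m where "m = min a x"
        have 1: "(m, b) \<in> I" "shift_pt e (m, b) \<in> K"
          using p \<open>bL I\<close> L e ID[of a m] KD[of "a - e" "m - e"] unfolding pab Ib(5) Kb(5) shift_pt_pair
          by (auto simp: m_def)
        have 2: "(m, x) \<in> I" using 1(1) x False \<open>bL I\<close> ID[of b x] unfolding Ib(5) by (auto simp: m_def)
        have "c (m, b) = c p"
          using N1[of p "(m, b)"] p 1 by (simp add: pab opp_le_def m_def)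
        then have "shift_pt e (m, x) \<in> K"
          using N3[of "(m, x)" "(m, b)"] 1 2 nz False by (auto simp: opp_le_def)
        then show ?thesis using L \<open>bL I\<close> unfolding shift_pt_pair Kb(5) by simp
      qed
      then show ?thesis using True by simp
    next
      case False
      have "x + e \<in> bE I" if x: "x \<in> bE K" for x
      proof (cases "a \<le> x + e")
        case True
        then show ?thesis using IE pI(2) False by simp
      next
        case lt: False
        have "shift_pt e (x + e, b) \<in> K" "p \<preceq> (x + e, b)"
          using x pI(1) pK L False lt e KD[of "a - e" x] unfolding shift_pt_pair Kb(5) pab opp_le_def by auto
        then have "(x + e, b) \<in> I" by (intro up)
        then show ?thesis using False unfolding Ib(5) by simp
      qed
      then show ?thesis using False by simp
    qed
  next
    assume R: "bR I = bR K"
    show "if bR I then \<forall>x\<in>bD I. x - e \<in> bD K else \<forall>x\<in>bD K. x - e \<in> bD I"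
    proof (cases "bR I")
      case True
      have "x - e \<in> bD K" if x: "x \<in> bD I" for x
      proof (cases "x \<le> a")
        case True
        then show ?thesis using KD[of "a - e" "x - e"] pK(2) R \<open>bR I\<close> by simp
      next
        case False
        define m where "m = max b x"
        have 1: "(a, m) \<in> I" "shift_pt e (a, m) \<in> K"
          using p \<open>bR I\<close> R e IE[of b m] KE[of "b + e" "m + e"] unfolding pab Ib(5) Kb(5) shift_pt_pair
          by (auto simp: m_def)
        have 2: "(x, m) \<in> I" using 1(1) x False \<open>bR I\<close> IE[of a x] unfolding Ib(5) by (auto simp: m_def)
        have "c (a, m) = c p"
          using N1[of p "(a, m)"] p 1 by (simp add: pab opp_le_def m_def)
        then have "shift_pt e (x, m) \<in> K"
          using N3[of "(x, m)" "(a, m)"] 1 2 nz False by (auto simp: opp_le_def)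
        then show ?thesis using R \<open>bR I\<close> unfolding shift_pt_pair Kb(5) by simp
      qed
      then show ?thesis using True by simp
    next
      case False
      have "x - e \<in> bD I" if x: "x \<in> bD K" for x
      proof (cases "x - e \<le> b")
        case True
        then show ?thesis using ID pI(3) False by simp
      next
        case lt: False
        have "shift_pt e (a, x - e) \<in> K" "p \<preceq> (a, x - e)"
          using x pI(1) pK R False lt e KE[of "b + e" x] unfolding shift_pt_pair Kb(5) pab opp_le_def by auto
        then have "(a, x - e) \<in> I" by (intro up)
        then show ?thesis using False unfolding Ib(5) by simp
      qed
      then show ?thesis using False by simp
    qed
  qed
qed

text \<open>
  The signs are such that a nonzero morphism raises both coordinates by at most the shift, whatever
  the type of the blocks (\<open>homc_coords\<close>).
\<close>

definition uu :: "pt set \<Rightarrow> ereal" where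
  "uu J = (if bL J then Inf (ereal ` bE J) else - Inf (ereal ` bE J))"

definition vv :: "pt set \<Rightarrow> ereal" where
  "vv J = (if bR J then - Sup (ereal ` bD J) else Sup (ereal ` bD J))"

text \<open>Equal types, with corresponding ends at distance at most \<open>d\<close>. Stating this
  for the sets of admissible coordinates treats infinite, open and closed ends alike.\<close>

definition close :: "real \<Rightarrow> pt set \<Rightarrow> pt set \<Rightarrow> bool" where
  "close d I K \<longleftrightarrow> bL I = bL K \<and> bR I = bR K \<and> (\<forall>x\<in>bE I. x + d \<in> bE K) \<and> (\<forall>x\<in>bE K. x + d \<in> bE I) \<and>
     (\<forall>x\<in>bD I. x - d \<in> bD K) \<and> (\<forall>x\<in>bD K. x - d \<in> bD I)"

section \<open>Ends of blocks as extended real coordinates\<close>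

lemma close_sym: "close d I K \<Longrightarrow> close d K I"
  by (simp add: close_def)

lemma ereal_le_shift: "x + ereal (- e) \<le> y \<Longrightarrow> x \<le> y + ereal e"
  by (cases x; cases y) auto

lemma ereal_uminus_le_shift: "- x \<le> - y + ereal e \<longleftrightarrow> y \<le> x + ereal e"
  by (cases x; cases y) auto

lemma Inf_shift_le:
  assumes "\<And>x. x \<in> S \<Longrightarrow> x + e \<in> T"
  shows "Inf (ereal ` T) \<le> Inf (ereal ` S) + ereal e"
proof (rule ereal_le_shift, rule Inf_greatest)
  fix y assume "y \<in> ereal ` S"
  then obtain x where x: "x \<in> S" "y = ereal x" by blast
  have "Inf (ereal ` T) \<le> ereal (x + e)" using assms[OF x(1)] by (intro Inf_lower) blast
  then show "Inf (ereal ` T) + ereal (- e) \<le> y" unfolding x(2) by (cases "Inf (ereal ` T)") auto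
qed

lemma Sup_shift_le:
  assumes "\<And>x. x \<in> S \<Longrightarrow> x - e \<in> T"
  shows "Sup (ereal ` S) \<le> Sup (ereal ` T) + ereal e"
proof (rule Sup_least)
  fix y assume "y \<in> ereal ` S"
  then obtain x where x: "x \<in> S" "y = ereal x" by blast
  have "ereal (x - e) \<le> Sup (ereal ` T)" using assms[OF x(1)] by (intro Sup_upper) blast
  then show "y \<le> Sup (ereal ` T) + ereal e" unfolding x(2) by (cases "Sup (ereal ` T)") auto
qed

text \<open>The infimum forgets whether the end belongs to the set; the strict inequality
  \<open>e < d\<close> makes up for it.\<close>

lemma Inf_shift_mem:
  assumes T: "upset T" and le: "Inf (ereal ` T) \<le> Inf (ereal ` S) + ereal e" and ed: "e < d" and x: "x \<in> S"
  shows "x + d \<in> T"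
proof -
  have "Inf (ereal ` S) \<le> ereal x" using x by (intro Inf_lower) blast
  then have "Inf (ereal ` S) + ereal e \<le> ereal x + ereal e" by (rule add_right_mono)
  then have "Inf (ereal ` T) \<le> ereal (x + e)" using le by simp
  also have "ereal (x + e) < ereal (x + d)" using ed by simp
  finally obtain t where "t \<in> T" "t < x + d" unfolding Inf_less_iff by auto
  then show ?thesis using upsetD[OF T, of t "x + d"] by simp
qed

lemma Sup_shift_mem:
  assumes T: "downset T" and le: "Sup (ereal ` S) \<le> Sup (ereal ` T) + ereal e" and ed: "e < d" and x: "x \<in> S"
  shows "x - d \<in> T"
proof -
  have "ereal x \<le> Sup (ereal ` S)" using x by (intro Sup_upper) blast
  then have "ereal x \<le> Sup (ereal ` T) + ereal e" using le by (rule order_trans)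
  then have "ereal (x - d) < Sup (ereal ` T)" using ed by (cases "Sup (ereal ` T)") auto
  then obtain t where "t \<in> T" "x - d < t" unfolding less_Sup_iff by auto
  then show ?thesis using downsetD[OF T, of t "x - d"] by simp
qed

lemma homc_coords:
  assumes "homc e I K" "bL I = bL K" "bR I = bR K"
  shows "uu K \<le> uu I + ereal e" "vv K \<le> vv I + ereal e"
proof -
  show "uu K \<le> uu I + ereal e"
    using assms Inf_shift_le[of "bE I" e "bE K"] Inf_shift_le[of "bE K" e "bE I"]
    unfolding homc_def uu_def by (cases "bL K") (simp_all add: ereal_uminus_le_shift)
  show "vv K \<le> vv I + ereal e"
    using assms Sup_shift_le[of "bD I" e "bD K"] Sup_shift_le[of "bD K" e "bD I"]
    unfolding homc_def vv_def by (cases "bR K") (simp_all add: ereal_uminus_le_shift)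
qed

text \<open>If neither coordinate dropped by more than \<open>e\<close>, then by
  \<open>homc_coords\<close> corresponding ends would differ by at most \<open>e\<close>, and
  \<open>d > e\<close> would make the blocks close.\<close>

lemma not_close_coords:
  assumes I: "is_block I" and K: "is_block K" and h: "homc e I K" and LR: "bL I = bL K" "bR I = bR K"
    and nc: "\<not> close d I K" and ed: "e < d"
  shows "uu K + ereal e < uu I \<or> vv K + ereal e < vv I"
proof (rule ccontr)
  assume "\<not> ?thesis"
  then have le: "uu I \<le> uu K + ereal e" "vv I \<le> vv K + ereal e" by auto
  note ge = homc_coords[OF h LR]
  have E: "Inf (ereal ` bE I) \<le> Inf (ereal ` bE K) + ereal e" "Inf (ereal ` bE K) \<le> Inf (ereal ` bE I) + ereal e"
    using le(1) ge(1) LR(1) unfolding uu_def by (cases "bL K"; simp add: ereal_uminus_le_shift)+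
  have D: "Sup (ereal ` bD I) \<le> Sup (ereal ` bD K) + ereal e" "Sup (ereal ` bD K) \<le> Sup (ereal ` bD I) + ereal e"
    using le(2) ge(2) LR(2) unfolding vv_def by (cases "bR K"; simp add: ereal_uminus_le_shift)+
  have "close d I K" unfolding close_def
    using LR Inf_shift_mem[OF block_params(1)[OF I] E(1) ed] Inf_shift_mem[OF block_params(1)[OF K] E(2) ed]
      Sup_shift_mem[OF block_params(2)[OF K] D(1) ed] Sup_shift_mem[OF block_params(2)[OF I] D(2) ed] by blast
  then show False using nc by simp
qed

text \<open>A sum with an infinite term does not register a strict change of the other term; clipped
  coordinates have real sums.\<close>

definition clip :: "real \<Rightarrow> ereal \<Rightarrow> real" where
  "clip R x = (case x of ereal r \<Rightarrow> r | PInfty \<Rightarrow> R | MInfty \<Rightarrow> - R)"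

text \<open>The margin keeps comparisons up to a shift by \<open>2 * e\<close> valid after clipping,
  also between a finite and an infinite value.\<close>

definition inrange :: "real \<Rightarrow> real \<Rightarrow> ereal \<Rightarrow> bool" where
  "inrange e R x \<longleftrightarrow> 0 < R \<and> 2 * e < R \<and> (\<forall>r. x = ereal r \<longrightarrow> \<bar>r\<bar> + 2 * e < R)"

lemma clip_le: "0 \<le> e \<Longrightarrow> inrange e R x \<Longrightarrow> inrange e R y \<Longrightarrow> y \<le> x + ereal (2 * e) \<Longrightarrow> clip R y \<le> clip R x + 2 * e"
  unfolding inrange_def clip_def by (cases x; cases y) auto

lemma clip_less: "0 \<le> e \<Longrightarrow> inrange e R x \<Longrightarrow> inrange e R y \<Longrightarrow> y + ereal (2 * e) < x \<Longrightarrow> clip R y + 2 * e < clip R x"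
  unfolding inrange_def clip_def by (cases x; cases y) auto

lemma clip_less0: "0 \<le> e \<Longrightarrow> inrange e R x \<Longrightarrow> inrange e R y \<Longrightarrow> y < x \<Longrightarrow> clip R y < clip R x"
  unfolding inrange_def clip_def by (cases x; cases y) auto

text \<open>Two drops in the same coordinate lower it by more than \<open>2 * e\<close>, while the
  other rises by at most \<open>2 * e\<close>; drops in different coordinates each outweigh the rise
  in the other step. The middle values stay unclipped, as the middle bar need not belong to the
  finite set that determines \<open>R\<close>.\<close>

lemma clip_sum_decreases:
  assumes e: "0 \<le> e" and w: "inrange e R u" "inrange e R v" "inrange e R u2" "inrange e R v2"
    and 1: "u1 \<le> u + ereal e" "v1 \<le> v + ereal e" and 2: "u2 \<le> u1 + ereal e" "v2 \<le> v1 + ereal e"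
    and s1: "u1 + ereal e < u \<or> v1 + ereal e < v" and s2: "u2 + ereal e < u1 \<or> v2 + ereal e < v1"
  shows "clip R u2 + clip R v2 < clip R u + clip R v"
proof -
  have lin: "z2 \<le> z + ereal (2 * e)" if "z1 \<le> z + ereal e" "z2 \<le> z1 + ereal e" for z z1 z2 :: ereal
    using that by (cases z; cases z1; cases z2) auto
  have ss: "z2 + ereal (2 * e) < z" if "z1 + ereal e < z" "z2 + ereal e < z1" for z z1 z2 :: ereal
    using that by (cases z; cases z1; cases z2) auto
  have sl: "z2 < z" if "z1 + ereal e < z" "z2 \<le> z1 + ereal e" for z z1 z2 :: ereal
    using that by simp
  have ls: "z2 < z" if "z1 \<le> z + ereal e" "z2 + ereal e < z1" for z z1 z2 :: ereal
    using that by (cases z; cases z1; cases z2) auto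
  from s1 s2 consider "u1 + ereal e < u" "u2 + ereal e < u1" | "u1 + ereal e < u" "v2 + ereal e < v1"
    | "v1 + ereal e < v" "u2 + ereal e < u1" | "v1 + ereal e < v" "v2 + ereal e < v1" by blast
  then show ?thesis
  proof cases
    case 1
    then show ?thesis
      using clip_less[OF e w(1,3) ss[OF 1]] clip_le[OF e w(2,4) lin] \<open>v1 \<le> v + ereal e\<close> \<open>v2 \<le> v1 + ereal e\<close> by fastforce
  next
    case c: 2
    then show ?thesis
      using clip_less0[OF e w(1,3) sl[OF c(1) 2(1)]] clip_less0[OF e w(2,4) ls[OF 1(2) c(2)]] by simp
  next
    case c: 3
    then show ?thesis
      using clip_less0[OF e w(2,4) sl[OF c(1) 2(2)]] clip_less0[OF e w(1,3) ls[OF 1(1) c(2)]] by simp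
  next
    case 4
    then show ?thesis
      using clip_less[OF e w(2,4) ss[OF 4]] clip_le[OF e w(1,3) lin] \<open>u1 \<le> u + ereal e\<close> \<open>u2 \<le> u1 + ereal e\<close> by fastforce
  qed
qed

lemma inrange_exists:
  assumes "finite A" "0 \<le> e"
  shows "\<exists>R. \<forall>x\<in>A. inrange e R (f x)"
proof (intro exI ballI)
  define g where "g x = \<bar>real_of_ereal (f x)\<bar>" for x
  have g: "0 \<le> g x" for x by (simp only: g_def abs_ge_zero)
  fix x assume x: "x \<in> A"
  have "g x \<le> sum g A" using member_le_sum[OF x, of g] g assms(1) by simp
  moreover have "0 \<le> sum g A" using g by (simp add: sum_nonneg)
  ultimately show "inrange e (sum g A + 2 * e + 1) (f x)"
    using assms(2) unfolding inrange_def by (auto simp: g_def)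
qed

text \<open>On each side one of the two conditions applies: a closed side is pushed forward from
  \<open>I\<close>, an open one pulled back from \<open>J\<close>.\<close>

lemma homc_middle:
  assumes I: "is_block I" and K: "is_block K" and J: "is_block J" and h: "homc e I K" "homc e K J"
    and LR: "bL I = bL K" "bR I = bR K" "bL K = bL J" "bR K = bR J"
    and p: "p \<in> I" "shift_pt (2 * e) p \<in> J" and e: "0 \<le> e"
  shows "shift_pt e p \<in> K"
proof -
  obtain a b where pab: "p = (a, b)" by (cases p)
  have I': "a \<le> b" "(if bL K then b else a) \<in> bE I" "(if bR K then a else b) \<in> bD I"
    using p(1) LR unfolding pab block_params(5)[OF I] by simp_all
  have J': "(if bL K then b + 2 * e else a - 2 * e) \<in> bE J" "(if bR K then a - 2 * e else b + 2 * e) \<in> bD J"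
    using p(2) LR unfolding pab shift_pt_pair block_params(5)[OF J] by simp_all
  have "(if bL K then b + e else a - e) \<in> bE K"
  proof (cases "bL K")
    case True then show ?thesis using h(1) LR I'(2) by (simp add: homc_def)
  next
    case False
    then have "a - 2 * e + e \<in> bE K" using homcD(2)[OF h(2) LR(3,4), of "a - 2 * e"] LR J'(1) by simp
    moreover have "a - 2 * e + e = a - e" by simp
    ultimately show ?thesis using False by simp
  qed
  moreover have "(if bR K then a - e else b + e) \<in> bD K"
  proof (cases "bR K")
    case True then show ?thesis using h(1) LR I'(3) by (simp add: homc_def)
  next
    case False
    then have "b + 2 * e - e \<in> bD K" using homcD(4)[OF h(2) LR(3,4), of "b + 2 * e"] LR J'(2) by simp
    moreover have "b + 2 * e - e = b + e" by simp
    ultimately show ?thesis using False by simp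
  qed
  ultimately show ?thesis using I'(1) e unfolding pab shift_pt_pair block_params(5)[OF K] by simp
qed

text \<open>If both sides are closed or both are open, a test point \<open>s\<close> always exists.
  In the mixed cases the blocks are strips meeting the diagonal, of width at least
  \<open>2 * d > 2 * e\<close>. When no diagonal point serves, the strips are separated up to
  \<open>2 * e\<close>, and their widths make both coordinates drop.\<close>

lemma homc_point:
  assumes I: "is_block I" and K: "is_block K" and J: "is_block J" and h: "homc e I K" "homc e K J"
    and LR: "bL I = bL K" "bR I = bR K" "bL K = bL J" "bR K = bR J"
    and e: "0 \<le> e" "e < d"
    and nI: "p \<in> I" "shift_pt (2 * d) p \<in> I" and nJ: "q \<in> J" "shift_pt (2 * d) q \<in> J"
  shows "(\<exists>s. s \<in> I \<and> shift_pt (2 * e) s \<in> J) \<or> uu J < uu I \<and> vv J < vv I"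
proof -
  note Ib = block_params[OF I] and Jb = block_params[OF J]
  obtain a b where pab: "p = (a, b)" by (cases p)
  obtain a' b' where qab: "q = (a', b')" by (cases q)
  note P = nI[unfolded pab shift_pt_pair Ib(5)] and Q = nJ[unfolded qab shift_pt_pair Jb(5)]
  have EE: "x + 2 * e \<in> bE J" if "bL J" "x \<in> bE I" for x
  proof -
    have "x + e + e \<in> bE J" using homcD(1)[OF h(2) LR(3,4), OF _ homcD(1)[OF h(1) LR(1,2), OF _ that(2)]] that(1) LR by simp
    moreover have "x + e + e = x + 2 * e" by simp
    ultimately show ?thesis by simp
  qed
  have EE': "x + 2 * e \<in> bE I" if "\<not> bL J" "x \<in> bE J" for x
  proof -
    have "x + e + e \<in> bE I" using homcD(2)[OF h(1) LR(1,2), OF _ homcD(2)[OF h(2) LR(3,4), OF _ that(2)]] that(1) LR by simp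
    moreover have "x + e + e = x + 2 * e" by simp
    ultimately show ?thesis by simp
  qed
  have DD: "x - 2 * e \<in> bD J" if "bR J" "x \<in> bD I" for x
  proof -
    have "x - e - e \<in> bD J" using homcD(3)[OF h(2) LR(3,4), OF _ homcD(3)[OF h(1) LR(1,2), OF _ that(2)]] that(1) LR by simp
    moreover have "x - e - e = x - 2 * e" by simp
    ultimately show ?thesis by simp
  qed
  have DD': "x - 2 * e \<in> bD I" if "\<not> bR J" "x \<in> bD J" for x
  proof -
    have "x - e - e \<in> bD I" using homcD(4)[OF h(1) LR(1,2), OF _ homcD(4)[OF h(2) LR(3,4), OF _ that(2)]] that(1) LR by simp
    moreover have "x - e - e = x - 2 * e" by simp
    ultimately show ?thesis by simp
  qed
  show ?thesis
  proof (cases "bL J"; cases "bR J")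
    assume t: "bL J" "bR J"
    \<comment> \<open>The join of \<open>p\<close> with \<open>q\<close> shifted back by
      \<open>2 * e\<close>.\<close>
    let ?s = "(min a (a' + 2 * e), max b (b' - 2 * e))"
    have "?s \<in> I" "shift_pt (2 * e) ?s \<in> J"
      using P Q t LR e upsetD[OF Ib(1), of b "max b (b' - 2 * e)"] downsetD[OF Ib(2), of a "min a (a' + 2 * e)"]
        upsetD[OF Jb(1), of b' "max b (b' - 2 * e) + 2 * e"] downsetD[OF Jb(2), of a' "min a (a' + 2 * e) - 2 * e"]
      unfolding shift_pt_pair Ib(5) Jb(5) by auto
    then show ?thesis by blast
  next
    assume t: "\<not> bL J" "\<not> bR J"
    have "a' - 2 * e \<in> bE J" using Q t e upsetD[OF Jb(1), of "a' - 2 * d" "a' - 2 * e"] by simp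
    moreover have "b' + 2 * e \<in> bD J" using Q t e downsetD[OF Jb(2), of "b' + 2 * d" "b' + 2 * e"] by simp
    ultimately have "q \<in> I" "shift_pt (2 * e) q \<in> J"
      using EE'[OF t(1), of "a' - 2 * e"] DD'[OF t(2), of "b' + 2 * e"] Q t LR e
      unfolding qab shift_pt_pair Ib(5) Jb(5) by auto
    then show ?thesis by blast
  next
    assume t: "bL J" "\<not> bR J"
    show ?thesis
    proof (cases "\<exists>x\<in>bE I. x + 2 * e \<in> bD J")
      case True
      then obtain x where x: "x \<in> bE I" "x + 2 * e \<in> bD J" by blast
      have "(x, x) \<in> I" "shift_pt (2 * e) (x, x) \<in> J"
        using x EE[OF t(1) x(1)] DD'[OF t(2) x(2)] t LR e unfolding shift_pt_pair Ib(5) Jb(5) by auto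
      then show ?thesis by blast
    next
      case False
      have sep: "y \<le> x + 2 * e" if "x \<in> bE I" "y \<in> bD J" for x y
        using False that downsetD[OF Jb(2), of y "x + 2 * e"] by force
      have b: "b \<in> bE I" "b + 2 * d \<in> bD I" and b': "b' \<in> bE J" "b' + 2 * d \<in> bD J"
        using P Q t LR by simp_all
      have "Sup (ereal ` bD J) \<le> ereal (b + 2 * e)" using sep[OF b(1)] by (intro Sup_least) auto
      also have "\<dots> < ereal (b + 2 * d)" using e by simp
      also have "\<dots> \<le> Sup (ereal ` bD I)" using b(2) by (intro Sup_upper) blast
      finally have v: "vv J < vv I" using t LR by (simp add: vv_def)
      have "Inf (ereal ` bE J) \<le> ereal b'" using b'(1) by (intro Inf_lower) blast
      also have "\<dots> < ereal (b' + 2 * d - 2 * e)" using e by simp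
      also have "\<dots> \<le> Inf (ereal ` bE I)" using sep[OF _ b'(2)] by (intro Inf_greatest) fastforce
      finally show ?thesis using v t LR by (simp add: uu_def)
    qed
  next
    assume t: "\<not> bL J" "bR J"
    show ?thesis
    proof (cases "\<exists>x\<in>bD I. x - 2 * e \<in> bE J")
      case True
      then obtain x where x: "x \<in> bD I" "x - 2 * e \<in> bE J" by blast
      have "(x, x) \<in> I" "shift_pt (2 * e) (x, x) \<in> J"
        using x DD[OF t(2) x(1)] EE'[OF t(1) x(2)] t LR e unfolding shift_pt_pair Ib(5) Jb(5) by auto
      then show ?thesis by blast
    next
      case False
      have sep: "x - 2 * e \<le> y" if "x \<in> bD I" "y \<in> bE J" for x y
        using False that upsetD[OF Jb(1), of y "x - 2 * e"] by force
      have a: "a \<in> bD I" "a - 2 * d \<in> bE I" and a': "a' \<in> bD J" "a' - 2 * d \<in> bE J"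
        using P Q t LR by simp_all
      have "Inf (ereal ` bE I) \<le> ereal (a - 2 * d)" using a(2) by (intro Inf_lower) blast
      also have "\<dots> < ereal (a - 2 * e)" using e by simp
      also have "\<dots> \<le> Inf (ereal ` bE J)" using sep[OF a(1)] by (intro Inf_greatest) auto
      finally have u: "uu J < uu I" using t LR by (simp add: uu_def)
      have "Sup (ereal ` bD I) \<le> ereal (a' - 2 * d + 2 * e)" using sep[OF _ a'(2)] by (intro Sup_least) fastforce
      also have "\<dots> < ereal a'" using e by simp
      also have "\<dots> \<le> Sup (ereal ` bD J)" using a'(1) by (intro Sup_upper) blast
      finally show ?thesis using u t LR by (simp add: vv_def)
    qed
  qed
qed

text \<open>Closeness gives \<open>homc\<close> in both directions, so the way from \<open>I\<close>
  through \<open>K\<close> back to \<open>I\<close> is an instance of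
  \<open>homc_middle\<close>.\<close>

lemma close_mem:
  assumes I: "is_block I" and K: "is_block K" and c: "close d I K" and d: "0 \<le> d"
    and p: "p \<in> I" "shift_pt (2 * d) p \<in> I"
  shows "shift_pt d p \<in> K"
proof -
  have "homc d I K" "homc d K I" using c by (auto simp: homc_def close_def)
  then show ?thesis using homc_middle[OF I K I _ _ _ _ _ _ p d] c by (simp add: close_def)
qed

text \<open>The morphism is the identity wherever both fibres are nonzero. It is natural because a
  comparison that starts in \<open>I\<close> and ends in the shifted \<open>K\<close> has both its
  points in both sets, which is \<open>key\<close>.\<close>

lemma close_hom:
  assumes I: "is_block I" and K: "is_block K" and c: "close d I K" and d: "0 \<le> d"
  shows "pmod_hom UNIV (interval_module I :: ('k::field, 'k) pmod) (shift d (interval_module K))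
     (\<lambda>a v. if a \<in> I \<and> shift_pt d a \<in> K then v else 0)"
proof -
  have key: "q \<in> I \<and> shift_pt d p \<in> K" if p: "p \<in> I" "p \<preceq> q" "shift_pt d q \<in> K" for p q
  proof -
    obtain a b where pab: "p = (a, b)" by (cases p)
    obtain a' b' where qab: "q = (a', b')" by (cases q)
    have le: "a' \<le> a" "b \<le> b'" using p(2) by (simp_all add: pab qab opp_le_def)
    have P: "a \<le> b" "(if bL I then b else a) \<in> bE I" "(if bR I then a else b) \<in> bD I"
      using p(1) unfolding pab block_params(5)[OF I] by blast+
    have Q: "(if bL I then b' + d else a' - d) \<in> bE K" "(if bR I then a' - d else b' + d) \<in> bD K"
      using p(3) c unfolding qab shift_pt_pair block_params(5)[OF K] close_def by simp_all
    have E: "(if bL I then b' else a') \<in> bE I \<and> (if bL I then b + d else a - d) \<in> bE K"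
    proof (cases "bL I")
      case True
      then show ?thesis using P(2) c upsetD[OF block_params(1)[OF I], of b b'] le by (simp add: close_def)
    next
      case False
      then have "a' - d \<in> bE K" using Q(1) by simp
      then have "a' - d + d \<in> bE I" using c unfolding close_def by blast
      then show ?thesis using False Q(1) upsetD[OF block_params(1)[OF K], of "a' - d" "a - d"] le by simp
    qed
    have D: "(if bR I then a' else b') \<in> bD I \<and> (if bR I then a - d else b + d) \<in> bD K"
    proof (cases "bR I")
      case True
      then show ?thesis using P(3) c downsetD[OF block_params(2)[OF I], of a a'] le by (simp add: close_def)
    next
      case False
      then have "b' + d \<in> bD K" using Q(2) by simp
      then have "b' + d - d \<in> bD I" using c unfolding close_def by blast
      then show ?thesis using False Q(2) downsetD[OF block_params(2)[OF K], of "b' + d" "b + d"] le by simp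
    qed
    show ?thesis using E D P(1) le d c
      unfolding pab qab shift_pt_pair block_params(5)[OF I] block_params(5)[OF K] close_def by simp
  qed
  show ?thesis
    unfolding pmod_hom_def shift_sel interval_module_sel
  proof (intro conjI ballI impI)
    fix a b :: pt and v :: 'k assume ab: "a \<preceq> b" and v: "v \<in> (if a \<in> I then UNIV else {0})"
    show "(if b \<in> I \<and> shift_pt d b \<in> K then if a \<in> I \<and> b \<in> I then v else 0 else 0) =
      (if shift_pt d a \<in> K \<and> shift_pt d b \<in> K then if a \<in> I \<and> shift_pt d a \<in> K then v else 0 else 0)"
      using key[OF _ ab] v by (cases "a \<in> I") auto
  qed (simp add: lin_map_def)
qed

lemma close_interleaved:
  assumes I: "is_block I" and K: "is_block K" and c: "close d I K" and d: "0 \<le> d"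
  shows "interleaved d (interval_module I :: ('k::field, 'k) pmod) (interval_module K :: ('k, 'k) pmod)"
  unfolding interleaved_def
proof (intro exI conjI allI ballI)
  let ?f = "\<lambda>a (v :: 'k). if a \<in> I \<and> shift_pt d a \<in> K then v else 0"
  let ?g = "\<lambda>a (v :: 'k). if a \<in> K \<and> shift_pt d a \<in> I then v else 0"
  show "pmod_hom UNIV (interval_module I) (shift d (interval_module K)) ?f"
    by (rule close_hom[OF I K c d])
  show "pmod_hom UNIV (interval_module K) (shift d (interval_module I)) ?g"
    by (rule close_hom[OF K I close_sym[OF c] d])
  show "?g (shift_pt d a) (?f a v) = shift_map (2 * d) (interval_module I) a v"
    if "v \<in> fib (interval_module I) a" for a and v :: 'k
    using that close_mem[OF I K c d, of a] by (auto simp: interval_module_sel shift_map_def shift_pt_shift_pt)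
  show "?f (shift_pt d a) (?g a v) = shift_map (2 * d) (interval_module K) a v"
    if "v \<in> fib (interval_module K) a" for a and v :: 'k
    using that close_mem[OF K I close_sym[OF c] d, of a] by (auto simp: interval_module_sel shift_map_def shift_pt_shift_pt)
qed

section \<open>From interleavings to matchings\<close>

lemma unit_at_imap:
  assumes "x \<in> bars C"
  shows "imap (bsum C) p q (unit_at x) = (if p \<in> fst x \<and> q \<in> fst x then unit_at x else (0 :: pt set \<times> nat \<Rightarrow> 'k::field))"
  unfolding bsum_def dsum_interval_sel using assms by (auto simp: unit_at_def fun_eq_iff)

lemma bsum_imap: "imap (bsum C) p q f y = (if y \<in> bars C \<and> p \<in> fst y \<and> q \<in> fst y then f y else 0)"
  unfolding bsum_def dsum_interval_sel by simp

lemma bars_block: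
  assumes "\<And>J. 0 < C J \<Longrightarrow> is_block J" "x \<in> bars C"
  shows "is_block (fst x)"
proof (rule assms(1))
  show "0 < C (fst x)" using assms(2) by (cases x) (auto simp: bars_def)
qed

text \<open>If a bar and the shifted other bar have no common point, the entry is set to 0, so that
  a nonzero entry always comes with \<open>homc\<close>.\<close>

lemma matrix_of_hom:
  fixes f :: "pt \<Rightarrow> (pt set \<times> nat \<Rightarrow> 'k::field) \<Rightarrow> (pt set \<times> nat \<Rightarrow> 'k)"
  assumes f: "pmod_hom UNIV (bsum C) (shift e (bsum D)) f"
    and C: "\<And>J. 0 < C J \<Longrightarrow> is_block J" and D: "\<And>J. 0 < D J \<Longrightarrow> is_block J" and e: "0 \<le> e"
  shows "\<exists>w. \<forall>x\<in>bars C. \<forall>y\<in>bars D.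
     (\<forall>p. p \<in> fst x \<longrightarrow> shift_pt e p \<in> fst y \<longrightarrow> f p (unit_at x) y = w x y) \<and>
     (w x y \<noteq> 0 \<longrightarrow> homc e (fst x) (fst y))"
proof -
  have u: "unit_at x \<in> fib (bsum C :: ('k, pt set \<times> nat \<Rightarrow> 'k) pmod) p" if "x \<in> bars C" "p \<in> fst x" for x p
    unfolding bsum_def by (rule unit_at_fib) (use that in simp_all)
  have f0: "f p 0 = 0" for p
  proof -
    have lin: "lin_map (scl (bsum C)) (scl (bsum D)) (fib (bsum C) p) (fib (bsum D) (shift_pt e p)) (f p)"
      using pmod_homD(1)[OF f UNIV_I] unfolding shift_sel .
    show ?thesis
      using lin_map_sum[OF vector_space_fun vector_space_fun subspace_dsum_fib lin[unfolded bsum_def dsum_interval_sel], of "{}" undefined]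
      by simp
  qed
  have nat: "f q (imap (bsum C) p q (unit_at x)) y = (if shift_pt e p \<in> fst y \<and> shift_pt e q \<in> fst y then f p (unit_at x) y else 0)"
    if "x \<in> bars C" "y \<in> bars D" "p \<in> fst x" "p \<preceq> q" for x y p q
  proof -
    have "f q (imap (bsum C) p q (unit_at x)) = imap (bsum D) (shift_pt e p) (shift_pt e q) (f p (unit_at x))"
      using pmod_homD(2)[OF f UNIV_I UNIV_I that(4) u[OF that(1,3)]] unfolding shift_sel .
    then show ?thesis using that(2) by (simp add: bsum_imap)
  qed
  have "\<exists>w. (\<forall>p. p \<in> fst x \<longrightarrow> shift_pt e p \<in> fst y \<longrightarrow> f p (unit_at x) y = w) \<and> (w \<noteq> 0 \<longrightarrow> homc e (fst x) (fst y))"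
    if x: "x \<in> bars C" and y: "y \<in> bars D" for x y
  proof (cases "\<exists>p. p \<in> fst x \<and> shift_pt e p \<in> fst y")
    case True
    then obtain p where p: "p \<in> fst x" "shift_pt e p \<in> fst y" by blast
    have bx: "is_block (fst x)" by (rule bars_block[OF C x])
    have byy: "is_block (fst y)" by (rule bars_block[OF D y])
    let ?c = "\<lambda>p. f p (unit_at x) y"
    have N1: "?c p = ?c q"
      if "p \<preceq> q" "p \<in> fst x" "q \<in> fst x" "shift_pt e p \<in> fst y" "shift_pt e q \<in> fst y" for p q
      using nat[OF x y that(2,1)] that unfolding unit_at_imap[OF x] by simp
    have N2: "?c p = 0"
      if "p \<preceq> q" "p \<in> fst x" "q \<notin> fst x" "shift_pt e p \<in> fst y" "shift_pt e q \<in> fst y" for p q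
      using nat[OF x y that(2,1)] that f0[of q] unfolding unit_at_imap[OF x] by simp
    have N3: "?c p = 0"
      if "q \<preceq> p" "p \<in> fst x" "q \<in> fst x" "shift_pt e p \<in> fst y" "shift_pt e q \<notin> fst y" for p q
      using nat[OF x y that(3,1)] that unfolding unit_at_imap[OF x] by simp
    have const: "?c p = ?c q" if "q \<in> fst x" "shift_pt e q \<in> fst y" for q
      by (rule hom_coefficients(1)[where c = ?c and I = "fst x" and K = "fst y" and p = p, OF bx byy e])
        (rule p that | (rule N1; assumption) | (rule N2; assumption) | (rule N3; assumption))+
    have nz: "homc e (fst x) (fst y)" if "?c p \<noteq> 0"
      by (rule hom_coefficients(2)[where c = ?c and I = "fst x" and K = "fst y" and p = p, OF bx byy e])
        (rule p that | (rule N1; assumption) | (rule N2; assumption) | (rule N3; assumption))+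
    show ?thesis
    proof (intro exI[of _ "?c p"] conjI allI impI)
      fix q assume "q \<in> fst x" "shift_pt e q \<in> fst y"
      then show "?c q = ?c p" using const[of q] by simp
    next
      assume "?c p \<noteq> 0" then show "homc e (fst x) (fst y)" by (rule nz)
    qed
  next
    case False then show ?thesis by (intro exI[of _ 0]) blast
  qed
  then show ?thesis by metis
qed

lemma not_trivialD:
  assumes "\<not> trivial_interval TYPE('k::field) (2 * d) J"
  shows "\<exists>p. p \<in> J \<and> shift_pt (2 * d) p \<in> J"
  using assms unfolding trivial_interval_def shift_map_def interval_module_sel by (metis (full_types))

text \<open>By \<open>close_mem\<close> all these bars pass through one common point.\<close>

lemma finite_close:
  assumes D: "\<And>p. finite {y \<in> bars D. p \<in> fst y}" "\<And>J. 0 < D J \<Longrightarrow> is_block J"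
    and I: "is_block I" and d: "0 \<le> d" and p: "p \<in> I" "shift_pt (2 * d) p \<in> I"
  shows "finite {y \<in> bars D. close d I (fst y)}"
proof (rule finite_subset[OF _ D(1)])
  show "{y \<in> bars D. close d I (fst y)} \<subseteq> {y \<in> bars D. shift_pt d p \<in> fst y}"
    using close_mem[OF I bars_block[OF D(2)] _ d p] by blast
qed

text \<open>The interleaving identity is evaluated at \<open>p\<close> on the unit vector of
  \<open>x\<close>, and the component at \<open>z\<close> is read off; internal maps of a sum of
  interval modules are diagonal. \<open>out\<close> allows the sum to run over a prescribed finite
  set of bars.\<close>

lemma composite_coefficients:
  fixes f g :: "pt \<Rightarrow> (pt set \<times> nat \<Rightarrow> 'k::field) \<Rightarrow> (pt set \<times> nat \<Rightarrow> 'k)"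
  assumes f: "pmod_hom UNIV (bsum C) (shift e (bsum D)) f" and g: "pmod_hom UNIV (bsum D) (shift e (bsum C)) g"
    and gf: "\<And>a v. v \<in> fib (bsum C) a \<Longrightarrow> g (shift_pt e a) (f a v) = shift_map (2 * e) (bsum C) a v"
    and x: "x \<in> bars C" and z: "z \<in> bars C" and p: "p \<in> fst x" "shift_pt (2 * e) p \<in> fst z"
    and N: "finite N" "N \<subseteq> {y \<in> bars D. shift_pt e p \<in> fst y}"
    and out: "\<And>y. y \<in> bars D \<Longrightarrow> shift_pt e p \<in> fst y \<Longrightarrow> y \<notin> N \<Longrightarrow>
        f p (unit_at x) y * g (shift_pt e p) (unit_at y) z = 0"
  shows "(\<Sum>y\<in>N. f p (unit_at x) y * g (shift_pt e p) (unit_at y) z) = (if x = z then 1 else 0)"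
proof -
  let ?q = "shift_pt e p" and ?h = "f p (unit_at x)"
  let ?t = "\<lambda>y. ?h y * g ?q (unit_at y) z"
  have u: "unit_at x \<in> fib (bsum C :: ('k, pt set \<times> nat \<Rightarrow> 'k) pmod) p"
    unfolding bsum_def by (rule unit_at_fib) (use x p in simp_all)
  have h: "?h \<in> fib (dsum (bars D) (\<lambda>x. interval_module (fst x))) ?q"
    using pmod_homD(3)[OF f UNIV_I u] unfolding shift_sel bsum_def .
  define S where "S = {y. ?h y \<noteq> 0}"
  have S: "finite S" "\<And>y. y \<in> S \<Longrightarrow> y \<in> bars D \<and> ?q \<in> fst y"
    using dsum_interval_fibD[OF h] unfolding S_def by blast+
  have lin: "lin_map (scl (dsum (bars D) (\<lambda>x. interval_module (fst x)))) (scl (dsum (bars C) (\<lambda>x. interval_module (fst x))))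
      (fib (dsum (bars D) (\<lambda>x. interval_module (fst x))) ?q) (fib (bsum C) (shift_pt e ?q)) (g ?q)"
    using pmod_homD(1)[OF g UNIV_I, of ?q] unfolding shift_sel bsum_def .
  have "?h = (\<lambda>y. if y \<in> S then ?h y else 0)" by (auto simp: S_def fun_eq_iff)
  then have "g ?q ?h z = g ?q (\<lambda>y. if y \<in> S then ?h y else 0) z" by (rule arg_cong)
  also have "\<dots> = (\<Sum>y\<in>S. ?t y)" by (rule lin_map_combination(2)[OF lin S])
  finally have "(\<Sum>y\<in>S. ?t y) = g ?q ?h z" ..
  also have "\<dots> = shift_map (2 * e) (bsum C) p (unit_at x) z" using gf[OF u] by simp
  also have "\<dots> = (if shift_pt (2 * e) p \<in> fst x then unit_at x z else 0)"
    unfolding shift_map_def unit_at_imap[OF x] using p(1) by simp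
  also have "\<dots> = (if x = z then 1 else 0)"
    using p(2) by (cases "x = z") (simp_all add: unit_at_def)
  finally have S1: "(\<Sum>y\<in>S. ?t y) = (if x = z then 1 else 0)" .
  have "(\<Sum>y\<in>N. ?t y) = (\<Sum>y\<in>S \<union> N. ?t y)"
  proof (rule sum.mono_neutral_left)
    show "\<forall>y\<in>S \<union> N - N. ?t y = 0"
    proof
      fix y assume "y \<in> S \<union> N - N"
      then have "y \<in> S" "y \<notin> N" by blast+
      then show "?t y = 0" using out S(2) by blast
    qed
  qed (use S N in simp_all)
  also have "\<dots> = (\<Sum>y\<in>S. ?t y)"
    by (rule sum.mono_neutral_right) (use S N in \<open>auto simp: S_def\<close>)
  finally show ?thesis using S1 by simp
qed

text \<open>
  The rank argument: ordering the intervals of \<open>A\<close> by \<open>\<alpha>\<close>, the matrix of the composite of the two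
  interleaving morphisms, restricted to the intervals of \<open>N\<close>, is unitriangular, because a chain of
  nonzero morphisms through an interval close to neither end strictly decreases \<open>\<alpha>\<close>.
\<close>

lemma rank_bound_typed:
  fixes f g :: "pt \<Rightarrow> (pt set \<times> nat \<Rightarrow> 'k::field) \<Rightarrow> (pt set \<times> nat \<Rightarrow> 'k)"
  assumes f: "pmod_hom UNIV (bsum C) (shift e (bsum D)) f" and g: "pmod_hom UNIV (bsum D) (shift e (bsum C)) g"
    and gf: "\<And>a v. v \<in> fib (bsum C) a \<Longrightarrow> g (shift_pt e a) (f a v) = shift_map (2 * e) (bsum C) a v"
    and C: "\<And>J. 0 < C J \<Longrightarrow> is_block J" and D: "\<And>J. 0 < D J \<Longrightarrow> is_block J"
    and D_fin: "\<And>p. finite {y \<in> bars D. p \<in> fst y}"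
    and e: "0 \<le> e" "e < d"
    and A: "finite A" "A \<subseteq> {x \<in> bars C. \<not> trivial_interval TYPE('k) (2 * d) (fst x)}"
    and type: "\<And>x. x \<in> A \<Longrightarrow> bL (fst x) = l \<and> bR (fst x) = r"
  shows "card A \<le> card (\<Union>x\<in>A. {y \<in> bars D. close d (fst x) (fst y)})"
proof (rule ccontr)
  define N where "N = (\<Union>x\<in>A. {y \<in> bars D. close d (fst x) (fst y)})"
  have d: "0 \<le> d" using e by simp
  have AC: "x \<in> bars C" and Ab: "is_block (fst x)" if "x \<in> A" for x
    using that A(2) bars_block[OF C] by blast+
  have Db: "is_block (fst y)" if "y \<in> bars D" for y by (rule bars_block[OF D that])
  have nt: "\<exists>p. p \<in> fst x \<and> shift_pt (2 * d) p \<in> fst x" if "x \<in> A" for x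
    using that A(2) not_trivialD by blast
  have finN: "finite N"
    unfolding N_def
  proof (rule finite_UN_I[OF A(1)])
    fix x assume x: "x \<in> A"
    obtain p where p: "p \<in> fst x" "shift_pt (2 * d) p \<in> fst x" using nt[OF x] by blast
    show "finite {y \<in> bars D. close d (fst x) (fst y)}"
      by (rule finite_close[OF D_fin D Ab[OF x] d p])
  qed
  obtain w where w: "\<And>x y p. x \<in> bars C \<Longrightarrow> y \<in> bars D \<Longrightarrow> p \<in> fst x \<Longrightarrow> shift_pt e p \<in> fst y \<Longrightarrow> f p (unit_at x) y = w x y"
    and wh: "\<And>x y. x \<in> bars C \<Longrightarrow> y \<in> bars D \<Longrightarrow> w x y \<noteq> 0 \<Longrightarrow> homc e (fst x) (fst y)"
    using matrix_of_hom[OF f C D e(1)] by metis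
  obtain w' where w': "\<And>x y p. x \<in> bars D \<Longrightarrow> y \<in> bars C \<Longrightarrow> p \<in> fst x \<Longrightarrow> shift_pt e p \<in> fst y \<Longrightarrow> g p (unit_at x) y = w' x y"
    and wh': "\<And>x y. x \<in> bars D \<Longrightarrow> y \<in> bars C \<Longrightarrow> w' x y \<noteq> 0 \<Longrightarrow> homc e (fst x) (fst y)"
    using matrix_of_hom[OF g D C e(1)] by metis
  obtain R1 where R1: "\<forall>x\<in>A. inrange e R1 (uu (fst x))" using inrange_exists[OF A(1) e(1), of "\<lambda>x. uu (fst x)"] by blast
  obtain R2 where R2: "\<forall>x\<in>A. inrange e R2 (vv (fst x))" using inrange_exists[OF A(1) e(1), of "\<lambda>x. vv (fst x)"] by blast
  define R where "R = max R1 R2"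
  have R: "inrange e R (uu (fst x))" "inrange e R (vv (fst x))" if "x \<in> A" for x
    using R1 R2 that unfolding inrange_def R_def by (metis less_max_iff_disj)+
  define \<alpha> where "\<alpha> x = clip R (uu (fst x)) + clip R (vv (fst x))" for x :: "pt set \<times> nat"
  \<comment> \<open>Along a nonzero entry a side can change only from closed to open, so between two
    bars of one type the middle bar has that type too.\<close>
  have types: "bL (fst x) = bL (fst y)" "bR (fst x) = bR (fst y)" "bL (fst y) = bL (fst z)" "bR (fst y) = bR (fst z)"
    if "x \<in> A" "z \<in> A" "homc e (fst x) (fst y)" "homc e (fst y) (fst z)" for x y z
    using type[OF that(1)] type[OF that(2)] that(3,4) unfolding homc_def by blast+
  \<comment> \<open>A middle bar outside \<open>N\<close> is close to neither end, so
    \<open>\<alpha>\<close> would strictly drop from \<open>x\<close> to \<open>z\<close>, against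
    the assumed order. The same order rules out the second alternative of
    \<open>homc_point\<close>.\<close>
  have chain: "y \<in> N" "\<exists>s. s \<in> fst x \<and> shift_pt (2 * e) s \<in> fst z"
    if xz: "x \<in> A" "z \<in> A" "\<alpha> x \<le> \<alpha> z" and y: "y \<in> bars D" "w x y \<noteq> 0" "w' y z \<noteq> 0" for x y z
  proof -
    have h: "homc e (fst x) (fst y)" "homc e (fst y) (fst z)"
      using wh[OF AC[OF xz(1)] y(1,2)] wh'[OF y(1) AC[OF xz(2)] y(3)] .
    note t = types[OF xz(1,2) h]
    show "y \<in> N"
    proof (rule ccontr)
      assume n: "y \<notin> N"
      then have nc: "\<not> close d (fst x) (fst y)" "\<not> close d (fst y) (fst z)"
        using xz y(1) close_sym unfolding N_def by blast+
      have "clip R (uu (fst z)) + clip R (vv (fst z)) < clip R (uu (fst x)) + clip R (vv (fst x))"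
        by (rule clip_sum_decreases[OF e(1) R[OF xz(1)] R[OF xz(2)] homc_coords[OF h(1) t(1,2)] homc_coords[OF h(2) t(3,4)]
            not_close_coords[OF Ab[OF xz(1)] Db[OF y(1)] h(1) t(1,2) nc(1) e(2)]
            not_close_coords[OF Db[OF y(1)] Ab[OF xz(2)] h(2) t(3,4) nc(2) e(2)]])
      then show False using xz(3) by (simp add: \<alpha>_def)
    qed
    obtain p where p: "p \<in> fst x" "shift_pt (2 * d) p \<in> fst x" using nt[OF xz(1)] by blast
    obtain q where q: "q \<in> fst z" "shift_pt (2 * d) q \<in> fst z" using nt[OF xz(2)] by blast
    have "\<not> (uu (fst z) < uu (fst x) \<and> vv (fst z) < vv (fst x))"
    proof
      assume "uu (fst z) < uu (fst x) \<and> vv (fst z) < vv (fst x)"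
      then have "\<alpha> z < \<alpha> x" unfolding \<alpha>_def
        using clip_less0[OF e(1) R(1)[OF xz(1)] R(1)[OF xz(2)]] clip_less0[OF e(1) R(2)[OF xz(1)] R(2)[OF xz(2)]]
        by (intro add_strict_mono) blast+
      then show False using xz(3) by simp
    qed
    then show "\<exists>s. s \<in> fst x \<and> shift_pt (2 * e) s \<in> fst z"
      using homc_point[OF Ab[OF xz(1)] Db[OF y(1)] Ab[OF xz(2)] h t e p q] by blast
  qed
  have entry: "(\<Sum>y\<in>N. w x y * w' y z) = (if x = z then 1 else 0)"
    if xz: "x \<in> A" "z \<in> A" "\<alpha> x \<le> \<alpha> z" for x z
  proof (cases "\<exists>s. s \<in> fst x \<and> shift_pt (2 * e) s \<in> fst z")
    case True
    then obtain s where s: "s \<in> fst x" "shift_pt (2 * e) s \<in> fst z" by blast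
    let ?q = "shift_pt e s"
    have sq: "shift_pt e ?q \<in> fst z" using s(2) by (simp add: shift_pt_shift_pt)
    let ?N = "{y \<in> N. ?q \<in> fst y}"
    have mid: "?q \<in> fst y" if "y \<in> bars D" "w x y \<noteq> 0" "w' y z \<noteq> 0" for y
    proof -
      have h: "homc e (fst x) (fst y)" "homc e (fst y) (fst z)"
        using wh[OF AC[OF xz(1)] that(1,2)] wh'[OF that(1) AC[OF xz(2)] that(3)] .
      show ?thesis
        by (rule homc_middle[OF Ab[OF xz(1)] Db[OF that(1)] Ab[OF xz(2)] h types[OF xz(1,2) h] s e(1)])
    qed
    have ND: "N \<subseteq> bars D" unfolding N_def by blast
    have val: "f s (unit_at x) y * g ?q (unit_at y) z = w x y * w' y z" if "y \<in> bars D" "?q \<in> fst y" for y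
      using w[OF AC[OF xz(1)] that(1) s(1) that(2)] w'[OF that(1) AC[OF xz(2)] that(2) sq] by simp
    have "(\<Sum>y\<in>N. w x y * w' y z) = (\<Sum>y\<in>?N. w x y * w' y z)"
      by (rule sum.mono_neutral_right[OF finN]) (use mid ND in auto)
    also have "\<dots> = (\<Sum>y\<in>?N. f s (unit_at x) y * g ?q (unit_at y) z)"
      by (rule sum.cong[OF refl]) (use val ND in auto)
    also have "\<dots> = (if x = z then 1 else 0)"
    proof (rule composite_coefficients[OF f g gf AC[OF xz(1)] AC[OF xz(2)] s])
      show "finite ?N" using finN by simp
      show "?N \<subseteq> {y \<in> bars D. ?q \<in> fst y}" using ND by blast
      fix y assume y: "y \<in> bars D" "?q \<in> fst y" "y \<notin> ?N"
      then have "y \<notin> N" by blast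
      then have "w x y = 0 \<or> w' y z = 0" using chain(1)[OF xz y(1)] by blast
      then show "f s (unit_at x) y * g ?q (unit_at y) z = 0" unfolding val[OF y(1,2)] by auto
    qed
    finally show ?thesis .
  next
    \<comment> \<open>Without a test point all products vanish by \<open>chain\<close>. The diagonal
      case cannot occur, since a bar surviving \<open>2 * d\<close> also survives
      \<open>2 * e\<close>.\<close>
    case False
    have "w x y * w' y z = 0" if "y \<in> N" for y
      using chain(2)[OF xz, of y] False that unfolding N_def by fastforce
    then have "(\<Sum>y\<in>N. w x y * w' y z) = 0" by (intro sum.neutral) blast
    moreover have "x \<noteq> z"
    proof
      assume "x = z"
      obtain p where p: "p \<in> fst x" "shift_pt (2 * d) p \<in> fst x" using nt[OF xz(1)] by blast
      obtain a b where ab: "p = (a, b)" by (cases p)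
      note bp = block_params[OF Ab[OF xz(1)]]
      note P = p[unfolded ab shift_pt_pair bp(5)]
      have "shift_pt (2 * e) p \<in> fst x"
        using P e upsetD[OF bp(1), of b "b + 2 * e"] upsetD[OF bp(1), of "a - 2 * d" "a - 2 * e"]
          downsetD[OF bp(2), of a "a - 2 * e"] downsetD[OF bp(2), of "b + 2 * d" "b + 2 * e"]
        unfolding ab shift_pt_pair bp(5) by auto
      then show False using False p(1) \<open>x = z\<close> by blast
    qed
    ultimately show ?thesis by simp
  qed
  assume "\<not> card A \<le> card (\<Union>x\<in>A. {y \<in> bars D. close d (fst x) (fst y)})"
  then have "card N < card A" by (simp add: N_def)
  then obtain c where c: "\<exists>x\<in>A. c x \<noteq> 0" "\<forall>y\<in>N. (\<Sum>x\<in>A. c x * w x y) = 0"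
    using homogeneous_system[OF finN A(1), of w] by blast
  \<comment> \<open>Entries are known only in the order of \<open>\<alpha>\<close>. Pairing the
    relation with a bar \<open>z\<close> of maximal \<open>\<alpha>\<close> among those with nonzero
    coefficient involves just these, and it collapses to \<open>c z = 0\<close>.\<close>
  let ?A = "{x \<in> A. c x \<noteq> 0}"
  have "finite ?A" "?A \<noteq> {}" using A(1) c(1) by auto
  then have "Max (\<alpha> ` ?A) \<in> \<alpha> ` ?A" by (intro Max_in) auto
  then obtain z where z: "z \<in> ?A" "\<alpha> z = Max (\<alpha> ` ?A)" by (auto simp del: Max_in)
  have zmax: "\<alpha> x \<le> \<alpha> z" if "x \<in> ?A" for x
    unfolding z(2) using that \<open>finite ?A\<close> by (intro Max_ge) auto
  have "0 = (\<Sum>y\<in>N. (\<Sum>x\<in>A. c x * w x y) * w' y z)" using c(2) by simp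
  also have "\<dots> = (\<Sum>y\<in>N. \<Sum>x\<in>A. c x * (w x y * w' y z))" by (simp add: sum_distrib_right mult.assoc)
  also have "\<dots> = (\<Sum>x\<in>A. \<Sum>y\<in>N. c x * (w x y * w' y z))" by (rule sum.swap)
  also have "\<dots> = (\<Sum>x\<in>A. c x * (\<Sum>y\<in>N. w x y * w' y z))" by (simp add: sum_distrib_left)
  also have "\<dots> = (\<Sum>x\<in>A. if x = z then c z else 0)"
  proof (rule sum.cong[OF refl])
    fix x assume x: "x \<in> A"
    show "c x * (\<Sum>y\<in>N. w x y * w' y z) = (if x = z then c z else 0)"
    proof (cases "c x = 0")
      case True then show ?thesis using z(1) by auto
    next
      case False
      then have "(\<Sum>y\<in>N. w x y * w' y z) = (if x = z then 1 else 0)"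
        using entry[of x z] zmax[of x] x z(1) by blast
      then show ?thesis by simp
    qed
  qed
  also have "\<dots> = c z" using A(1) z(1) by simp
  finally show False using z(1) by simp
qed

text \<open>\<open>close\<close> preserves the type, so bars of different types have disjoint sets
  of partners and the bounds for the four types add up.\<close>

lemma rank_bound:
  fixes C D :: barcode
  assumes I: "interleaved e (bsum C :: ('k::field, pt set \<times> nat \<Rightarrow> 'k) pmod) (bsum D :: ('k, pt set \<times> nat \<Rightarrow> 'k) pmod)"
    and C: "\<And>J. 0 < C J \<Longrightarrow> is_block J" and D: "\<And>J. 0 < D J \<Longrightarrow> is_block J"
    and D_fin: "\<And>p. finite {y \<in> bars D. p \<in> fst y}"
    and e: "0 \<le> e" "e < d"
    and A: "finite A" "A \<subseteq> {x \<in> bars C. \<not> trivial_interval TYPE('k) (2 * d) (fst x)}"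
  shows "card A \<le> card (\<Union>x\<in>A. {y \<in> bars D. close d (fst x) (fst y)})"
proof -
  obtain f g where f: "pmod_hom UNIV (bsum C) (shift e (bsum D)) f" and g: "pmod_hom UNIV (bsum D) (shift e (bsum C)) g"
    and gf: "\<And>a v. v \<in> fib (bsum C :: ('k, pt set \<times> nat \<Rightarrow> 'k) pmod) a \<Longrightarrow> g (shift_pt e a) (f a v) = shift_map (2 * e) (bsum C) a v"
    using I unfolding interleaved_def by blast
  define B where "B t = {x \<in> A. (bL (fst x), bR (fst x)) = t}" for t
  define N where "N x = {y \<in> bars D. close d (fst x) (fst y)}" for x :: "pt set \<times> nat"
  have finN: "finite (N x)" if "x \<in> A" for x
  proof -
    have nt: "\<not> trivial_interval TYPE('k) (2 * d) (fst x)" and x: "x \<in> bars C" using that A(2) by blast+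
    obtain p where p: "p \<in> fst x" "shift_pt (2 * d) p \<in> fst x" using not_trivialD[OF nt] by blast
    show ?thesis unfolding N_def
      by (rule finite_close[OF D_fin D bars_block[OF C x] _ p]) (use e in simp_all)
  qed
  have typed: "card (B t) \<le> card (\<Union>x\<in>B t. N x)" for t
    unfolding N_def
  proof (rule rank_bound_typed[OF f g gf C D D_fin e])
    show "finite (B t)" using A(1) by (simp add: B_def)
    show "B t \<subseteq> {x \<in> bars C. \<not> trivial_interval TYPE('k) (2 * d) (fst x)}" using A(2) by (auto simp: B_def)
    show "bL (fst x) = fst t \<and> bR (fst x) = snd t" if "x \<in> B t" for x using that by (auto simp: B_def)
  qed
  have finB: "finite (B t)" for t using A(1) by (simp add: B_def)
  have finNB: "finite (\<Union>x\<in>B t. N x)" for t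
    by (rule finite_UN_I[OF finB finN]) (auto simp: B_def)
  have ty: "(bL (fst y), bR (fst y)) = t" if "y \<in> (\<Union>x\<in>B t. N x)" for y t
    using that by (auto simp: B_def N_def close_def)
  have UB: "(\<Union>t\<in>UNIV. B t) = A" by (auto simp: B_def)
  have UN: "(\<Union>t\<in>UNIV. \<Union>x\<in>B t. N x) = (\<Union>x\<in>A. N x)" unfolding UB[symmetric] by blast
  have Bdisj: "B s \<inter> B t = {}" if "s \<noteq> t" for s t using that by (auto simp: B_def)
  have Ndisj: "(\<Union>x\<in>B s. N x) \<inter> (\<Union>x\<in>B t. N x) = {}" if "s \<noteq> t" for s t
  proof (rule equals0I)
    fix y assume "y \<in> (\<Union>x\<in>B s. N x) \<inter> (\<Union>x\<in>B t. N x)"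
    then show False using ty[of y s] ty[of y t] that by simp
  qed
  have "card A = (\<Sum>t\<in>UNIV. card (B t))"
    unfolding UB[symmetric] by (rule card_UN_disjoint) (simp_all add: finB Bdisj)
  also have "\<dots> \<le> (\<Sum>t\<in>UNIV. card (\<Union>x\<in>B t. N x))" by (intro sum_mono typed)
  also have "\<dots> = card (\<Union>x\<in>A. N x)"
    unfolding UN[symmetric] by (rule card_UN_disjoint[symmetric]) (use finNB Ndisj in simp_all)
  finally show ?thesis unfolding N_def .
qed

lemma interleaved_sym: "interleaved e M N \<Longrightarrow> interleaved e N M"
  unfolding interleaved_def by blast

lemma one_sided_matching:
  fixes C D :: barcode
  assumes I: "interleaved e (bsum C :: ('k::field, pt set \<times> nat \<Rightarrow> 'k) pmod) (bsum D :: ('k, pt set \<times> nat \<Rightarrow> 'k) pmod)"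
    and C: "\<And>J. 0 < C J \<Longrightarrow> is_block J"
    and D: "\<And>J. 0 < D J \<Longrightarrow> is_block J" "\<And>p. finite {y \<in> bars D. p \<in> fst y}"
    and e: "0 \<le> e" "e < d"
  shows "\<exists>h. inj_on h {x \<in> bars C. \<not> trivial_interval TYPE('k) (2 * d) (fst x)} \<and>
      (\<forall>x\<in>{x \<in> bars C. \<not> trivial_interval TYPE('k) (2 * d) (fst x)}. h x \<in> {y \<in> bars D. close d (fst x) (fst y)})"
proof (rule marriage)
  fix x assume x: "x \<in> {x \<in> bars C. \<not> trivial_interval TYPE('k) (2 * d) (fst x)}"
  then have nt: "\<not> trivial_interval TYPE('k) (2 * d) (fst x)" and xC: "x \<in> bars C" by blast+
  obtain p where p: "p \<in> fst x" "shift_pt (2 * d) p \<in> fst x" using not_trivialD[OF nt] by blast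
  show "finite {y \<in> bars D. close d (fst x) (fst y)}"
    by (rule finite_close[OF D(2,1) bars_block[OF C xC] _ p]) (use e in simp_all)
next
  fix A assume A: "finite A" "A \<subseteq> {x \<in> bars C. \<not> trivial_interval TYPE('k) (2 * d) (fst x)}"
  show "card A \<le> card (\<Union>x\<in>A. {y \<in> bars D. close d (fst x) (fst y)})"
    by (rule rank_bound[OF I C D e]) (use A in simp_all)
qed

text \<open>Each one-sided injection covers the bars that must be matched in one barcode but may hit
  trivial bars of the other; \<open>combine_injections\<close> merges the two.\<close>

lemma interleaved_matching:
  fixes C D :: barcode
  assumes I: "interleaved e (bsum C :: ('k::field, pt set \<times> nat \<Rightarrow> 'k) pmod) (bsum D :: ('k, pt set \<times> nat \<Rightarrow> 'k) pmod)"
    and C: "\<And>J. 0 < C J \<Longrightarrow> is_block J" "\<And>p. finite {y \<in> bars C. p \<in> fst y}"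
    and D: "\<And>J. 0 < D J \<Longrightarrow> is_block J" "\<And>p. finite {y \<in> bars D. p \<in> fst y}"
    and e: "0 \<le> e" "e < d"
  shows "\<exists>C' D' \<sigma>. is_matching TYPE('k) d C D C' D' \<sigma>"
proof -
  have d: "0 \<le> d" using e by simp
  let ?X = "{x \<in> bars C. \<not> trivial_interval TYPE('k) (2 * d) (fst x)}"
  let ?Y = "{x \<in> bars D. \<not> trivial_interval TYPE('k) (2 * d) (fst x)}"
  obtain h1 where h1: "inj_on h1 ?X" "\<forall>x\<in>?X. h1 x \<in> {y \<in> bars D. close d (fst x) (fst y)}"
    using one_sided_matching[OF I C(1) D e] by blast
  obtain h2 where h2: "inj_on h2 ?Y" "\<forall>x\<in>?Y. h2 x \<in> {y \<in> bars C. close d (fst x) (fst y)}"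
    using one_sided_matching[OF interleaved_sym[OF I] D(1) C e] by blast
  have "\<exists>A' B' \<sigma>. ?X \<subseteq> A' \<and> A' \<subseteq> bars C \<and> ?Y \<subseteq> B' \<and> B' \<subseteq> bars D \<and> bij_betw \<sigma> A' B' \<and>
     (\<forall>x\<in>A'. x \<in> ?X \<and> \<sigma> x = h1 x \<or> \<sigma> x \<in> ?Y \<and> h2 (\<sigma> x) = x)"
    by (rule combine_injections[OF h1(1) _ h2(1)]) (use h1(2) h2(2) in blast)+
  then obtain A' B' \<sigma> where \<sigma>: "?X \<subseteq> A'" "A' \<subseteq> bars C" "?Y \<subseteq> B'" "B' \<subseteq> bars D" "bij_betw \<sigma> A' B'"
     "\<And>x. x \<in> A' \<Longrightarrow> x \<in> ?X \<and> \<sigma> x = h1 x \<or> \<sigma> x \<in> ?Y \<and> h2 (\<sigma> x) = x" by blast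
  have "intervals_interleaved TYPE('k) d (fst x) (fst (\<sigma> x))" if x: "x \<in> A'" for x
  proof -
    have "\<sigma> x \<in> B'" using \<sigma>(5) x by (rule bij_betwE[THEN bspec])
    then have b: "is_block (fst x)" "is_block (fst (\<sigma> x))"
      using bars_block[OF C(1)] bars_block[OF D(1)] x \<sigma>(2,4) by blast+
    have "close d (fst x) (fst (\<sigma> x))" using \<sigma>(6)[OF x]
    proof
      assume "x \<in> ?X \<and> \<sigma> x = h1 x" then show ?thesis using h1(2) by auto
    next
      assume *: "\<sigma> x \<in> ?Y \<and> h2 (\<sigma> x) = x"
      then have "h2 (\<sigma> x) \<in> {y \<in> bars C. close d (fst (\<sigma> x)) (fst y)}" using h2(2) by blast
      then show ?thesis using * close_sym by auto
    qed
    then show ?thesis unfolding intervals_interleaved_def by (rule close_interleaved[OF b _ d])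
  qed
  then have "is_matching TYPE('k) d C D A' B' \<sigma>" unfolding is_matching_def using \<sigma>(1-5) by blast
  then show ?thesis by blast
qed

text \<open>A matching yields an interleaving with the same parameter, and an interleaving yields
  matchings for all larger parameters, a difference that the infimum does not see.\<close>

theorem zz_distances_eq:
  fixes V :: "('k::field, 'v::ab_group_add) pmod" and W :: "('k, 'w::ab_group_add) pmod"
  assumes V: "is_pmod ZZ V" "pfd ZZ V" and W: "is_pmod ZZ W" "pfd ZZ W"
  shows "zz_interleaving_dist V W = zz_bottleneck_dist V W"
proof -
  let ?C = "barcode_of UU (block_ext V)" and ?D = "barcode_of UU (block_ext W)"
  let ?V = "extend_zero UU (block_ext V)" and ?W = "extend_zero UU (block_ext W)"
  note bV = barcode_block_ext[OF V] and bW = barcode_block_ext[OF W]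
  have bsub: "J \<subseteq> UU" if "is_block J" for J
    using that by (auto simp: is_block_def block_def)
  have pV: "is_pmod UNIV ?V" and pW: "is_pmod UNIV ?W"
    using is_pmod_extend_zero is_pmod_block_ext V(1) W(1) by blast+
  have iV: "pmod_iso UNIV ?V (bsum ?C)"
    by (rule pmod_iso_extend_zero[OF is_pmod_block_ext[OF V(1)] bV(1) bsub[OF bV(2)]])
  have iW: "pmod_iso UNIV ?W (bsum ?D)"
    by (rule pmod_iso_extend_zero[OF is_pmod_block_ext[OF W(1)] bW(1) bsub[OF bW(2)]])
  note il = interleaved_iso[OF _ pV iV pW iW]
  show ?thesis
  proof (rule antisym)
    show "zz_interleaving_dist V W \<le> zz_bottleneck_dist V W"
      unfolding zz_interleaving_dist_def zz_bottleneck_dist_def interleaving_dist_def bottleneck_dist_def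
    proof (rule Inf_superset_mono, clarify)
      fix e C' D' \<sigma> assume "0 \<le> e" "is_matching TYPE('k) e ?C ?D C' D' \<sigma>"
      then show "\<exists>e'. ennreal e = ennreal e' \<and> 0 \<le> e' \<and> interleaved e' ?V ?W"
        using matching_interleaved il by blast
    qed
    show "zz_bottleneck_dist V W \<le> zz_interleaving_dist V W"
      unfolding zz_interleaving_dist_def interleaving_dist_def
    proof (rule Inf_greatest, clarify)
      fix e assume e: "0 \<le> e" and i: "interleaved e ?V ?W"
      show "zz_bottleneck_dist V W \<le> ennreal e"
      proof (rule ennreal_le_epsilon)
        fix t :: real assume t: "0 < t"
        have "\<exists>C' D' \<sigma>. is_matching TYPE('k) (e + t) ?C ?D C' D' \<sigma>"
          using interleaved_matching[OF il[OF e, THEN iffD1, OF i] bV(2,3) bW(2,3) e, of "e + t"] t by simp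
        moreover have "0 \<le> e + t" using e t by simp
        ultimately have "zz_bottleneck_dist V W \<le> ennreal (e + t)"
          unfolding zz_bottleneck_dist_def bottleneck_dist_def by (intro Inf_lower CollectI) blast
        then show "zz_bottleneck_dist V W \<le> ennreal e + ennreal t" using e t by simp
      qed
    qed
  qed
qed

theorem mainTheorem3:
  fixes V :: "('k::field, 'v::ab_group_add) pmod"
    and W :: "('k, 'w::ab_group_add) pmod"
  assumes "is_pmod ZZ V" and "pfd ZZ V"
    and "is_pmod ZZ W" and "pfd ZZ W"
  shows "zz_interleaving_dist V W \<le> zz_bottleneck_dist V W
       \<and> zz_bottleneck_dist V W \<le> ennreal (5 / 2) * zz_interleaving_dist V W"
proof -
  \<comment> \<open>As the two distances agree, only \<open>1 \<le> 5 / 2\<close> is left.\<close>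
  have "1 * zz_interleaving_dist V W \<le> ennreal (5 / 2) * zz_interleaving_dist V W"
    by (intro mult_right_mono) (simp_all flip: ennreal_1 add: ennreal_leI)
  then show ?thesis using zz_distances_eq[OF assms] by simp
qed

end
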